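(* For any $\delta>0$, the set $$\{\lambda\in\sigma(\mathcal L):\Re(\lambda)\ge-\delta\}$$ is finite.
   Context: Setting: $\Omega=\mathbb T^d=(\mathbb R/2\pi\mathbb Z)^d$, $\sigma>0$; $V\in W^{1,\infty}(\Omega)\cap W^{2,p}(\Omega)$ with $p=\max\{d,2+\epsilon\}$ for some $\epsilon>0$; $W\in W^{2,\infty}(\Omega)$ is even in each coordinate; moreover $V,W\in C^2(\Omega)$ and either $W$ is $H$-stable, i.e. $\int_{\Omega\times\Omega}W(x-y)\nu(x)\nu(y)\,dx\,dy\ge0$ for all $\nu\in L^2(\Omega)$, or $\|W\|_\infty<\sigma$. All functions are periodic. $\bar\mu$ is a fixed stationary state: a probability density with $\bar\mu=\frac1Z\exp(-\frac1\sigma(V+W*\bar\mu))$, $Z$ the normalizing constant (so $\bar\mu$ is continuous and bounded above and below by positive constants). $\mathcal L$ is the linearized McKean-Vlasov operator on (complex) $\mathcal X=L^2(\Omega,\bar\mu^{-1})$ (inner product $\int_\Omega f\bar g\,\bar\mu^{-1}dx$) with domain $H^2(\Omega)$: $$\mathcal L y=\nabla\cdot(\sigma\nabla y+y\nabla V)+\nabla\cdot\big(y\,\nabla W*\bar\mu+\bar\mu\,\nabla W*y\big).$$ $\sigma(\mathcal L)$ denotes its spectrum. *)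

theory Defs
  imports "HOL-Analysis.Analysis" "HOL-Probability.Essential_Supremum"
begin

section \<open>The torus\<close>

text \<open>
  A function on the torus \<open>(\<real>/2\<pi>\<int>)^d\<close> is a function on \<open>real^'d\<close> that is \<open>2\<pi>\<close>-periodic in each
  coordinate; \<open>d\<close> is \<open>CARD('d)\<close>.  Integrals, norms and almost-everywhere statements refer to Lebesgue
  measure on the fundamental domain \<open>[0,2\<pi>)^d\<close>.  Elements of the Lebesgue and Sobolev spaces are
  represented by Borel functions, equality in these spaces being equality almost everywhere.
\<close>

definition torus :: "(real^'d::finite) measure" where
  "torus = restrict_space lborel {x. \<forall>i. 0 \<le> x $ i \<and> x $ i < 2 * pi}"

definition periodic :: "(real^'d::finite \<Rightarrow> 'a) \<Rightarrow> bool" where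
  "periodic f \<longleftrightarrow> (\<forall>i x. f (x + axis i (2 * pi)) = f x)"

definition Lp :: "ereal \<Rightarrow> (real^'d::finite \<Rightarrow> 'a::{banach,second_countable_topology}) set" where
  "Lp p = {f. periodic f \<and> f \<in> borel_measurable borel \<and>
     (if p = \<infinity> then esssup torus (\<lambda>x. ereal (norm (f x))) < \<infinity>
      else integrable torus (\<lambda>x. norm (f x) powr real_of_ereal p))}"

definition conv :: "(real^'d::finite \<Rightarrow> real) \<Rightarrow> (real^'d \<Rightarrow> 'a::{banach,second_countable_topology}) \<Rightarrow> real^'d \<Rightarrow> 'a" where
  "conv w f x = (LINT y|torus. w (x - y) *\<^sub>R f y)"


section \<open>Classical and weak derivatives, Sobolev spaces\<close>

definition pdiff :: "'d::finite \<Rightarrow> (real^'d \<Rightarrow> 'a::real_normed_vector) \<Rightarrow> real^'d \<Rightarrow> 'a" where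
  "pdiff i f x = vector_derivative (\<lambda>t. f (x + t *\<^sub>R axis i 1)) (at 0)"

text \<open>Multi-indices are represented by lists of coordinates.\<close>

primrec pdiffs :: "'d::finite list \<Rightarrow> (real^'d \<Rightarrow> 'a::real_normed_vector) \<Rightarrow> real^'d \<Rightarrow> 'a" where
  "pdiffs [] f = f"
| "pdiffs (i # \<alpha>) f = pdiff i (pdiffs \<alpha> f)"

definition Ck :: "nat \<Rightarrow> (real^'d::finite \<Rightarrow> 'a::real_normed_vector) set" where
  "Ck k = {f. periodic f \<and>
     (\<forall>\<alpha>. length \<alpha> < k \<longrightarrow>
        (\<forall>i x. (\<lambda>t. pdiffs \<alpha> f (x + t *\<^sub>R axis i 1)) differentiable (at (0::real)))) \<and>
     (\<forall>\<alpha>. length \<alpha> \<le> k \<longrightarrow> continuous_on UNIV (pdiffs \<alpha> f))}"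

definition weak_deriv :: "'d::finite list \<Rightarrow> (real^'d \<Rightarrow> 'a::{banach,second_countable_topology}) \<Rightarrow> (real^'d \<Rightarrow> 'a) \<Rightarrow> bool" where
  "weak_deriv \<alpha> f g \<longleftrightarrow> f \<in> Lp 1 \<and> g \<in> Lp 1 \<and>
     (\<forall>\<phi> :: real^'d \<Rightarrow> real. (\<forall>k. \<phi> \<in> Ck k) \<longrightarrow>
        (LINT x|torus. pdiffs \<alpha> \<phi> x *\<^sub>R f x) = (- 1) ^ length \<alpha> *\<^sub>R (LINT x|torus. \<phi> x *\<^sub>R g x))"

definition Wkp :: "nat \<Rightarrow> ereal \<Rightarrow> (real^'d::finite \<Rightarrow> 'a::{banach,second_countable_topology}) set" where
  "Wkp k p = {f \<in> Lp p. \<forall>\<alpha>. length \<alpha> \<le> k \<longrightarrow> (\<exists>g \<in> Lp p. weak_deriv \<alpha> f g)}"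

text \<open>
  Weak derivatives are unique almost everywhere; \<open>wpdiff\<close> picks a representative.  It is
  unspecified if the weak derivative does not exist.
\<close>

definition wpdiff :: "'d::finite \<Rightarrow> (real^'d \<Rightarrow> 'a::{banach,second_countable_topology}) \<Rightarrow> real^'d \<Rightarrow> 'a" where
  "wpdiff i f = (SOME g. weak_deriv [i] f g)"

definition wdiv :: "('d::finite \<Rightarrow> real^'d \<Rightarrow> 'a::{banach,second_countable_topology}) \<Rightarrow> real^'d \<Rightarrow> 'a" where
  "wdiv F x = (\<Sum>i\<in>UNIV. wpdiff i (F i) x)"


section \<open>Potentials and stationary states\<close>

definition even_each_coordinate :: "(real^'d::finite \<Rightarrow> real) \<Rightarrow> bool" where
  "even_each_coordinate w \<longleftrightarrow> (\<forall>i x. w (\<chi> j. if j = i then - (x $ j) else x $ j) = w x)"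

definition H_stable :: "(real^'d::finite \<Rightarrow> real) \<Rightarrow> bool" where
  "H_stable w \<longleftrightarrow> (\<forall>\<nu> :: real^'d \<Rightarrow> real. \<nu> \<in> Lp 2 \<longrightarrow>
     (LINT z|(torus \<Otimes>\<^sub>M torus). w (fst z - snd z) * \<nu> (fst z) * \<nu> (snd z)) \<ge> 0)"

definition stationary_state ::
  "real \<Rightarrow> (real^'d::finite \<Rightarrow> real) \<Rightarrow> (real^'d \<Rightarrow> real) \<Rightarrow> (real^'d \<Rightarrow> real) \<Rightarrow> bool" where
  "stationary_state \<sigma> V W \<mu> \<longleftrightarrow>
     \<mu> \<in> Lp 1 \<and> (\<forall>x. \<mu> x \<ge> 0) \<and> (LINT x|torus. \<mu> x) = 1 \<and>
     (let g = (\<lambda>x. exp (- (1 / \<sigma>) * (V x + conv W \<mu> x))); Z = (LINT x|torus. g x)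
      in \<forall>x. \<mu> x = 1 / Z * g x)"


section \<open>The linearized McKean-Vlasov operator and its spectrum\<close>

definition X_space :: "(real^'d::finite \<Rightarrow> real) \<Rightarrow> (real^'d \<Rightarrow> complex) set" where
  "X_space \<mu> = {f. periodic f \<and> f \<in> borel_measurable borel \<and>
     integrable torus (\<lambda>x. (norm (f x))\<^sup>2 * inverse (\<mu> x))}"

definition X_inner :: "(real^'d::finite \<Rightarrow> real) \<Rightarrow> (real^'d \<Rightarrow> complex) \<Rightarrow> (real^'d \<Rightarrow> complex) \<Rightarrow> complex" where
  "X_inner \<mu> f g = (LINT x|torus. f x * cnj (g x) * of_real (inverse (\<mu> x)))"

definition X_norm :: "(real^'d::finite \<Rightarrow> real) \<Rightarrow> (real^'d \<Rightarrow> complex) \<Rightarrow> real" where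
  "X_norm \<mu> f = sqrt (Re (X_inner \<mu> f f))"

text \<open>
  The potentials are differentiated classically (they will be \<open>C\<^sup>2\<close>), \<open>y\<close> and the fluxes weakly.
  On \<open>Wkp 2 2\<close> all these weak derivatives exist.
\<close>

definition McKV_lin ::
  "real \<Rightarrow> (real^'d::finite \<Rightarrow> real) \<Rightarrow> (real^'d \<Rightarrow> real) \<Rightarrow> (real^'d \<Rightarrow> real) \<Rightarrow>
   (real^'d \<Rightarrow> complex) \<Rightarrow> real^'d \<Rightarrow> complex" where
  "McKV_lin \<sigma> V W \<mu> y x =
     wdiv (\<lambda>i x. \<sigma> *\<^sub>R wpdiff i y x + pdiff i V x *\<^sub>R y x) x +
     wdiv (\<lambda>i x. conv (pdiff i W) \<mu> x *\<^sub>R y x + \<mu> x *\<^sub>R conv (pdiff i W) y x) x"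

text \<open>
  Resolvent set and spectrum of an operator \<open>T\<close> with domain \<open>D \<subseteq> X\<close>, for a space \<open>X\<close> of functions
  on the torus modulo null sets, with norm \<open>nrm\<close>: \<open>z\<close> is in the resolvent set iff
  \<open>z - T : D \<rightarrow> X\<close> is a bijection with bounded inverse.
\<close>

definition resolvent_set ::
  "(real^'d::finite \<Rightarrow> complex) set \<Rightarrow> ((real^'d \<Rightarrow> complex) \<Rightarrow> real) \<Rightarrow> (real^'d \<Rightarrow> complex) set \<Rightarrow>
   ((real^'d \<Rightarrow> complex) \<Rightarrow> real^'d \<Rightarrow> complex) \<Rightarrow> complex set" where
  "resolvent_set X nrm D T = {z.
     (\<forall>y\<in>D. \<forall>y'\<in>D. (AE x in torus. z * y x - T y x = z * y' x - T y' x) \<longrightarrow>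
        (AE x in torus. y x = y' x)) \<and>
     (\<forall>f\<in>X. \<exists>y\<in>D. AE x in torus. z * y x - T y x = f x) \<and>
     (\<exists>C. \<forall>y\<in>D. nrm y \<le> C * nrm (\<lambda>x. z * y x - T y x))}"

definition spectrum_of ::
  "(real^'d::finite \<Rightarrow> complex) set \<Rightarrow> ((real^'d \<Rightarrow> complex) \<Rightarrow> real) \<Rightarrow> (real^'d \<Rightarrow> complex) set \<Rightarrow>
   ((real^'d \<Rightarrow> complex) \<Rightarrow> real^'d \<Rightarrow> complex) \<Rightarrow> complex set" where
  "spectrum_of X nrm D T = - resolvent_set X nrm D T"

definition McKV_spectrum ::
  "real \<Rightarrow> (real^'d::finite \<Rightarrow> real) \<Rightarrow> (real^'d \<Rightarrow> real) \<Rightarrow> (real^'d \<Rightarrow> real) \<Rightarrow> complex set" where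
  "McKV_spectrum \<sigma> V W \<mu> = spectrum_of (X_space \<mu>) (X_norm \<mu>) (Wkp 2 2) (McKV_lin \<sigma> V W \<mu>)"

end

theory Submission
  imports Defs "HOL-Complex_Analysis.Conformal_Mappings"
begin

text \<open>
  In Fourier variables the operator is \<open>-q + B p\<close> with \<open>q(k) = \<sigma> \<bar>k\<bar>\<^sup>2\<close>, \<open>p(k) = 1 + \<bar>k\<bar>\<^sub>1\<close> and \<open>B\<close> bounded on
  square-summable sequences, because everything except \<open>\<sigma> \<Delta>\<close> is of order at most one.  Since
  \<open>p / (1 + q)\<close> tends to \<open>0\<close> at infinity, \<open>\<parallel>B p / (z + q)\<parallel> \<le> 1/2\<close> for all \<open>z\<close> with \<open>Re z \<ge> -\<delta>\<close> and large
  modulus, so such \<open>z\<close> are in the resolvent set by a Neumann series.  For the remaining bounded set of \<open>z\<close>,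
  fix one large real \<open>s\<close>; with the unknown \<open>u = (s + q) v\<close> the resolvent equation becomes
  \<open>(1 - K) u + (z - s) G u = f\<close> with \<open>\<parallel>K\<parallel> \<le> 1/2\<close> and a diagonal operator \<open>G\<close> whose entries tend to \<open>0\<close>.
  Splitting off finitely many entries of \<open>G\<close> leaves an operator that is invertible by a Neumann series,
  holomorphically in \<open>z\<close>, and the equation reduces to a finite linear system whose holomorphic
  determinant is \<open>1\<close> at \<open>z = s\<close>; its zeros in a compact set are finite in number.
\<close>

section \<open>The Hilbert space of square-summable families\<close>

text \<open>For bounded \<open>z\<close> the lower-order part is not small relative to the diagonal;
  it is only relatively compact, so exceptional values must be allowed. Freezing the shift puts all
  dependence on \<open>z\<close> into one affine term. The bound 1/2 for \<open>K\<close> and the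
  bound 1/4 for the tail of \<open>(z - s) G\<close> add up to less than 1, uniformly on a disc
  slightly larger than the one that matters; the larger disc makes the closed one a compact part of
  the domain of holomorphy.

  The half plane enters through one inequality: for Re z \<ge> -\<delta> and |z| large compared with
  \<delta>, the modulus |z + q| is comparable with |z| + q.

  Invertibility is always expressed as solvability together with an a priori bound, which is the
  format of \<open>resolvent_set\<close>. The return from coefficients to functions rests on
  Parseval and on positive bounds for \<mu> from both sides, which make the weighted norm equivalent
  to the coefficient norm. The stationarity equation makes \<mu> continuously differentiable, so
  that the product rule applies to the fluxes.\<close>

lemma summable_on_real_comparison:
  fixes f g :: "'i \<Rightarrow> real"
  assumes "g summable_on A" "\<And>i. i \<in> A \<Longrightarrow> norm (f i) \<le> g i"
  shows "f summable_on A"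
  by (rule abs_summable_summable) (rule Infinite_Sum.abs_summable_on_comparison_test'[OF assms])

lemma norm_add_power2_le:
  fixes a b :: "'a::real_normed_vector"
  shows "(norm (a + b))\<^sup>2 \<le> 2 * (norm a)\<^sup>2 + 2 * (norm b)\<^sup>2"
proof -
  have "(norm (a + b))\<^sup>2 \<le> (norm a + norm b)\<^sup>2"
    by (intro power_mono norm_triangle_ineq norm_ge_zero)
  also have "\<dots> \<le> 2 * (norm a)\<^sup>2 + 2 * (norm b)\<^sup>2"
    using sum_squares_bound[of "norm a" "norm b"] by (simp add: power2_sum)
  finally show ?thesis .
qed

lemma cmod_mult_le_power2: "cmod (a * b) \<le> (cmod a)\<^sup>2 + (cmod b)\<^sup>2"
  using sum_squares_bound[of "cmod a" "cmod b"] mult_nonneg_nonneg[OF norm_ge_zero[of a] norm_ge_zero[of b]]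
  unfolding norm_mult by linarith

definition square_summable :: "('i \<Rightarrow> complex) \<Rightarrow> bool" where
  "square_summable f \<longleftrightarrow> (\<lambda>i. (cmod (f i))\<^sup>2) summable_on UNIV"

lemma square_summable_add:
  assumes "square_summable f" "square_summable g"
  shows "square_summable (\<lambda>i. f i + g i)"
proof -
  have "(\<lambda>i. 2 * (cmod (f i))\<^sup>2 + 2 * (cmod (g i))\<^sup>2) summable_on UNIV"
    using assms unfolding square_summable_def by (intro summable_on_add summable_on_cmult_right)
  then show ?thesis
    unfolding square_summable_def
    by (rule summable_on_real_comparison) (use norm_add_power2_le[where 'a=complex] in simp)
qed

lemma square_summable_mult:
  assumes "square_summable f" "\<And>i. cmod (m i) \<le> \<kappa>"
  shows "square_summable (\<lambda>i. m i * f i)"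
proof -
  have "(cmod (m i * f i))\<^sup>2 \<le> \<kappa>\<^sup>2 * (cmod (f i))\<^sup>2" for i
    unfolding norm_mult power_mult_distrib by (intro mult_right_mono power_mono assms) auto
  moreover have "(\<lambda>i. \<kappa>\<^sup>2 * (cmod (f i))\<^sup>2) summable_on UNIV"
    using assms unfolding square_summable_def by (intro summable_on_cmult_right)
  ultimately show ?thesis
    unfolding square_summable_def by (auto intro: summable_on_real_comparison)
qed

typedef 'i l2 = "{f :: 'i \<Rightarrow> complex. square_summable f}"
  morphisms cf Abs_l2
  by (rule exI[of _ "\<lambda>_. 0"]) (simp add: square_summable_def)

setup_lifting type_definition_l2

lemma square_summable_cf [simp]: "square_summable (cf u)"
  using cf[of u] by simp

lemma summable_cf: "(\<lambda>i. (cmod (cf u i))\<^sup>2) summable_on UNIV"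
  using square_summable_cf[of u] unfolding square_summable_def .

lemma l2_eqI: "(\<And>i. cf u i = cf v i) \<Longrightarrow> u = v"
  by (simp add: cf_inject[symmetric] fun_eq_iff)

lemma summable_Re_cf_mult: "(\<lambda>i. Re (cf u i * cnj (cf v i))) summable_on UNIV"
proof (rule summable_on_real_comparison)
  show "(\<lambda>i. (cmod (cf u i))\<^sup>2 + (cmod (cf v i))\<^sup>2) summable_on UNIV"
    by (intro summable_on_add summable_cf)
  show "norm (Re (cf u i * cnj (cf v i))) \<le> (cmod (cf u i))\<^sup>2 + (cmod (cf v i))\<^sup>2" for i
    using order_trans[OF abs_Re_le_cmod cmod_mult_le_power2[of "cf u i" "cnj (cf v i)"]] by simp
qed

instantiation l2 :: (type) real_vector
begin

lift_definition zero_l2 :: "'a l2" is "\<lambda>_. 0"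
  by (simp add: square_summable_def)
lift_definition plus_l2 :: "'a l2 \<Rightarrow> 'a l2 \<Rightarrow> 'a l2" is "\<lambda>f g i. f i + g i"
  by (rule square_summable_add)
lift_definition uminus_l2 :: "'a l2 \<Rightarrow> 'a l2" is "\<lambda>f i. - f i"
  by (simp add: square_summable_def)
lift_definition minus_l2 :: "'a l2 \<Rightarrow> 'a l2 \<Rightarrow> 'a l2" is "\<lambda>f g i. f i - g i"
  subgoal for f g
    using square_summable_add[of f "\<lambda>i. - g i"] by (simp add: square_summable_def)
  done
lift_definition scaleR_l2 :: "real \<Rightarrow> 'a l2 \<Rightarrow> 'a l2" is "\<lambda>c f i. of_real c * f i"
  subgoal for c f
    using square_summable_mult[of f "\<lambda>_. of_real c" "\<bar>c\<bar>"] by simp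
  done

lemma cf_arith [simp]:
  "cf (u + v) i = cf u i + cf v i" "cf (u - v) i = cf u i - cf v i" "cf (- u) i = - cf u i"
  "cf 0 i = 0" "cf (r *\<^sub>R u) i = of_real r * cf u i"
  by (transfer; simp)+

instance
  by standard (auto intro!: l2_eqI simp: algebra_simps)

end

instantiation l2 :: (type) real_inner
begin

text \<open>The real part of the Hermitian product. It induces the same norm and fits the real type
  classes; complex scalars are supplied separately by \<open>cscale\<close>.\<close>

definition inner_l2 :: "'a l2 \<Rightarrow> 'a l2 \<Rightarrow> real" where
  "inner_l2 u v = (\<Sum>\<^sub>\<infinity>i. Re (cf u i * cnj (cf v i)))"
definition norm_l2 :: "'a l2 \<Rightarrow> real" where
  "norm_l2 u = sqrt (inner u u)"
definition dist_l2 :: "'a l2 \<Rightarrow> 'a l2 \<Rightarrow> real" where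
  "dist_l2 u v = norm (u - v)"
definition sgn_l2 :: "'a l2 \<Rightarrow> 'a l2" where
  "sgn_l2 u = u /\<^sub>R norm u"
definition uniformity_l2 :: "('a l2 \<times> 'a l2) filter" where
  "uniformity_l2 = (INF e\<in>{0<..}. principal {(u, v). dist u v < e})"
definition open_l2 :: "'a l2 set \<Rightarrow> bool" where
  "open_l2 U \<longleftrightarrow> (\<forall>x\<in>U. \<forall>\<^sub>F (x', y) in uniformity. x' = x \<longrightarrow> y \<in> U)"

lemma Re_mult_cnj_self: "Re (z * cnj z) = (cmod z)\<^sup>2"
  by (subst cmod_power2) (simp add: power2_eq_square)

instance
proof
  fix u v w :: "'a l2" and r :: real
  show "inner u v = inner v u"
    unfolding inner_l2_def by (intro infsum_cong) (simp add: algebra_simps)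
  show "inner (u + v) w = inner u w + inner v w"
    unfolding inner_l2_def
    by (subst infsum_add[symmetric]) (auto intro!: summable_Re_cf_mult simp del: times_complex.sel simp: algebra_simps)
  show "inner (r *\<^sub>R u) v = r * inner u v"
    unfolding inner_l2_def
    by (subst infsum_cmult_right'[symmetric]) (auto intro!: infsum_cong simp: algebra_simps)
  show "0 \<le> inner u u"
    unfolding inner_l2_def Re_mult_cnj_self by (intro infsum_nonneg) simp
  show "inner u u = 0 \<longleftrightarrow> u = 0"
  proof
    assume "inner u u = 0"
    then have "(\<Sum>\<^sub>\<infinity>i. (cmod (cf u i))\<^sup>2) \<le> 0"
      unfolding inner_l2_def Re_mult_cnj_self by simp
    then have "(cmod (cf u i))\<^sup>2 = 0" for i
      by (rule nonneg_infsum_le_0D) (auto intro: summable_cf)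
    then show "u = 0" by (intro l2_eqI) simp
  qed (simp add: inner_l2_def)
qed (simp_all add: norm_l2_def dist_l2_def sgn_l2_def uniformity_l2_def open_l2_def)

end

lemma norm_l2_sq: "(norm (u :: 'i l2))\<^sup>2 = (\<Sum>\<^sub>\<infinity>i. (cmod (cf u i))\<^sup>2)"
  unfolding dot_square_norm[symmetric] inner_l2_def Re_mult_cnj_self ..

lemma cmod_cf_le_norm: "cmod (cf u i) \<le> norm u"
proof (rule power2_le_imp_le)
  have "(\<Sum>j\<in>{i}. (cmod (cf u j))\<^sup>2) \<le> (norm u)\<^sup>2"
    unfolding norm_l2_sq by (intro finite_sum_le_infsum summable_cf) auto
  then show "(cmod (cf u i))\<^sup>2 \<le> (norm u)\<^sup>2" by simp
qed simp

lemma norm_l2_leI: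
  assumes "\<And>F. finite F \<Longrightarrow> (\<Sum>i\<in>F. (cmod (cf u i))\<^sup>2) \<le> C\<^sup>2" "0 \<le> C"
  shows "norm u \<le> C"
proof (rule power2_le_imp_le)
  show "(norm u)\<^sup>2 \<le> C\<^sup>2"
    unfolding norm_l2_sq by (intro infsum_le_finite_sums summable_cf assms)
qed fact

lemma square_summableI:
  assumes "\<And>F. finite F \<Longrightarrow> (\<Sum>i\<in>F. (cmod (f i))\<^sup>2) \<le> C"
  shows "square_summable f"
  unfolding square_summable_def
  by (rule nonneg_bdd_above_summable_on) (auto intro!: bdd_aboveI[of _ C] assms)

lemma sum_cf_le: "finite F \<Longrightarrow> (\<Sum>i\<in>F. (cmod (cf u i))\<^sup>2) \<le> (norm u)\<^sup>2"
  unfolding norm_l2_sq by (intro finite_sum_le_infsum summable_cf) auto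

text \<open>The candidate is the coordinatewise limit. The Cauchy estimate passes to the limit on
  each finite set of indices; being uniform in that set, it yields both square-summability and norm
  convergence.\<close>

instance l2 :: (type) banach
proof
  fix X :: "nat \<Rightarrow> 'a l2"
  assume X: "Cauchy X"
  have "Cauchy (\<lambda>n. cf (X n) i)" for i
  proof (rule metric_CauchyI)
    fix e :: real assume "0 < e"
    then obtain M where M: "\<And>m n. m \<ge> M \<Longrightarrow> n \<ge> M \<Longrightarrow> dist (X m) (X n) < e"
      using X unfolding Cauchy_def by metis
    have "dist (cf (X m) i) (cf (X n) i) < e" if "m \<ge> M" "n \<ge> M" for m n
      using cmod_cf_le_norm[of "X m - X n" i] M[OF that] by (simp add: dist_norm)
    then show "\<exists>M. \<forall>m\<ge>M. \<forall>n\<ge>M. dist (cf (X m) i) (cf (X n) i) < e" by blast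
  qed
  then have "\<forall>i. \<exists>l. (\<lambda>n. cf (X n) i) \<longlonglongrightarrow> l"
    by (simp add: Cauchy_convergent_iff convergent_def)
  then obtain l where l: "\<And>i. (\<lambda>n. cf (X n) i) \<longlonglongrightarrow> l i" by metis
  have tail: "\<exists>M. \<forall>m\<ge>M. \<forall>F. finite F \<longrightarrow> (\<Sum>i\<in>F. (cmod (l i - cf (X m) i))\<^sup>2) \<le> e\<^sup>2"
    if "0 < e" for e
  proof -
    obtain M where M: "\<And>m n. m \<ge> M \<Longrightarrow> n \<ge> M \<Longrightarrow> dist (X m) (X n) < e"
      using X \<open>0 < e\<close> unfolding Cauchy_def by metis
    have "(\<Sum>i\<in>F. (cmod (l i - cf (X m) i))\<^sup>2) \<le> e\<^sup>2" if "finite F" "m \<ge> M" for m F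
    proof (rule LIMSEQ_le_const2)
      show "(\<lambda>n. \<Sum>i\<in>F. (cmod (cf (X n) i - cf (X m) i))\<^sup>2) \<longlonglongrightarrow> (\<Sum>i\<in>F. (cmod (l i - cf (X m) i))\<^sup>2)"
        by (intro tendsto_intros l)
      have "(\<Sum>i\<in>F. (cmod (cf (X n) i - cf (X m) i))\<^sup>2) \<le> e\<^sup>2" if "n \<ge> M" for n
      proof -
        have "(\<Sum>i\<in>F. (cmod (cf (X n - X m) i))\<^sup>2) \<le> (norm (X n - X m))\<^sup>2"
          by (intro sum_cf_le that \<open>finite F\<close>)
        also have "\<dots> \<le> e\<^sup>2"
          using M[OF \<open>n \<ge> M\<close> \<open>m \<ge> M\<close>] by (intro power_mono) (auto simp: dist_norm)
        finally show ?thesis by simp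
      qed
      then show "\<exists>N. \<forall>n\<ge>N. (\<Sum>i\<in>F. (cmod (cf (X n) i - cf (X m) i))\<^sup>2) \<le> e\<^sup>2" by blast
    qed
    then show ?thesis by blast
  qed
  obtain m0 where "\<And>F. finite F \<Longrightarrow> (\<Sum>i\<in>F. (cmod (l i - cf (X m0) i))\<^sup>2) \<le> 1"
    using tail[of 1] by auto
  then have "square_summable (\<lambda>i. l i - cf (X m0) i)"
    by (rule square_summableI)
  from square_summable_add[OF this square_summable_cf[of "X m0"]]
  have "square_summable l" by simp
  then have cfl: "cf (Abs_l2 l) = l" by (simp add: Abs_l2_inverse)
  have "X \<longlonglongrightarrow> Abs_l2 l"
  proof (rule metric_LIMSEQ_I)
    fix e :: real assume "0 < e"
    obtain M where M: "\<And>m F. m \<ge> M \<Longrightarrow> finite F \<Longrightarrow> (\<Sum>i\<in>F. (cmod (l i - cf (X m) i))\<^sup>2) \<le> (e/2)\<^sup>2"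
      using tail[of "e/2"] \<open>0 < e\<close> by auto
    have "dist (X m) (Abs_l2 l) < e" if "m \<ge> M" for m
    proof -
      have "norm (Abs_l2 l - X m) \<le> e/2"
        using M[OF that] \<open>0 < e\<close> by (intro norm_l2_leI) (auto simp: cfl)
      then show ?thesis using \<open>0 < e\<close> by (simp add: dist_norm norm_minus_commute)
    qed
    then show "\<exists>M. \<forall>m\<ge>M. dist (X m) (Abs_l2 l) < e" by blast
  qed
  then show "convergent X" by (auto simp: convergent_def)
qed

section \<open>Diagonal operators and bounded complex-linear maps\<close>

definition cscale :: "complex \<Rightarrow> 'i l2 \<Rightarrow> 'i l2" where
  "cscale c u = Abs_l2 (\<lambda>i. c * cf u i)"

text \<open>\<open>Abs_l2\<close> is meaningful only on square-summable families, so the lemmas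
  below carry a bound on the multiplier.\<close>

definition dmul :: "('i \<Rightarrow> complex) \<Rightarrow> 'i l2 \<Rightarrow> 'i l2" where
  "dmul m u = Abs_l2 (\<lambda>i. m i * cf u i)"

lemma cf_cscale [simp]: "cf (cscale c u) i = c * cf u i"
  unfolding cscale_def
  by (subst Abs_l2_inverse) (auto intro: square_summable_mult[of _ "\<lambda>_. c" "cmod c"])

lemma cf_dmul: 
  assumes "\<And>i. cmod (m i) \<le> \<kappa>"
  shows "cf (dmul m u) i = m i * cf u i"
  unfolding dmul_def by (subst Abs_l2_inverse) (auto intro: square_summable_mult assms)

lemma norm_l2_mono:
  assumes "\<And>i. cmod (cf u i) \<le> \<kappa> * cmod (cf v i)" "0 \<le> \<kappa>"
  shows "norm u \<le> \<kappa> * norm v"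
proof (rule norm_l2_leI)
  fix F :: "'a set" assume F: "finite F"
  have "(\<Sum>i\<in>F. (cmod (cf u i))\<^sup>2) \<le> (\<Sum>i\<in>F. \<kappa>\<^sup>2 * (cmod (cf v i))\<^sup>2)"
    unfolding power_mult_distrib[symmetric] by (intro sum_mono power_mono assms) auto
  also have "\<dots> \<le> \<kappa>\<^sup>2 * (norm v)\<^sup>2"
    unfolding sum_distrib_left[symmetric] by (intro mult_left_mono sum_cf_le F) auto
  finally show "(\<Sum>i\<in>F. (cmod (cf u i))\<^sup>2) \<le> (\<kappa> * norm v)\<^sup>2" by (simp add: power_mult_distrib)
qed (use assms in auto)

lemma norm_dmul_le:
  assumes "\<And>i. cmod (m i) \<le> \<kappa>"
  shows "norm (dmul m u) \<le> \<kappa> * norm u"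
proof -
  have "0 \<le> \<kappa>" using order_trans[OF norm_ge_zero assms] .
  then show ?thesis
    by (intro norm_l2_mono) (auto simp: cf_dmul[OF assms] norm_mult intro!: mult_right_mono assms)
qed

lemma norm_cscale [simp]: "norm (cscale c u) = cmod c * norm u"
proof (rule antisym)
  show "norm (cscale c u) \<le> cmod c * norm u"
    by (intro norm_l2_mono) (auto simp: norm_mult)
  show "cmod c * norm u \<le> norm (cscale c u)"
  proof (cases "c = 0")
    case False
    then have "norm u \<le> inverse (cmod c) * norm (cscale c u)"
      by (intro norm_l2_mono) (auto simp: norm_mult field_simps)
    then show ?thesis using False by (simp add: field_simps)
  qed simp
qed

text \<open>The type classes on \<open>l2\<close> know only real scalars, whereas a power series in
  a complex parameter needs maps that commute with \<open>cscale\<close>.\<close>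

definition clin :: "('i l2 \<Rightarrow> 'j l2) \<Rightarrow> bool" where
  "clin T \<longleftrightarrow> (\<forall>u v. T (u + v) = T u + T v) \<and> (\<forall>c u. T (cscale c u) = cscale c (T u)) \<and>
     (\<exists>C\<ge>0. \<forall>u. norm (T u) \<le> C * norm u)"

lemma clinI:
  assumes "\<And>u v. T (u + v) = T u + T v" "\<And>c u. T (cscale c u) = cscale c (T u)"
    "\<And>u. norm (T u) \<le> C * norm u"
  shows "clin T"
proof -
  have "norm (T u) \<le> \<bar>C\<bar> * norm u" for u
    using assms(3)[of u] mult_right_mono[OF abs_ge_self[of C] norm_ge_zero[of u]] by linarith
  then show ?thesis unfolding clin_def using assms(1,2) abs_ge_zero by blast
qed

lemma
  assumes "clin T"
  shows clin_plus: "T (u + v) = T u + T v" and clin_cscale: "T (cscale c u) = cscale c (T u)"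
  using assms unfolding clin_def by blast+

lemma clin_bound:
  assumes "clin T"
  obtains C where "C \<ge> 0" "\<And>u. norm (T u) \<le> C * norm u"
  using assms unfolding clin_def by blast

lemma clin_minus:
  assumes "clin T" shows "T (u - v) = T u - T v"
  using clin_plus[OF assms, of "u - v" v] by simp

lemma clin_0: "clin T \<Longrightarrow> T 0 = 0"
  using clin_minus[of T 0 0] by simp

lemma clin_dmul: "(\<And>i. cmod (m i) \<le> \<kappa>) \<Longrightarrow> clin (dmul m)"
  by (rule clinI[of _ \<kappa>]) (auto intro!: l2_eqI norm_dmul_le simp: cf_dmul[of m \<kappa>] algebra_simps)

lemma clin_compose:
  assumes "clin S" "clin T"
  shows "clin (\<lambda>u. S (T u))"
proof -
  obtain C where C: "C \<ge> 0" "\<And>u. norm (S u) \<le> C * norm u" using clin_bound[OF assms(1)] by metis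
  obtain D where D: "D \<ge> 0" "\<And>u. norm (T u) \<le> D * norm u" using clin_bound[OF assms(2)] by metis
  have "norm (S (T u)) \<le> (C * D) * norm u" for u
    using C(2)[of "T u"] mult_left_mono[OF D(2)[of u] C(1)] by (simp add: mult.assoc)
  then show ?thesis
    by (intro clinI[of _ "C * D"]) (simp_all add: clin_plus[OF assms(1)] clin_plus[OF assms(2)]
        clin_cscale[OF assms(1)] clin_cscale[OF assms(2)])
qed

lemma cscale_add: "cscale c (u + v) = cscale c u + cscale c v"
  by (rule l2_eqI) (simp add: algebra_simps)

lemma clin_add:
  assumes "clin S" "clin T"
  shows "clin (\<lambda>u. S u + T u)"
proof -
  obtain C where C: "C \<ge> 0" "\<And>u. norm (S u) \<le> C * norm u" using clin_bound[OF assms(1)] by metis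
  obtain D where D: "D \<ge> 0" "\<And>u. norm (T u) \<le> D * norm u" using clin_bound[OF assms(2)] by metis
  have "norm (S u + T u) \<le> (C + D) * norm u" for u
    using norm_triangle_ineq[of "S u" "T u"] C(2)[of u] D(2)[of u] by (simp add: algebra_simps)
  then show ?thesis
    by (intro clinI[of _ "C + D"]) (simp_all add: clin_plus[OF assms(1)] clin_plus[OF assms(2)]
        clin_cscale[OF assms(1)] clin_cscale[OF assms(2)] cscale_add)
qed

lemma cscale_minus: "cscale (- c) u = - cscale c u"
  by (rule l2_eqI) simp

lemma clin_cscale_comp:
  assumes "clin T"
  shows "clin (\<lambda>u. cscale c (T u))"
proof -
  obtain C where C: "C \<ge> 0" "\<And>u. norm (T u) \<le> C * norm u" using clin_bound[OF assms] by metis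
  show ?thesis
  proof (rule clinI[of _ "cmod c * C"])
    show "cscale c (T (u + v)) = cscale c (T u) + cscale c (T v)" for u v
      by (simp add: clin_plus[OF assms] cscale_add)
    show "cscale c (T (cscale a u)) = cscale a (cscale c (T u))" for a u
      by (rule l2_eqI) (simp add: clin_cscale[OF assms])
    show "norm (cscale c (T u)) \<le> (cmod c * C) * norm u" for u
      using mult_left_mono[OF C(2)[of u] norm_ge_zero[of c]] by (simp add: mult.assoc)
  qed
qed

lemma clin_zero: "clin (\<lambda>u. 0)"
  by (rule clinI[of _ 0]) (auto intro!: l2_eqI)

lemma clin_sum: "(\<And>k. k \<in> A \<Longrightarrow> clin (T k)) \<Longrightarrow> clin (\<lambda>u. \<Sum>k\<in>A. T k u)"
  by (induction A rule: infinite_finite_induct) (auto intro: clin_add clin_zero)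

section \<open>Perturbations of diagonal operators\<close>

text \<open>The solution is the fixed point of the contraction that sends u to f + A u; the lower
  bound is the reverse triangle inequality.\<close>

lemma one_minus_contraction:
  assumes "clin A" and A: "\<And>u. norm (A u) \<le> \<kappa> * norm u" and "0 \<le> \<kappa>" "\<kappa> < 1"
  shows "(1 - \<kappa>) * norm u \<le> norm (u - A u)" and "\<exists>u. u - A u = f"
proof -
  show "(1 - \<kappa>) * norm u \<le> norm (u - A u)"
    using norm_triangle_ineq2[of u "A u"] A[of u] by (simp add: algebra_simps)
  have "dist (f + A u) (f + A v) \<le> \<kappa> * dist u v" for u v
    using A[of "u - v"] by (simp add: dist_norm clin_minus[OF \<open>clin A\<close>])
  then have "\<exists>!u. f + A u = u"
    using assms(3,4) by (intro banach_fix_type) auto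
  then show "\<exists>u. u - A u = f" by (metis add_diff_cancel_right')
qed

text \<open>Invertibility of the matrix on \<open>F\<close> without naming an inverse: b = 0 with
  \<beta> = 0 in the second clause forces x = 0 on \<open>F\<close>. Entries outside
  \<open>F\<close> do not matter.\<close>

definition boundedly_solvable :: "'i set \<Rightarrow> ('i \<Rightarrow> 'i \<Rightarrow> complex) \<Rightarrow> bool" where
  "boundedly_solvable F m \<longleftrightarrow> (\<forall>b. \<exists>x. \<forall>j\<in>F. (\<Sum>k\<in>F. m j k * x k) = b j) \<and>
    (\<exists>C\<ge>0. \<forall>x b \<beta>. (\<forall>j\<in>F. (\<Sum>k\<in>F. m j k * x k) = b j \<and> cmod (b j) \<le> \<beta>) \<longrightarrow>
      (\<forall>j\<in>F. cmod (x j) \<le> C * \<beta>))"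

text \<open>The function \<open>d\<close> is the product of the pivots of a division-free Gaussian elimination.\<close>

lemma holomorphic_matrix_solvable:
  fixes m :: "complex \<Rightarrow> 'i \<Rightarrow> 'i \<Rightarrow> complex"
  assumes "finite F" and "\<And>j k. j \<in> F \<Longrightarrow> k \<in> F \<Longrightarrow> (\<lambda>w. m w j k) holomorphic_on U"
    and "\<And>j k. j \<in> F \<Longrightarrow> k \<in> F \<Longrightarrow> m w0 j k = (if j = k then 1 else 0)"
  shows "\<exists>d. d holomorphic_on U \<and> d w0 = 1 \<and> (\<forall>w\<in>U. d w \<noteq> 0 \<longrightarrow> boundedly_solvable F (m w))"
  using assms
proof (induction F arbitrary: m rule: finite_induct)
  case empty
  show ?case by (rule exI[of _ "\<lambda>_. 1"]) (auto simp: boundedly_solvable_def)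
next
  case (insert i F)
  \<comment> \<open>The Schur complement of the pivot, multiplied by the pivot. Without division the
    entries stay holomorphic where the pivot vanishes, and at \<open>w0\<close> the reduced matrix
    is again the identity.\<close>
  define m' where "m' w j k = m w i i * m w j k - m w j i * m w i k" for w j k
  have "\<exists>d. d holomorphic_on U \<and> d w0 = 1 \<and> (\<forall>w\<in>U. d w \<noteq> 0 \<longrightarrow> boundedly_solvable F (m' w))"
  proof (rule insert.IH)
    show "(\<lambda>w. m' w j k) holomorphic_on U" if "j \<in> F" "k \<in> F" for j k
      unfolding m'_def by (intro holomorphic_intros insert.prems) (use that in auto)
    show "m' w0 j k = (if j = k then 1 else 0)" if "j \<in> F" "k \<in> F" for j k
      using that insert.hyps by (auto simp: m'_def insert.prems(2))
  qed
  then obtain d where d: "d holomorphic_on U" "d w0 = 1"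
    and dd: "\<And>w. w \<in> U \<Longrightarrow> d w \<noteq> 0 \<Longrightarrow> boundedly_solvable F (m' w)"
    by blast
  have row: "(\<Sum>k\<in>F. m' w j k * x k) = m w i i * (\<Sum>k\<in>F. m w j k * x k) - m w j i * (\<Sum>k\<in>F. m w i k * x k)"
    for w j x
    unfolding m'_def by (simp add: sum_distrib_left sum_subtractf algebra_simps)
  show ?case
  proof (intro exI[of _ "\<lambda>w. m w i i * d w"] conjI ballI impI)
    show "(\<lambda>w. m w i i * d w) holomorphic_on U"
      by (intro holomorphic_intros insert.prems d) auto
    show "m w0 i i * d w0 = 1" by (simp add: d insert.prems)
  next
    fix w assume w: "w \<in> U" and "m w i i * d w \<noteq> 0"
    then have p: "m w i i \<noteq> 0" and dw: "d w \<noteq> 0" by auto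
    note solv = dd[OF w dw, unfolded boundedly_solvable_def]
    have solvable: "\<forall>b. \<exists>x. \<forall>j\<in>insert i F. (\<Sum>k\<in>insert i F. m w j k * x k) = b j"
    proof
      fix b
      obtain x where x: "\<And>j. j \<in> F \<Longrightarrow> (\<Sum>k\<in>F. m' w j k * x k) = m w i i * b j - m w j i * b i"
        using solv[THEN conjunct1, THEN spec, of "\<lambda>j. m w i i * b j - m w j i * b i"] by blast
      \<comment> \<open>Back substitution: row \<open>i\<close> determines the eliminated
        unknown.\<close>
      define xi where "xi = (b i - (\<Sum>k\<in>F. m w i k * x k)) / m w i i"
      have xi: "m w i i * xi = b i - (\<Sum>k\<in>F. m w i k * x k)" using p by (simp add: xi_def)
      have upd: "(\<Sum>k\<in>insert i F. m w j k * (x(i := xi)) k) = m w j i * xi + (\<Sum>k\<in>F. m w j k * x k)" for j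
        using insert.hyps by (auto intro!: sum.cong)
      have "(\<Sum>k\<in>insert i F. m w j k * (x(i := xi)) k) = b j" if "j \<in> insert i F" for j
      proof (cases "j = i")
        case False
        with that have "m w i i * (\<Sum>k\<in>F. m w j k * x k) - m w j i * (\<Sum>k\<in>F. m w i k * x k)
            = m w i i * b j - m w j i * b i"
          using x row by simp
        \<comment> \<open>Substituting row \<open>i\<close> undoes the elimination up to the factor
          \<open>m w i i\<close>, which is then cancelled.\<close>
        then have "m w i i * (m w j i * xi + (\<Sum>k\<in>F. m w j k * x k)) = m w i i * b j"
          using xi by algebra
        then show ?thesis unfolding upd using p by simp
      qed (use xi upd in auto)
      then show "\<exists>x. \<forall>j\<in>insert i F. (\<Sum>k\<in>insert i F. m w j k * x k) = b j" by blast
    qed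
    from solv[THEN conjunct2] obtain C where C: "C \<ge> 0"
      and C2: "\<forall>x b \<beta>. (\<forall>j\<in>F. (\<Sum>k\<in>F. m' w j k * x k) = b j \<and> cmod (b j) \<le> \<beta>) \<longrightarrow>
        (\<forall>j\<in>F. cmod (x j) \<le> C * \<beta>)"
      by blast
    \<comment> \<open>\<open>M\<close> bounds the right-hand side of the reduced system in terms of
      \<beta>, so \<open>C * M\<close> bounds the unknowns on \<open>F\<close>; \<open>N\<close>
      then bounds the eliminated unknown through row \<open>i\<close>.\<close>
    define M where "M = cmod (m w i i) + (\<Sum>j\<in>F. cmod (m w j i))"
    define N where "N = (1 + (\<Sum>k\<in>F. cmod (m w i k) * (C * M))) / cmod (m w i i)"
    have M: "M \<ge> 0" unfolding M_def by (auto intro!: add_nonneg_nonneg sum_nonneg)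
    have N: "N \<ge> 0" unfolding N_def using C M
      by (auto intro!: add_nonneg_nonneg sum_nonneg divide_nonneg_nonneg)
    have bound: "cmod (x j) \<le> (C * M + N) * \<beta>"
      if sys: "\<And>j. j \<in> insert i F \<Longrightarrow> (\<Sum>k\<in>insert i F. m w j k * x k) = b j \<and> cmod (b j) \<le> \<beta>"
        and j: "j \<in> insert i F" for x b \<beta> j
    proof -
      have \<beta>: "\<beta> \<ge> 0" using order_trans[OF norm_ge_zero conjunct2[OF sys[OF insertI1]]] .
      have eq: "m w j i * x i + (\<Sum>k\<in>F. m w j k * x k) = b j" if "j \<in> insert i F" for j
        using sys[OF that] insert.hyps by simp
      have "\<forall>j\<in>F. cmod (x j) \<le> C * (M * \<beta>)"
      proof (rule C2[rule_format, of x "\<lambda>j. m w i i * b j - m w j i * b i", THEN ballI])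
        fix j assume j: "j \<in> F"
        have "(\<Sum>k\<in>F. m' w j k * x k) = m w i i * b j - m w j i * b i"
          unfolding row eq[OF insertI1, symmetric] eq[OF insertI2[OF j], symmetric] by (simp add: algebra_simps)
        moreover have "cmod (m w i i * b j - m w j i * b i) \<le> M * \<beta>"
        proof -
          have "cmod (m w i i * b j - m w j i * b i) \<le> cmod (m w i i) * cmod (b j) + cmod (m w j i) * cmod (b i)"
            using norm_triangle_ineq4 by (metis norm_mult)
          also have "\<dots> \<le> cmod (m w i i) * \<beta> + (\<Sum>j\<in>F. cmod (m w j i)) * \<beta>"
            using sys[of i] sys[of j] j insert.hyps(1) \<beta>
            by (intro add_mono mult_mono member_le_sum sum_nonneg) auto
          finally show ?thesis by (simp add: M_def algebra_simps)
        qed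
        ultimately show "(\<Sum>k\<in>F. m' w j k * x k) = m w i i * b j - m w j i * b i \<and>
          cmod (m w i i * b j - m w j i * b i) \<le> M * \<beta>" by blast
      qed
      then have xF: "cmod (x j) \<le> C * (M * \<beta>)" if "j \<in> F" for j using that by blast
      show ?thesis
      proof (cases "j = i")
        case True
        have "m w i i * x i = b i - (\<Sum>k\<in>F. m w i k * x k)" using eq[of i] by (simp add: algebra_simps)
        then have "cmod (m w i i) * cmod (x i) \<le> cmod (b i) + cmod (\<Sum>k\<in>F. m w i k * x k)"
          by (metis norm_mult norm_triangle_ineq4)
        also have "\<dots> \<le> \<beta> + (\<Sum>k\<in>F. cmod (m w i k) * (C * (M * \<beta>)))"
          using sys[of i] by (intro add_mono sum_norm_le) (auto simp: norm_mult intro!: mult_left_mono xF)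
        also have "\<dots> = (1 + (\<Sum>k\<in>F. cmod (m w i k) * (C * M))) * \<beta>"
          by (simp add: distrib_right sum_distrib_right mult.assoc)
        finally have "cmod (x i) \<le> N * \<beta>"
          using p by (simp add: N_def field_simps)
        also have "\<dots> \<le> (C * M + N) * \<beta>" using C M \<beta> by (simp add: mult_right_mono)
        finally show ?thesis using True by simp
      next
        case False
        then have "cmod (x j) \<le> C * (M * \<beta>)" using xF j by auto
        also have "\<dots> \<le> (C * M + N) * \<beta>" using N \<beta> by (simp add: algebra_simps)
        finally show ?thesis .
      qed
    qed
    have "\<exists>C\<ge>0. \<forall>x b \<beta>. (\<forall>j\<in>insert i F. (\<Sum>k\<in>insert i F. m w j k * x k) = b j \<and> cmod (b j) \<le> \<beta>) \<longrightarrow>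
        (\<forall>j\<in>insert i F. cmod (x j) \<le> C * \<beta>)"
    proof (intro exI[of _ "C * M + N"] conjI allI impI ballI)
      fix x b \<beta> j
      assume "\<forall>j\<in>insert i F. (\<Sum>k\<in>insert i F. m w j k * x k) = b j \<and> cmod (b j) \<le> \<beta>" "j \<in> insert i F"
      then show "cmod (x j) \<le> (C * M + N) * \<beta>" by (intro bound[of x b \<beta> j]) blast+
    qed (use C M N in auto)
    with solvable show "boundedly_solvable (insert i F) (m w)" unfolding boundedly_solvable_def by (rule conjI)
  qed
qed

section \<open>Power series in the parameter and reduction to finite rank\<close>

lemma cscale_simps:
  "cscale c (u - v) = cscale c u - cscale c v" "cscale c 0 = 0" "cscale 0 u = 0"
  "cscale a (cscale b u) = cscale (a * b) u" "cscale 1 u = u"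
  by (auto intro!: l2_eqI simp: algebra_simps)

text \<open>The solution is the sum of a Neumann series in powers of \<open>w\<close>.\<close>

lemma resolvent_entry_holomorphic:
  assumes K: "clin K" "\<And>u. norm (K u) \<le> 1/2 * norm u"
    and G: "clin G" "\<And>u. norm (G u) \<le> \<eta> * norm u" "0 \<le> \<eta>" "\<rho> * \<eta> \<le> 1/4"
    and sol: "\<And>w. cmod w < \<rho> \<Longrightarrow> r w - K (r w) + cscale w (G (r w)) = g"
  shows "(\<lambda>w. cf (r w) j) holomorphic_on ball 0 \<rho>"
proof -
  note lin = clin_minus[OF K(1)] clin_minus[OF G(1)] clin_plus[OF K(1)] clin_plus[OF G(1)]
    clin_cscale[OF K(1)] clin_cscale[OF G(1)] clin_0[OF K(1)] clin_0[OF G(1)] cscale_add cscale_simps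
  define A where "A u = u - K u" for u
  have A_low: "norm u \<le> 2 * norm (A u)" for u
    using one_minus_contraction(1)[OF K, of u] by (simp add: A_def)
  obtain Ai where Ai: "\<And>f. A (Ai f) = f"
    using one_minus_contraction(2)[OF K] unfolding A_def by (simp add: choice_iff) metis
  \<comment> \<open>The coefficients of the solution in powers of \<open>w\<close>: comparing powers
    in (A + w G) applied to the series gives A U_0 = g and A U_(n+1) = - G U_n.\<close>
  define U where "U = rec_nat (Ai g) (\<lambda>_ u. Ai (- G u))"
  have U: "A (U 0) = g" "A (U (Suc n)) = - G (U n)" for n
    by (simp_all add: U_def Ai)
  have U_norm: "norm (U n) \<le> (2 * \<eta>) ^ n * (2 * norm g)" for n
  proof (induction n)
    case (Suc n)
    have "norm (U (Suc n)) \<le> 2 * norm (G (U n))"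
      using A_low[of "U (Suc n)"] by (simp add: U)
    also have "\<dots> \<le> 2 * (\<eta> * norm (U n))" using G(2)[of "U n"] by simp
    also have "\<dots> \<le> 2 * (\<eta> * ((2 * \<eta>) ^ n * (2 * norm g)))"
      using Suc G(3) by (intro mult_left_mono) auto
    finally show ?case by (simp add: algebra_simps)
  qed (use A_low[of "U 0"] in \<open>simp add: U\<close>)
  have "(\<lambda>n. cf (U n) j * (w - 0) ^ n) sums cf (r w) j" if "w \<in> ball 0 \<rho>" for w
  proof -
    define S where "S u = u - K u + cscale w (G u)" for u
    define P where "P N = (\<Sum>n<N. cscale (w ^ n) (U n))" for N
    have w: "cmod w < \<rho>" using that by simp
    have w\<eta>: "cmod w * \<eta> \<le> 1/4"
      using mult_right_mono[OF less_imp_le[OF w] G(3)] G(4) by linarith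
    \<comment> \<open>1 - 1/2 - 1/4 = 1/4 remains after subtracting the bounds for \<open>K\<close>
      and for \<open>w G\<close>.\<close>
    have S_low: "norm u \<le> 4 * norm (S u)" for u
    proof -
      have "norm (cscale w (G u)) \<le> cmod w * (\<eta> * norm u)"
        using G(2) by (simp add: mult_left_mono)
      also have "\<dots> \<le> 1/4 * norm u"
        using mult_right_mono[OF w\<eta> norm_ge_zero[of u]] by (simp add: mult.assoc)
      finally show ?thesis
        using norm_triangle_ineq2[of "A u" "- cscale w (G u)"] A_low[of u]
        by (simp add: S_def A_def)
    qed
    have S_diff: "S (u - v) = S u - S v" for u v
      by (simp add: S_def lin)
    \<comment> \<open>The partial sums telescope under \<open>S\<close>; only the last term survives
      as a residual.\<close>
    have SP: "S (P N) = g - cscale (w ^ N) (A (U N))" for N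
    proof (induction N)
      case 0
      show ?case by (simp add: P_def S_def lin U)
    next
      case (Suc N)
      have "S (P (Suc N)) = S (P N) + S (cscale (w ^ N) (U N))"
        using S_diff[of "P (Suc N)" "P N"] by (simp add: P_def)
      also have "S (cscale (w ^ N) (U N)) = cscale (w ^ N) (A (U N)) + cscale (w ^ Suc N) (G (U N))"
        by (simp add: S_def A_def lin)
      also have "cscale (w ^ Suc N) (G (U N)) = - cscale (w ^ Suc N) (A (U (Suc N)))"
        by (rule l2_eqI) (simp add: U)
      finally show ?case by (simp add: Suc)
    qed
    \<comment> \<open>\<open>S_low\<close> turns the residual into an error bound for the given
      solution, so any choice of \<open>r\<close> is the sum of the series. The ratio is 2 |w|
      \<eta> \<le> 1/2; the factor 4 of \<open>norm g\<close> is 2 from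
      \<open>norm (A u) \<le> 2 * norm u\<close> times 2 from \<open>U_norm\<close>.\<close>
    have "norm (r w - P N) \<le> 4 * ((1/2) ^ N * (4 * norm g))" for N
    proof -
      have "norm (r w - P N) \<le> 4 * norm (S (r w) - S (P N))"
        using S_low[of "r w - P N"] by (simp add: S_diff)
      also have "S (r w) = g" using sol[OF w] by (simp add: S_def)
      also have "g - S (P N) = cscale (w ^ N) (A (U N))" by (simp add: SP)
      also have "norm (cscale (w ^ N) (A (U N))) \<le> (1/2) ^ N * (4 * norm g)"
      proof -
        have "norm (A (U N)) \<le> 2 * norm (U N)"
          using norm_triangle_ineq4[of "U N" "K (U N)"] K(2)[of "U N"] norm_ge_zero[of "U N"]
          unfolding A_def by linarith
        then have "norm (A (U N)) \<le> (2 * \<eta>) ^ N * (4 * norm g)"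
          using U_norm[of N] by linarith
        then have "norm (cscale (w ^ N) (A (U N))) \<le> cmod w ^ N * ((2 * \<eta>) ^ N * (4 * norm g))"
          by (simp add: norm_power mult_left_mono)
        also have "\<dots> = (2 * (cmod w * \<eta>)) ^ N * (4 * norm g)"
          by (simp add: power_mult_distrib algebra_simps)
        also have "\<dots> \<le> (1/2) ^ N * (4 * norm g)"
          using w\<eta> G(3) by (intro mult_right_mono power_mono) auto
        finally show ?thesis .
      qed
      finally show ?thesis by simp
    qed
    then have bound: "cmod (cf (P N) j - cf (r w) j) \<le> 4 * ((1/2) ^ N * (4 * norm g))" for N
      using cmod_cf_le_norm[of "r w - P N" j] by (metis cf_arith(2) order_trans norm_minus_commute)
    have "(\<lambda>N. cf (P N) j - cf (r w) j) \<longlonglongrightarrow> 0"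
    proof (rule Lim_null_comparison)
      show "\<forall>\<^sub>F N in sequentially. cmod (cf (P N) j - cf (r w) j) \<le> 4 * ((1/2) ^ N * (4 * norm g))"
        using bound by simp
      show "(\<lambda>N. 4 * ((1/2) ^ N * (4 * norm g))) \<longlonglongrightarrow> 0"
        by (intro tendsto_mult_right_zero tendsto_mult_left_zero LIMSEQ_power_zero) auto
    qed
    then have "(\<lambda>N. cf (P N) j) \<longlonglongrightarrow> cf (r w) j"
      by (rule LIM_zero_cancel)
    moreover have "cf (P N) j = (\<Sum>n<N. cf (U n) j * (w - 0) ^ n)" for N
    proof -
      have "cf (\<Sum>n<N. f n) j = (\<Sum>n<N. cf (f n) j)" for f :: "nat \<Rightarrow> 'a l2" 
        by (induction N) auto
      then show ?thesis by (simp add: P_def mult.commute)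
    qed
    ultimately show ?thesis by (simp add: sums_def)
  qed
  then show ?thesis by (rule power_series_holomorphic)
qed

definition unit_l2 :: "'i \<Rightarrow> 'i l2" where
  "unit_l2 k = Abs_l2 (\<lambda>i. if i = k then 1 else 0)"

lemma cf_unit_l2 [simp]: "cf (unit_l2 k) i = (if i = k then 1 else 0)"
  unfolding unit_l2_def
  by (subst Abs_l2_inverse) (auto intro!: square_summableI[of _ 1] simp: if_distrib[of "\<lambda>x. (cmod x)\<^sup>2"] sum.If_cases cong: if_cong
      intro: order_trans[OF card_mono[of "{k}"]])

lemma cf_sum: "cf (\<Sum>k\<in>F. f k) i = (\<Sum>k\<in>F. cf (f k) i)"
  by (induction F rule: infinite_finite_induct) auto

lemma norm_unit_l2 [simp]: "norm (unit_l2 k) \<le> 1"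
  by (rule norm_l2_leI) (auto simp: if_distrib[of "\<lambda>x. (cmod x)\<^sup>2"] sum.If_cases cong: if_cong
      intro: order_trans[OF card_mono[of "{k}"]])

text \<open>Dropping the finitely many large entries of \<open>g\<close> leaves an operator
  \<open>S w\<close> that is invertible for all relevant \<open>w\<close>. The dropped part has
  finite rank, so a solution is recovered from its coordinates on \<open>F\<close>, and these solve
  a linear system with holomorphic matrix \<open>m w\<close>, equal to the identity at w =
  0.\<close>

lemma compact_pencil_finite:
  fixes g :: "'i \<Rightarrow> complex"
  assumes K: "clin K" "\<And>u. norm (K u) \<le> 1/2 * norm u"
    and g_bounded: "\<And>k. cmod (g k) \<le> B" and g_small: "\<And>\<eta>. \<eta> > 0 \<Longrightarrow> finite {k. cmod (g k) > \<eta>}"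
    and "\<rho> > 0"
  shows "\<exists>E. finite E \<and> (\<forall>w. cmod w \<le> \<rho> \<longrightarrow> w \<notin> E \<longrightarrow>
    (\<exists>C. \<forall>u. norm u \<le> C * norm (u - K u + cscale w (dmul g u))) \<and>
    (\<forall>f. \<exists>u. u - K u + cscale w (dmul g u) = f))"
proof -
  note lin = clin_minus[OF K(1)] clin_plus[OF K(1)] clin_cscale[OF K(1)] clin_0[OF K(1)]
    cscale_add cscale_simps
  \<comment> \<open>Calibrated so that |w| \<eta> \<le> 1/4 on the open disc of radius \<rho> + 1,
    which contains the closed disc of radius \<rho>.\<close>
  define \<eta> where "\<eta> = 1 / (4 * (\<rho> + 1))"
  have \<eta>: "\<eta> > 0" "(\<rho> + 1) * \<eta> \<le> 1/4" using \<open>\<rho> > 0\<close> by (auto simp: \<eta>_def)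
  define F where "F = {k. cmod (g k) > \<eta>}"
  have "finite F" unfolding F_def by (rule g_small) fact
  define gQ where "gQ k = (if k \<in> F then 0 else g k)" for k
  have gQ: "cmod (gQ k) \<le> \<eta>" for k using \<eta> by (auto simp: gQ_def F_def)
  note G = clin_dmul[of gQ \<eta>, OF gQ] norm_dmul_le[of gQ \<eta>, OF gQ]
  define S where "S w u = u - K u + cscale w (dmul gQ u)" for w u
  have S_alt: "S w u = u - (K u - cscale w (dmul gQ u))" for w u by (simp add: S_def)
  have clinS: "clin (\<lambda>u. K u - cscale w (dmul gQ u))" for w
    using clin_add[OF K(1) clin_cscale_comp[OF G(1), of "- w"]] by (simp add: cscale_minus)
  \<comment> \<open>1/2 from \<open>K\<close> plus 1/4 from the tail of \<open>g\<close>.\<close>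
  have contr: "norm (K u - cscale w (dmul gQ u)) \<le> 3/4 * norm u" if "cmod w < \<rho> + 1" for w u
  proof -
    have "norm (cscale w (dmul gQ u)) \<le> cmod w * (\<eta> * norm u)"
      using G(2) by (simp add: mult_left_mono)
    also have "\<dots> \<le> (\<rho> + 1) * (\<eta> * norm u)" using that \<eta> by (intro mult_right_mono) auto
    also have "\<dots> \<le> 1/4 * norm u"
      using mult_right_mono[OF \<eta>(2) norm_ge_zero[of u]] by (simp add: mult.assoc)
    finally show ?thesis
      using norm_triangle_ineq4[of "K u" "cscale w (dmul gQ u)"] K(2)[of u] by linarith
  qed
  have S_low: "norm u \<le> 4 * norm (S w u)" if "cmod w < \<rho> + 1" for w u
    using one_minus_contraction(1)[OF clinS contr, of w u] that unfolding S_alt by simp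
  have "\<exists>u. S w u = f" if "cmod w < \<rho> + 1" for w f
    using one_minus_contraction(2)[OF clinS contr, of w f] that unfolding S_alt by simp
  then obtain Si where Si: "\<And>w f. cmod w < \<rho> + 1 \<Longrightarrow> S w (Si w f) = f" by metis
  have S_lin: "S w (u + v) = S w u + S w v" "S w (u - v) = S w u - S w v"
    "S w (cscale c u) = cscale c (S w u)" "S w 0 = 0" for w u v c
    by (simp_all add: S_def lin clin_plus[OF G(1)] clin_minus[OF G(1)] clin_cscale[OF G(1)] clin_0[OF G(1)] mult.commute)
  have S_sum: "S w (\<Sum>k\<in>A. f k) = (\<Sum>k\<in>A. S w (f k))" for w f and A :: "'i set"
    by (induction A rule: infinite_finite_induct) (auto simp: S_lin)
  have S_inj: "u = v" if "S w u = S w v" "cmod w < \<rho> + 1" for u v w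
    using S_low[OF that(2), of "u - v"] that(1) by (simp add: S_lin)
  have T_eq: "u - K u + cscale w (dmul g u) = S w u + (\<Sum>k\<in>F. cscale (w * g k * cf u k) (unit_l2 k))" for w u
    using \<open>finite F\<close> unfolding S_def
    by (intro l2_eqI) (auto simp: cf_sum cf_dmul[of g B, OF g_bounded] cf_dmul[OF gQ] gQ_def if_distrib[of "(*) _"] cong: if_cong)
  \<comment> \<open>Applying the inverse of \<open>S w\<close> to \<open>T_eq\<close> and reading
    off coordinate j in \<open>F\<close> gives this matrix, acting on the coordinates of
    \<open>u\<close>.\<close>
  define m where "m w j k = (if j = k then 1 else 0) + w * g k * cf (Si w (unit_l2 k)) j" for w j k
  have hol: "(\<lambda>w. m w j k) holomorphic_on ball 0 (\<rho> + 1)" for j k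
  proof -
    have "(\<lambda>w. cf (Si w (unit_l2 k)) j) holomorphic_on ball 0 (\<rho> + 1)"
      using G \<eta> Si by (intro resolvent_entry_holomorphic[OF K, of "dmul gQ" \<eta> _ _ "unit_l2 k"]) (auto simp: S_def)
    then show ?thesis unfolding m_def by (intro holomorphic_intros)
  qed
  obtain d where d: "d holomorphic_on ball 0 (\<rho> + 1)" "d 0 = 1"
    and dd: "\<And>w. w \<in> ball 0 (\<rho> + 1) \<Longrightarrow> d w \<noteq> 0 \<Longrightarrow> boundedly_solvable F (m w)"
    using holomorphic_matrix_solvable[OF \<open>finite F\<close>, of m "ball 0 (\<rho> + 1)" 0] hol
    by (auto simp: m_def)
  have msum: "(\<Sum>k\<in>F. m w j k * x k) = x j + (\<Sum>k\<in>F. w * g k * x k * cf (Si w (unit_l2 k)) j)"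
    if "j \<in> F" for w j x
    unfolding m_def distrib_right sum.distrib
    using \<open>finite F\<close> that by (simp add: mult_ac if_distrib[of "(*) _"] cong: if_cong)
  show ?thesis
  proof (intro exI[of _ "{w \<in> cball 0 \<rho>. d w = 0}"] conjI allI impI)
    \<comment> \<open>A zero together with \<open>d 0 = 1\<close> excludes a constant, so the zeros
      in the closed disc cannot accumulate.\<close>
    have "\<not> d constant_on ball 0 (\<rho> + 1)" if "d w = 0" "w \<in> cball 0 \<rho>" for w
    proof
      assume "d constant_on ball 0 (\<rho> + 1)"
      then obtain c where c: "\<And>w. w \<in> ball 0 (\<rho> + 1) \<Longrightarrow> d w = c" unfolding constant_on_def by blast
      have "w \<in> ball 0 (\<rho> + 1)" "0 \<in> ball (0::complex) (\<rho> + 1)" using that \<open>\<rho> > 0\<close> by auto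
      then have "d w = c" "d 0 = c" using c by blast+
      then show False using that(1) d(2) by simp
    qed
    then show "finite {w \<in> cball 0 \<rho>. d w = 0}"
      using holomorphic_compact_finite_zeros[OF d(1), of "cball 0 \<rho>"] \<open>\<rho> > 0\<close>
      by (cases "\<exists>w\<in>cball 0 \<rho>. d w = 0") (auto simp: subset_iff intro: finite_subset[of _ "{}"])
  next
    fix w assume "cmod w \<le> \<rho>" "w \<notin> {w \<in> cball 0 \<rho>. d w = 0}"
    then have w: "cmod w < \<rho> + 1" "w \<in> ball 0 (\<rho> + 1)" "d w \<noteq> 0" by auto
    note solve = dd[OF w(2,3), unfolded boundedly_solvable_def]
    show "\<exists>u. u - K u + cscale w (dmul g u) = f" for f
    proof -
      obtain x where x: "\<And>j. j \<in> F \<Longrightarrow> (\<Sum>k\<in>F. m w j k * x k) = cf (Si w f) j"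
        using solve[THEN conjunct1, THEN spec, of "cf (Si w f)"] by blast
      \<comment> \<open>Reconstruction from prescribed coordinates \<open>x\<close> on
        \<open>F\<close>; the linear system says exactly that the coordinates of this
        \<open>u\<close> on \<open>F\<close> are \<open>x\<close>.\<close>
      define u where "u = Si w f - (\<Sum>k\<in>F. cscale (w * g k * x k) (Si w (unit_l2 k)))"
      have "cf u j = x j" if "j \<in> F" for j
        using x[OF that] msum[OF that] by (simp add: u_def cf_sum algebra_simps)
      then have "S w u + (\<Sum>k\<in>F. cscale (w * g k * cf u k) (unit_l2 k)) = f"
        using w by (simp add: u_def[THEN arg_cong, of "S w"] S_lin S_sum Si)
      then show ?thesis unfolding T_eq by blast
    qed
    obtain C where C: "C \<ge> 0" "\<forall>x b \<beta>. (\<forall>j\<in>F. (\<Sum>k\<in>F. m w j k * x k) = b j \<and> cmod (b j) \<le> \<beta>) \<longrightarrow>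
        (\<forall>j\<in>F. cmod (x j) \<le> C * \<beta>)"
      using solve[THEN conjunct2] by blast
    \<comment> \<open>The same system read backwards has right-hand side at most
      \<open>4 * norm f\<close>, so \<open>C\<close> bounds the coordinates of \<open>u\<close> on
      \<open>F\<close>, and \<open>M * norm f\<close> bounds the finite-rank term \<open>h\<close>.
      A second use of \<open>S_low\<close> gives the constant \<open>4 * (1 + M)\<close>.\<close>
    define M where "M = (\<Sum>k\<in>F. cmod (w * g k) * (C * 4))"
    have "norm u \<le> (4 * (1 + M)) * norm (u - K u + cscale w (dmul g u))" for u
    proof -
      define f where "f = u - K u + cscale w (dmul g u)"
      define h where "h = (\<Sum>k\<in>F. cscale (w * g k * cf u k) (unit_l2 k))"
      have f: "f = S w u + h" unfolding f_def h_def T_eq ..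
      have u: "u = Si w f - (\<Sum>k\<in>F. cscale (w * g k * cf u k) (Si w (unit_l2 k)))"
        by (rule S_inj[OF _ w(1)]) (simp add: S_lin S_sum Si[OF w(1)] f h_def)
      have "\<forall>j\<in>F. cmod (cf u j) \<le> C * (4 * norm f)"
      proof (rule C(2)[rule_format, THEN ballI], intro conjI)
        fix j assume "j \<in> F"
        show "(\<Sum>k\<in>F. m w j k * cf u k) = cf (Si w f) j"
          unfolding msum[OF \<open>j \<in> F\<close>]
          by (subst (1) u) (simp add: cf_sum)
        show "cmod (cf (Si w f) j) \<le> 4 * norm f"
          using cmod_cf_le_norm[of "Si w f" j] S_low[OF w(1), of "Si w f"] Si[OF w(1), of f] by simp
      qed
      then have "norm (cscale (w * g k * cf u k) (unit_l2 k)) \<le> cmod (w * g k) * (C * (4 * norm f)) * 1"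
        if "k \<in> F" for k
        unfolding norm_cscale norm_mult[of "w * g k"] using that C(1)
        by (intro mult_mono[OF mult_left_mono norm_unit_l2]) auto
      then have "norm h \<le> (\<Sum>k\<in>F. cmod (w * g k) * (C * (4 * norm f)) * 1)"
        unfolding h_def by (rule sum_norm_le)
      also have "\<dots> = M * norm f" by (simp add: M_def sum_distrib_right mult.assoc)
      finally have "norm (S w u) \<le> norm f + M * norm f"
        using norm_triangle_ineq4[of f h] f by simp
      then show ?thesis
        using S_low[OF w(1), of u] unfolding f_def by (simp add: algebra_simps)
    qed
    then show "\<exists>C. \<forall>u. norm u \<le> C * norm (u - K u + cscale w (dmul g u))" by blast
  qed
qed

section \<open>Unbounded pencils and finiteness in the half plane\<close>

text \<open>
  \<open>pencil B p q z v f\<close> expresses \<open>(z + q) v - B (p v) = f\<close> for multiplication operators \<open>p\<close>, \<open>q\<close>;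
  the witnesses \<open>h\<close> and \<open>u\<close> say that \<open>p v\<close> and \<open>(1 + q) v\<close> are square-summable, i.e. that \<open>v\<close> is in the domain.
\<close>

definition pencil :: "('i l2 \<Rightarrow> 'i l2) \<Rightarrow> ('i \<Rightarrow> real) \<Rightarrow> ('i \<Rightarrow> real) \<Rightarrow> complex \<Rightarrow> 'i l2 \<Rightarrow> 'i l2 \<Rightarrow> bool" where
  "pencil B p q z v f \<longleftrightarrow> (\<exists>h u. (\<forall>k. cf h k = of_real (p k) * cf v k) \<and>
     (\<forall>k. cf u k = of_real (1 + q k) * cf v k) \<and>
     (\<forall>k. cf f k = (z + of_real (q k)) * cf v k - cf (B h) k))"

text \<open>After adding \<delta> the real part is nonnegative, so adding q does not decrease the
  modulus, which also dominates q. This gives |z| + q \<le> 2 |z + q| + 3 \<delta>, and |z| \<ge> 6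
  \<delta> absorbs 3 \<delta> into half of the left side.\<close>

lemma shifted_modulus_ge:
  assumes "q \<ge> 0" "\<delta> > 0" "Re z \<ge> - \<delta>" "cmod z \<ge> 6 * \<delta>"
  shows "cmod z + q \<le> 4 * cmod (z + of_real q)"
proof -
  have 1: "cmod (z + of_real \<delta>) \<le> cmod (z + of_real \<delta> + of_real q)"
    unfolding cmod_def using assms(1,3) by (intro real_sqrt_le_mono add_mono) (auto intro!: power_mono)
  have 2: "q \<le> cmod (z + of_real \<delta> + of_real q)"
    using complex_Re_le_cmod[of "z + of_real \<delta> + of_real q"] assms(3) by simp
  have 3: "cmod z \<le> cmod (z + of_real \<delta>) + \<delta>"
    using norm_triangle_ineq4[of "z + of_real \<delta>" "of_real \<delta>"] assms(2) by simp
  have 4: "cmod (z + of_real \<delta> + of_real q) \<le> cmod (z + of_real q) + \<delta>"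
    using norm_triangle_ineq[of "z + of_real q" "of_real \<delta>"] assms(2) by (simp add: add_ac)
  show ?thesis using 1 2 3 4 assms(1,4) by linarith
qed

text \<open>With \<open>u = (\<zeta> + q) v\<close> as the new unknown, the unbounded pencil becomes a bounded one.\<close>

lemma pencil_iff:
  assumes "clin B" and p: "\<And>k. p k \<ge> 1" and q: "\<And>k. q k \<ge> 0"
    and \<zeta>: "\<And>k. 1 + q k \<le> 4 * cmod (\<zeta> + of_real (q k))"
      "\<And>k. p k \<le> \<epsilon> * cmod (\<zeta> + of_real (q k))"
  shows "pencil B p q z v f \<longleftrightarrow>
    (\<exists>u. v = dmul (\<lambda>k. 1 / (\<zeta> + of_real (q k))) u \<and>
      u - B (dmul (\<lambda>k. of_real (p k) / (\<zeta> + of_real (q k))) u)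
        + cscale (z - \<zeta>) (dmul (\<lambda>k. 1 / (\<zeta> + of_real (q k))) u) = f)"
proof -
  define n where "n k = \<zeta> + of_real (q k)" for k
  have n: "n k \<noteq> 0" for k using \<zeta>(1)[of k] q[of k] unfolding n_def by auto
  have b1: "cmod (1 / n k) \<le> \<epsilon>" for k
  proof -
    have "1 \<le> \<epsilon> * cmod (n k)" using p[of k] \<zeta>(2)[of k] unfolding n_def by linarith
    then show ?thesis using n[of k] by (simp add: norm_divide field_simps)
  qed
  have b2: "cmod (of_real (p k) / n k) \<le> \<epsilon>" for k
    using \<zeta>(2)[of k] n[of k] p[of k] by (simp add: norm_divide field_simps n_def)
  have b3: "cmod (of_real (1 + q k) / n k) \<le> 4" for k
    using \<zeta>(1)[of k] n[of k] q[of k] by (simp add: norm_divide field_simps n_def del: of_real_add)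
  have b4: "cmod (n k / of_real (1 + q k)) \<le> cmod \<zeta> + 1" for k
  proof -
    have "cmod (n k) \<le> cmod \<zeta> + q k" using norm_triangle_ineq[of \<zeta> "of_real (q k)"] q[of k] by (simp add: n_def)
    also have "\<dots> \<le> (cmod \<zeta> + 1) * (1 + q k)" using q[of k] by (simp add: algebra_simps)
    finally show ?thesis using q[of k] by (simp add: norm_divide field_simps del: of_real_add)
  qed
  note d1 = cf_dmul[of "\<lambda>k. 1 / n k", OF b1] and d2 = cf_dmul[of "\<lambda>k. of_real (p k) / n k", OF b2]
    and d3 = cf_dmul[of "\<lambda>k. of_real (1 + q k) / n k", OF b3]
    and d4 = cf_dmul[of "\<lambda>k. n k / of_real (1 + q k)", OF b4]
  show ?thesis
    unfolding n_def[symmetric]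
  proof
    assume "pencil B p q z v f"
    then obtain h u0 where h: "\<And>k. cf h k = of_real (p k) * cf v k"
      and u0: "\<And>k. cf u0 k = of_real (1 + q k) * cf v k"
      and f: "\<And>k. cf f k = (z + of_real (q k)) * cf v k - cf (B h) k"
      unfolding pencil_def by blast
    \<comment> \<open>The multiplier \<open>n\<close> is unbounded, but its quotient by
      \<open>1 + q\<close> is bounded by \<open>b4\<close>; hence the domain witness
      \<open>u0\<close> puts (\<zeta> + q) v into \<open>l2\<close>.\<close>
    define u where "u = dmul (\<lambda>k. n k / of_real (1 + q k)) u0"
    have u: "cf u k = n k * cf v k" for k
    proof -
      have "of_real (1 + q k) \<noteq> (0::complex)" unfolding of_real_eq_0_iff using q[of k] by linarith
      then show ?thesis unfolding u_def d4 u0 by (simp del: of_real_add)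
    qed
    have v: "v = dmul (\<lambda>k. 1 / n k) u" using n by (intro l2_eqI) (simp add: d1 u)
    moreover have "h = dmul (\<lambda>k. of_real (p k) / n k) u" using n by (intro l2_eqI) (simp add: d2 u h)
    moreover have "u - B h + cscale (z - \<zeta>) v = f"
      by (intro l2_eqI) (simp add: f u n_def algebra_simps)
    ultimately show "\<exists>u. v = dmul (\<lambda>k. 1 / n k) u \<and>
      u - B (dmul (\<lambda>k. of_real (p k) / n k) u) + cscale (z - \<zeta>) (dmul (\<lambda>k. 1 / n k) u) = f" by metis
  next
    assume "\<exists>u. v = dmul (\<lambda>k. 1 / n k) u \<and>
      u - B (dmul (\<lambda>k. of_real (p k) / n k) u) + cscale (z - \<zeta>) (dmul (\<lambda>k. 1 / n k) u) = f"
    then obtain u where v: "v = dmul (\<lambda>k. 1 / n k) u"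
      and f: "f = u - B (dmul (\<lambda>k. of_real (p k) / n k) u) + cscale (z - \<zeta>) v" by auto
    have cfu: "cf u k = n k * cf v k" for k using n by (simp add: v d1)
    show "pencil B p q z v f"
      unfolding pencil_def
      by (rule exI[of _ "dmul (\<lambda>k. of_real (p k) / n k) u"], rule exI[of _ "dmul (\<lambda>k. of_real (1 + q k) / n k) u"])
        (simp add: d2 d3 f cfu n del: of_real_add, simp add: n_def algebra_simps)
  qed
qed

theorem diagonal_perturbation_spectrum_finite:
  fixes p q :: "'i \<Rightarrow> real"
  assumes B: "clin B" and p: "\<And>k. p k \<ge> 1" and q: "\<And>k. q k \<ge> 0"
    and small: "\<And>\<epsilon>. \<epsilon> > 0 \<Longrightarrow> finite {k. p k > \<epsilon> * (1 + q k)}"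
    and "\<delta> > 0"
  shows "\<exists>E. finite E \<and> (\<forall>z. Re z \<ge> - \<delta> \<longrightarrow> z \<notin> E \<longrightarrow>
    (\<exists>C. \<forall>v f. pencil B p q z v f \<longrightarrow> norm v \<le> C * norm f) \<and> (\<forall>f. \<exists>v. pencil B p q z v f))"
proof -
  obtain C where C: "C \<ge> 0" "\<And>u. norm (B u) \<le> C * norm u" using clin_bound[OF B] by metis
  \<comment> \<open>A multiplier of size \<epsilon> followed by \<open>B\<close> then has norm at
    most 1/2; adding 1 to \<open>C\<close> covers C = 0.\<close>
  define \<epsilon> where "\<epsilon> = 1 / (2 * (C + 1))"
  have \<epsilon>: "\<epsilon> > 0" "C * \<epsilon> \<le> 1/2" using C by (auto simp: \<epsilon>_def field_simps)
  \<comment> \<open>Outside \<open>F\<close>, 4 p \<le> \<epsilon> (1 + q); the factor 4 is the one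
    lost in \<open>shifted_modulus_ge\<close>.\<close>
  define F where "F = {k. p k > \<epsilon> / 4 * (1 + q k)}"
  have "finite F" unfolding F_def using \<epsilon> by (intro small) auto
  \<comment> \<open>Three demands: \<open>6 * \<delta>\<close> for
    \<open>shifted_modulus_ge\<close>, 1 to compare 1 + q with |\<zeta>| + q, and the last entry to
    make 4 p \<le> \<epsilon> |\<zeta>| on the finite set \<open>F\<close>.\<close>
  define R where "R = max (6 * \<delta>) (max 1 (4 * (\<Sum>k\<in>F. p k) / \<epsilon>))"
  have R: "R \<ge> 6 * \<delta>" "R \<ge> 1" "4 * (\<Sum>k\<in>F. p k) / \<epsilon> \<le> R" by (auto simp: R_def)
  have far: "1 + q k \<le> 4 * cmod (\<zeta> + of_real (q k)) \<and> p k \<le> \<epsilon> * cmod (\<zeta> + of_real (q k))"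
    if \<zeta>: "Re \<zeta> \<ge> - \<delta>" "cmod \<zeta> \<ge> R" for \<zeta> k
  proof -
    have 1: "cmod \<zeta> + q k \<le> 4 * cmod (\<zeta> + of_real (q k))"
      using shifted_modulus_ge[OF q \<open>\<delta> > 0\<close>] \<zeta> R(1) by simp
    have "4 * p k \<le> \<epsilon> * (cmod \<zeta> + q k)"
    proof (cases "k \<in> F")
      case True
      then have "p k \<le> (\<Sum>k\<in>F. p k)"
        using \<open>finite F\<close> p by (intro member_le_sum) (auto intro: order_trans[OF zero_le_one])
      also have "4 * \<dots> \<le> R * \<epsilon>" using R(3) \<epsilon>(1) by (simp add: field_simps)
      also have "\<dots> \<le> (cmod \<zeta> + q k) * \<epsilon>" using \<zeta>(2) q[of k] \<epsilon>(1) by (intro mult_right_mono) auto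
      finally show ?thesis by (simp add: mult.commute)
    next
      case False
      then have "4 * p k \<le> \<epsilon> * (1 + q k)" by (simp add: F_def)
      also have "\<dots> \<le> \<epsilon> * (cmod \<zeta> + q k)" using \<zeta>(2) R(2) \<epsilon>(1) by (intro mult_left_mono) auto
      finally show ?thesis .
    qed
    also have "\<dots> \<le> \<epsilon> * (4 * cmod (\<zeta> + of_real (q k)))" using 1 \<epsilon>(1) by (intro mult_left_mono) auto
    finally show ?thesis using 1 \<zeta>(2) R(2) by simp
  qed
  define a where "a \<zeta> k = 1 / (\<zeta> + complex_of_real (q k))" for \<zeta> k
  define P where "P \<zeta> k = of_real (p k) / (\<zeta> + complex_of_real (q k))" for \<zeta> k
  have iff: "pencil B p q z v f \<longleftrightarrow>
    (\<exists>u. v = dmul (a \<zeta>) u \<and> u - B (dmul (P \<zeta>) u) + cscale (z - \<zeta>) (dmul (a \<zeta>) u) = f)"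
    if "Re \<zeta> \<ge> - \<delta>" "cmod \<zeta> \<ge> R" for \<zeta> z v f
    unfolding a_def P_def by (rule pencil_iff[OF B p q]) (use far[OF that] in auto)
  have nz: "\<zeta> + complex_of_real (q k) \<noteq> 0" if "Re \<zeta> \<ge> - \<delta>" "cmod \<zeta> \<ge> R" for \<zeta> k
    using far[OF that, of k] q[of k] by auto
  have P_le: "cmod (P \<zeta> k) \<le> \<epsilon>" if "Re \<zeta> \<ge> - \<delta>" "cmod \<zeta> \<ge> R" for \<zeta> k
    using far[OF that, of k] nz[OF that, of k] p[of k] by (simp add: P_def norm_divide field_simps)
  have a_le_P: "cmod (a \<zeta> k) \<le> cmod (P \<zeta> k)" for \<zeta> k
    using p[of k] by (auto simp: P_def a_def norm_divide intro!: divide_right_mono)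
  have a_le: "cmod (a \<zeta> k) \<le> \<epsilon>" if "Re \<zeta> \<ge> - \<delta>" "cmod \<zeta> \<ge> R" for \<zeta> k
    using a_le_P P_le[OF that] order_trans by blast
  have K: "clin (\<lambda>u. B (dmul (P \<zeta>) u))" "norm (B (dmul (P \<zeta>) u)) \<le> 1/2 * norm u"
    if "Re \<zeta> \<ge> - \<delta>" "cmod \<zeta> \<ge> R" for \<zeta> u
  proof -
    show "clin (\<lambda>u. B (dmul (P \<zeta>) u))" by (intro clin_compose[OF B] clin_dmul[of _ \<epsilon>] P_le that)
    have "norm (B (dmul (P \<zeta>) u)) \<le> C * (\<epsilon> * norm u)"
      using C(2)[of "dmul (P \<zeta>) u"] mult_left_mono[OF norm_dmul_le[of "P \<zeta>" \<epsilon> u, OF P_le[OF that]] C(1)]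
      by linarith
    also have "\<dots> \<le> 1/2 * norm u"
      using mult_right_mono[OF \<epsilon>(2) norm_ge_zero[of u]] by (simp add: mult.assoc)
    finally show "norm (B (dmul (P \<zeta>) u)) \<le> 1/2 * norm u" .
  qed
  define s where "s = complex_of_real R"
  have s: "Re s \<ge> - \<delta>" "cmod s \<ge> R" using R \<open>\<delta> > 0\<close> by (auto simp: s_def)
  \<comment> \<open>A large entry forces \<eta> (1 + q) < 1 \<le> p, so \<open>small\<close>
    applies.\<close>
  have "finite {k. cmod (a s k) > \<eta>}" if "\<eta> > 0" for \<eta>
  proof (rule finite_subset[OF _ small[OF that]], safe)
    fix k assume "\<eta> < cmod (a s k)"
    moreover have "cmod (a s k) = 1 / (R + q k)"
      using R q[of k] by (simp add: a_def s_def norm_divide flip: of_real_add)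
    ultimately have "\<eta> * (R + q k) < 1" using R q[of k] by (simp add: field_simps)
    moreover have "\<eta> * (1 + q k) \<le> \<eta> * (R + q k)" using that R by (intro mult_left_mono) auto
    ultimately show "\<eta> * (1 + q k) < p k" using p[of k] by linarith
  qed
  then obtain E where E: "finite E" "\<And>w. cmod w \<le> 2 * R \<Longrightarrow> w \<notin> E \<Longrightarrow>
    (\<exists>C. \<forall>u. norm u \<le> C * norm (u - B (dmul (P s) u) + cscale w (dmul (a s) u))) \<and>
    (\<forall>f. \<exists>u. u - B (dmul (P s) u) + cscale w (dmul (a s) u) = f)"
    using compact_pencil_finite[OF K(1)[OF s] K(2)[OF s], of "a s" \<epsilon> "2 * R"] a_le[OF s] R by auto
  show ?thesis
  proof (intro exI[of _ "(\<lambda>w. w + s) ` E"] conjI allI impI)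
    show "finite ((\<lambda>w. w + s) ` E)" using E by simp
    fix z assume z: "Re z \<ge> - \<delta>" "z \<notin> (\<lambda>w. w + s) ` E"
    \<comment> \<open>For large |z| take \<zeta> = z, which kills the affine term and leaves a
      contraction. Otherwise take \<zeta> = s; then |z - s| \<le> 2 R, the disc on which
      \<open>E\<close> was obtained.\<close>
    have "\<exists>\<zeta>. (Re \<zeta> \<ge> - \<delta> \<and> cmod \<zeta> \<ge> R) \<and>
      (\<exists>C. \<forall>u. norm u \<le> C * norm (u - B (dmul (P \<zeta>) u) + cscale (z - \<zeta>) (dmul (a \<zeta>) u))) \<and>
      (\<forall>f. \<exists>u. u - B (dmul (P \<zeta>) u) + cscale (z - \<zeta>) (dmul (a \<zeta>) u) = f)"
    proof (cases "cmod z \<ge> R")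
      case True
      have "norm u \<le> 2 * norm (u - B (dmul (P z) u))" for u
        using one_minus_contraction(1)[OF K(1,2)[OF z(1) True], of u] by simp
      moreover have "\<exists>u. u - B (dmul (P z) u) = f" for f
        using one_minus_contraction(2)[OF K(1,2)[OF z(1) True], of f] by simp
      ultimately show ?thesis
        using z True by (intro exI[of _ z]) (auto simp: cscale_simps)
    next
      case False
      have "cmod (z - s) \<le> 2 * R"
        using False norm_triangle_ineq4[of z s] R by (simp add: s_def)
      moreover have "z - s \<notin> E" using z(2) by (metis diff_add_cancel imageI)
      ultimately show ?thesis using E(2)[of "z - s"] s by (intro exI[of _ s]) auto
    qed
    then obtain \<zeta> D where \<zeta>: "Re \<zeta> \<ge> - \<delta>" "cmod \<zeta> \<ge> R"
      and D: "\<And>u. norm u \<le> D * norm (u - B (dmul (P \<zeta>) u) + cscale (z - \<zeta>) (dmul (a \<zeta>) u))"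
      and surj: "\<And>f. \<exists>u. u - B (dmul (P \<zeta>) u) + cscale (z - \<zeta>) (dmul (a \<zeta>) u) = f"
      by blast
    have "norm v \<le> (\<epsilon> * D) * norm f" if pencil: "pencil B p q z v f" for v f
    proof -
      obtain u where "v = dmul (a \<zeta>) u" "u - B (dmul (P \<zeta>) u) + cscale (z - \<zeta>) (dmul (a \<zeta>) u) = f"
        using pencil unfolding iff[OF \<zeta>] by (elim exE conjE) (rule that)
      then have "norm v \<le> \<epsilon> * norm u" "norm u \<le> D * norm f"
        using norm_dmul_le[of "a \<zeta>" \<epsilon> u, OF a_le[OF \<zeta>]] D[of u] by auto
      then show ?thesis using mult_left_mono[of "norm u" "D * norm f" \<epsilon>] \<epsilon>(1) unfolding mult.assoc by linarith
    qed
    then show "\<exists>C. \<forall>v f. pencil B p q z v f \<longrightarrow> norm v \<le> C * norm f" by blast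
    show "\<exists>v. pencil B p q z v f" for f
    proof -
      obtain u where "u - B (dmul (P \<zeta>) u) + cscale (z - \<zeta>) (dmul (a \<zeta>) u) = f"
        using surj[of f] by (rule exE)
      then have "pencil B p q z (dmul (a \<zeta>) u) f"
        unfolding iff[OF \<zeta>] by (intro exI[of _ u] conjI refl)
      then show ?thesis by (rule exI)
    qed
  qed
qed

section \<open>Integration and differentiation on the torus\<close>

no_notation fps_nth (infixl "$" 75)

abbreviation shift :: "'d::finite \<Rightarrow> real \<Rightarrow> real^'d \<Rightarrow> real^'d" where
  "shift i t x \<equiv> x + t *\<^sub>R axis i 1"

definition cell :: "(real^'d::finite) set" where
  "cell = {x. \<forall>i. 0 \<le> x $ i \<and> x $ i < 2 * pi}"

lemma torus_eq: "torus = restrict_space lborel cell"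
  by (simp add: torus_def cell_def)

lemma borel_measurable_component [measurable]: "(\<lambda>x::real^'d::finite. x $ i) \<in> borel_measurable borel"
  by (intro borel_measurable_continuous_onI continuous_intros)

lemma cell_sets [measurable]: "cell \<in> sets borel"
  unfolding cell_def by measurable

lemma space_torus [simp]: "space torus = cell"
  by (simp add: torus_eq)

lemma measurable_torus [measurable (raw)]: "f \<in> borel_measurable borel \<Longrightarrow> f \<in> borel_measurable torus"
  unfolding torus_eq by (intro measurable_restrict_space1) simp

lemma emeasure_cell_finite: "emeasure lborel (cell :: (real^'d::finite) set) < \<infinity>"
proof -
  have "emeasure lborel (cell :: (real^'d) set) \<le> emeasure lborel (cbox 0 (\<chi> i. 2 * pi) :: (real^'d) set)"
    by (intro emeasure_mono) (auto simp: cell_def mem_box_cart less_imp_le)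
  also have "\<dots> < \<infinity>" by (rule emeasure_bounded_finite) simp
  finally show ?thesis .
qed

lemma emeasure_torus_cell: "emeasure torus (cell :: (real^'d::finite) set) = emeasure lborel (cell :: (real^'d) set)"
  unfolding torus_eq by (subst emeasure_restrict_space) auto

interpretation torus: finite_measure "torus :: (real^'d::finite) measure"
  by (rule finite_measureI) (use emeasure_cell_finite[where 'd='d] in \<open>simp add: emeasure_torus_cell less_top[symmetric]\<close>)

text \<open>Only the positivity of the volume is used, so its value \<open>(2\<pi>)^d\<close> is never computed.\<close>

definition vol :: "'d::finite itself \<Rightarrow> real" where
  "vol _ = measure (torus :: (real^'d) measure) (space torus)"

lemma vol_pos: "vol TYPE('d::finite) > 0"
proof -
  have "0 < measure lborel (box 0 (\<chi> i. 2 * pi) :: (real^'d) set)"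
    by (subst measure_lborel_box) (auto simp: inner_axis Basis_vec_def intro!: prod_pos)
  then have "0 < emeasure lborel (box 0 (\<chi> i. 2 * pi) :: (real^'d) set)"
    by (simp add: Sigma_Algebra.measure_def enn2real_positive_iff)
  also have "\<dots> \<le> emeasure lborel (cell :: (real^'d) set)"
    by (intro emeasure_mono) (auto simp: cell_def mem_box_cart less_imp_le)
  finally have "emeasure torus (space (torus :: (real^'d) measure)) > 0" 
    by (simp add: emeasure_torus_cell)
  then show ?thesis
    unfolding vol_def torus.emeasure_eq_measure by simp
qed

lemma integral_torus:
  fixes f :: "real^'d::finite \<Rightarrow> 'a::{banach,second_countable_topology}"
  shows "(LINT x|torus. f x) = (LINT x|lborel. indicator cell x *\<^sub>R f x)"
  unfolding torus_eq by (rule integral_restrict_space) simp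

section \<open>Periodic functions and translation invariance of the integral\<close>

lemma shift_component: "shift i t x $ j = (if j = i then x $ j + t else x $ j)"
  by (simp add: axis_def)

lemma periodic_shift: "periodic f \<longleftrightarrow> (\<forall>i x. f (shift i (2 * pi) x) = f x)"
proof -
  have "axis i (2 * pi) = (2 * pi) *\<^sub>R axis i 1" for i :: 'a
    by (simp add: vec_eq_iff axis_def)
  then show ?thesis by (simp add: periodic_def)
qed

lemma periodicD: "periodic f \<Longrightarrow> f (shift i (2 * pi) x) = f x"
  by (simp add: periodic_shift)

lemma periodic_shift_int:
  assumes "periodic f"
  shows "f (shift i (2 * pi * of_int n) x) = f x"
proof -
  have nat: "f (shift i (2 * pi * of_nat m) x) = f x" for m x
  proof (induction m)
    case (Suc m)
    have "shift i (2 * pi * of_nat (Suc m)) x = shift i (2 * pi) (shift i (2 * pi * of_nat m) x)"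
      by (simp add: algebra_simps)
    then show ?case using Suc periodicD[OF assms] by metis
  qed simp
  show ?thesis
  proof (cases "n \<ge> 0")
    case True
    then show ?thesis using nat[where m = "nat n"] by simp
  next
    case False
    have "f (shift i (2 * pi * of_nat (nat (- n))) (shift i (2 * pi * of_int n) x)) = f (shift i (2 * pi * of_int n) x)"
      by (rule nat)
    then show ?thesis using False by simp
  qed
qed

lemma periodic_reduce:
  fixes f :: "real^'d::finite \<Rightarrow> 'a"
  assumes "periodic f"
  obtains y where "y \<in> cell" "f y = f x"
proof -
  \<comment> \<open>Reducing only the coordinates in \<open>S\<close> lets an induction on
    \<open>S\<close> change one coordinate at a time.\<close>
  define r where "r S = (\<chi> i. if i \<in> S then x $ i - 2 * pi * of_int \<lfloor>x $ i / (2 * pi)\<rfloor> else x $ i)" for S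
  have "f (r S) = f x" if "finite S" for S
    using that
  proof (induction S)
    case empty
    then show ?case by (simp add: r_def)
  next
    case (insert i S)
    have "r (insert i S) = shift i (2 * pi * of_int (- \<lfloor>x $ i / (2 * pi)\<rfloor>)) (r S)"
      using insert.hyps by (auto simp: r_def vec_eq_iff axis_def)
    then show ?case using periodic_shift_int[OF assms] insert.IH by metis
  qed
  then have "f (r UNIV) = f x" by simp
  moreover have "r UNIV \<in> cell"
  proof -
    have "0 \<le> t - 2 * pi * of_int \<lfloor>t / (2 * pi)\<rfloor> \<and> t - 2 * pi * of_int \<lfloor>t / (2 * pi)\<rfloor> < 2 * pi" for t :: real
    proof -
      define u where "u = t / (2 * pi)"
      have "0 \<le> 2 * pi * (u - of_int \<lfloor>u\<rfloor>)" by (intro mult_nonneg_nonneg) auto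
      moreover have "2 * pi * (u - of_int \<lfloor>u\<rfloor>) < 2 * pi * 1"
        by (intro mult_strict_left_mono) (auto, linarith)
      moreover have "t = 2 * pi * u" by (simp add: u_def)
      ultimately show ?thesis unfolding u_def[symmetric] by (simp add: right_diff_distrib)
    qed
    then show ?thesis by (simp add: r_def cell_def)
  qed
  ultimately show thesis using that by blast
qed

lemma continuous_periodic_bounded:
  fixes f :: "real^'d::finite \<Rightarrow> 'a::real_normed_vector"
  assumes "periodic f" "continuous_on UNIV f"
  obtains M where "M > 0" "\<And>x. norm (f x) \<le> M"
proof -
  have "compact (f ` cbox 0 (\<chi> i. 2 * pi))"
    by (intro compact_continuous_image continuous_on_subset[OF assms(2)]) auto
  then obtain M where M: "M > 0" "\<And>x. x \<in> cbox 0 (\<chi> i. 2 * pi) \<Longrightarrow> norm (f x) \<le> M"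
    using compact_imp_bounded bounded_pos by (metis imageI)
  have "norm (f x) \<le> M" for x
  proof -
    obtain y where "y \<in> cell" "f y = f x" using periodic_reduce[OF assms(1)] .
    moreover have "cell \<subseteq> cbox 0 (\<chi> i. 2 * pi)"
      by (auto simp: cell_def mem_box_cart less_imp_le)
    ultimately show ?thesis using M(2) by (metis subsetD)
  qed
  with M(1) show thesis using that by blast
qed

lemma integrable_torus_bounded:
  fixes f :: "real^'d::finite \<Rightarrow> 'a::{banach,second_countable_topology}"
  assumes "f \<in> borel_measurable borel" "\<And>x. norm (f x) \<le> M"
  shows "integrable torus f"
  using assms by (intro torus.integrable_const_bound[of _ M]) auto

lemma integrable_torus_continuous:
  fixes f :: "real^'d::finite \<Rightarrow> 'a::{banach,second_countable_topology}"
  assumes "periodic f" "continuous_on UNIV f"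
  shows "integrable torus f"
  using continuous_periodic_bounded[OF assms] integrable_torus_bounded borel_measurable_continuous_onI[OF assms(2)]
  by metis

lemma lborel_integral_translate:
  fixes g :: "real^'d::finite \<Rightarrow> 'a::{banach,second_countable_topology}"
  assumes "g \<in> borel_measurable borel"
  shows "(LINT x|lborel. g (c + x)) = (LINT x|lborel. g x)"
proof -
  have "(LINT x|lborel. g x) = (LINT x|distr lborel borel ((+) c). g x)"
    by (simp add: lborel_distr_plus)
  also have "\<dots> = (LINT x|lborel. g (c + x))"
    using assms by (intro integral_distr) auto
  finally show ?thesis by simp
qed

text \<open>The shifted cell is a slab whose part beyond 2 pi in direction \<open>i\<close> is moved
  back by one period, where it fills the gap left at the bottom.\<close>

lemma torus_integral_shift:
  fixes f :: "real^'d::finite \<Rightarrow> 'a::{banach,second_countable_topology}"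
  assumes f: "periodic f" "continuous_on UNIV f" and t: "0 \<le> t" "t \<le> 2 * pi"
  shows "(LINT x|torus. f (shift i t x)) = (LINT x|torus. f x)"
proof -
  have [measurable]: "f \<in> borel_measurable borel" by (intro borel_measurable_continuous_onI f)
  obtain M where M: "\<And>x. norm (f x) \<le> M" using continuous_periodic_bounded[OF f] by blast
  define slab :: "real \<Rightarrow> real \<Rightarrow> (real^'d) set"
    where "slab a b = {x. a \<le> x $ i \<and> x $ i < b \<and> (\<forall>j. j \<noteq> i \<longrightarrow> 0 \<le> x $ j \<and> x $ j < 2 * pi)}" for a b
  have [measurable]: "slab a b \<in> sets borel" for a b unfolding slab_def by measurable
  have int: "integrable lborel (\<lambda>x. indicator (slab a b) x *\<^sub>R f x)" for a b
  proof (rule integrableI_bounded_set_indicator)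
    have "emeasure lborel (slab a b) \<le> emeasure lborel (cbox (\<chi> j. if j = i then a else 0) (\<chi> j. if j = i then b else 2 * pi))"
      by (intro emeasure_mono) (auto simp: slab_def mem_box_cart less_imp_le)
    also have "\<dots> < \<infinity>" by (rule emeasure_bounded_finite) simp
    finally show "emeasure lborel (slab a b) < \<infinity>" .
  qed (use M in auto)
  have split: "indicator (slab a c) x *\<^sub>R f x = indicator (slab a b) x *\<^sub>R f x + indicator (slab b c) x *\<^sub>R f x"
    if "a \<le> b" "b \<le> c" for a b c x
    using that by (auto simp: slab_def indicator_def)
  have cell: "cell = slab 0 (2 * pi)" by (auto simp: cell_def slab_def)
  have move: "(LINT x|lborel. indicator (slab a b) x *\<^sub>R f (shift i s x)) = (LINT x|lborel. indicator (slab (a + s) (b + s)) x *\<^sub>R f x)"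
    for a b s
  proof -
    have ind: "indicator (slab (a + s) (b + s)) (shift i s x) = (indicator (slab a b) x :: real)" for x
      by (auto simp: slab_def indicator_def axis_def)
    have "(LINT x|lborel. indicator (slab (a + s) (b + s)) x *\<^sub>R f x)
        = (LINT x|lborel. indicator (slab (a + s) (b + s)) (s *\<^sub>R axis i 1 + x) *\<^sub>R f (s *\<^sub>R axis i 1 + x))"
      by (rule lborel_integral_translate[symmetric]) measurable
    also have "\<dots> = (LINT x|lborel. indicator (slab a b) x *\<^sub>R f (shift i s x))"
      by (simp add: ind add.commute[of "s *\<^sub>R axis i 1"])
    finally show ?thesis by simp
  qed
  have "(LINT x|torus. f (shift i t x)) = (LINT x|lborel. indicator (slab t (2 * pi + t)) x *\<^sub>R f x)"
    using move[of 0 "2 * pi" t] by (simp add: integral_torus cell)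
  also have "\<dots> = (LINT x|lborel. indicator (slab t (2 * pi)) x *\<^sub>R f x) + (LINT x|lborel. indicator (slab (2 * pi) (2 * pi + t)) x *\<^sub>R f x)"
    using t by (subst split[of t "2 * pi"]) (auto intro: Bochner_Integration.integral_add int)
  also have "(LINT x|lborel. indicator (slab (2 * pi) (2 * pi + t)) x *\<^sub>R f x) = (LINT x|lborel. indicator (slab 0 t) x *\<^sub>R f x)"
    using move[of 0 t "2 * pi"] by (simp add: periodicD[OF f(1)] add.commute)
  also have "(LINT x|lborel. indicator (slab t (2 * pi)) x *\<^sub>R f x) + (LINT x|lborel. indicator (slab 0 t) x *\<^sub>R f x)
      = (LINT x|lborel. indicator (slab 0 t) x *\<^sub>R f x + indicator (slab t (2 * pi)) x *\<^sub>R f x)"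
    by (subst Bochner_Integration.integral_add) (auto intro: int)
  also have "\<dots> = (LINT x|torus. f x)"
    using t by (subst split[of 0 t "2 * pi", symmetric]) (auto simp: integral_torus cell)
  finally show ?thesis .
qed

text \<open>The regularity that one integration by parts in direction \<open>i\<close> consumes; no
  other direction is differentiated.\<close>

definition C1dir :: "'d::finite \<Rightarrow> (real^'d \<Rightarrow> 'a::real_normed_vector) \<Rightarrow> bool" where
  "C1dir i f \<longleftrightarrow> periodic f \<and> continuous_on UNIV f \<and>
     (\<forall>x. (\<lambda>t. f (shift i t x)) differentiable (at (0::real))) \<and> continuous_on UNIV (pdiff i f)"

lemma C1dir_deriv:
  assumes "C1dir i f"
  shows "((\<lambda>t. f (shift i t x)) has_vector_derivative pdiff i f (shift i s x)) (at s)"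
proof -
  have "((\<lambda>t. f (shift i t (shift i s x))) has_vector_derivative pdiff i f (shift i s x)) (at 0)"
    unfolding pdiff_def using assms by (intro vector_derivative_works[THEN iffD1]) (auto simp: C1dir_def)
  then have "((\<lambda>t. f (shift i t (shift i s x))) \<circ> (\<lambda>\<tau>. \<tau> - s) has_vector_derivative 1 *\<^sub>R pdiff i f (shift i s x)) (at s)"
    by (intro vector_diff_chain_at) (auto intro!: derivative_eq_intros)
  moreover have "(\<lambda>t. f (shift i t (shift i s x))) \<circ> (\<lambda>\<tau>. \<tau> - s) = (\<lambda>t. f (shift i t x))"
    by (auto simp: fun_eq_iff algebra_simps)
  ultimately show ?thesis by simp
qed

lemma C1dir_deriv0:
  assumes "C1dir i f"
  shows "((\<lambda>t. f (shift i t x)) has_vector_derivative pdiff i f x) (at 0)"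
  using C1dir_deriv[OF assms, of x 0] by simp

lemma pdiffI: "((\<lambda>t. f (shift i t x)) has_vector_derivative D) (at 0) \<Longrightarrow> pdiff i f x = D"
  unfolding pdiff_def by (rule vector_derivative_at)

lemma C1dirI:
  assumes "periodic f" "continuous_on UNIV f" "continuous_on UNIV g"
    and d: "\<And>x. ((\<lambda>t. f (shift i t x)) has_vector_derivative g x) (at 0)"
  shows "C1dir i f" and "pdiff i f = g"
proof -
  show "pdiff i f = g" using pdiffI[OF d] by blast
  with assms show "C1dir i f"
    unfolding C1dir_def by (auto intro: differentiableI_vector)
qed

lemma periodic_comp_shift:
  assumes "periodic f"
  shows "periodic (\<lambda>x. f (shift i t x))"
proof -
  have "f (shift i t (shift j (2 * pi) x)) = f (shift i t x)" for j x
    using periodicD[OF assms, where i=j and x="shift i t x"] by (simp add: add_ac)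
  then show ?thesis unfolding periodic_shift by blast
qed

lemma periodic_pdiff:
  assumes "periodic f"
  shows "periodic (pdiff i f)"
proof -
  have "f (shift i t (shift j (2 * pi) x)) = f (shift i t x)" for j t x
    using periodic_comp_shift[OF assms, where i=i and t=t] unfolding periodic_shift by blast
  then show ?thesis unfolding periodic_shift pdiff_def by simp
qed

lemma
  assumes "C1dir i f"
  shows C1dir_periodic: "periodic f" and C1dir_cont: "continuous_on UNIV f"
    and C1dir_periodic_pdiff: "periodic (pdiff i f)" and C1dir_cont_pdiff: "continuous_on UNIV (pdiff i f)"
  using assms periodic_pdiff unfolding C1dir_def by auto

lemma has_vector_derivative_at_0_iff:
  "(f has_vector_derivative D) (at 0) \<longleftrightarrow> ((\<lambda>t. (f t - f 0) /\<^sub>R t) \<longlongrightarrow> D) (at (0::real))"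
proof -
  have "norm (f t - f 0 - t *\<^sub>R D) / norm t = norm ((f t - f 0) /\<^sub>R t - D)" if "t \<noteq> 0" for t
  proof -
    have "(f t - f 0) /\<^sub>R t - D = (f t - f 0 - t *\<^sub>R D) /\<^sub>R t"
      using that by (simp add: scaleR_diff_right)
    then show ?thesis by (simp add: divide_inverse mult.commute)
  qed
  then have "\<forall>\<^sub>F t in at 0. norm (f t - f 0 - t *\<^sub>R D) / norm t = norm ((f t - f 0) /\<^sub>R t - D)"
    by (simp add: eventually_at_filter)
  from tendsto_cong[OF this, of 0] show ?thesis
    unfolding has_vector_derivative_def has_derivative_at
    by (simp add: bounded_linear_scaleR_left tendsto_norm_zero_iff LIM_zero_iff)
qed

lemma C1dir_difference_quotient:
  fixes f :: "real^'d::finite \<Rightarrow> 'a::real_normed_vector"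
  assumes f: "C1dir i f" and t: "t \<longlonglongrightarrow> 0" "\<And>n. t n \<noteq> 0"
  shows "(\<lambda>n. (f (shift i (t n) x) - f x) /\<^sub>R t n) \<longlonglongrightarrow> pdiff i f x"
proof -
  have "((\<lambda>h. (f (shift i h x) - f x) /\<^sub>R h) \<longlongrightarrow> pdiff i f x) (at 0)"
    using C1dir_deriv0[OF f, of x] unfolding has_vector_derivative_at_0_iff by simp
  then show ?thesis
    by (rule filterlim_compose) (use t in \<open>auto simp: filterlim_at\<close>)
qed

lemma C1dir_difference_quotient_bound:
  fixes f :: "real^'d::finite \<Rightarrow> 'a::real_normed_vector"
  assumes f: "C1dir i f"
  shows "\<exists>M>0. \<forall>t x. t \<noteq> 0 \<longrightarrow> norm ((f (shift i t x) - f x) /\<^sub>R t) \<le> M"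
proof -
  obtain M where M: "M > 0" "\<And>x. norm (pdiff i f x) \<le> M"
    using continuous_periodic_bounded[OF C1dir_periodic_pdiff[OF f] C1dir_cont_pdiff[OF f]] by blast
  have "norm ((f (shift i t x) - f x) /\<^sub>R t) \<le> 3 * M" if "t \<noteq> 0" for t x
  proof -
    \<comment> \<open>Along the line the derivative varies by at most 2 M, so the linearization errs
      by at most 2 M |t|; the linear term adds M |t|.\<close>
    have "norm (f (shift i t x) - f (shift i 0 x) - (t - 0) *\<^sub>R pdiff i f (shift i 0 x)) \<le> norm (t - 0) * (2 * M)"
    proof (rule vector_differentiable_bound_linearization[where S=UNIV and f'="\<lambda>s. pdiff i f (shift i s x)"])
      show "norm (pdiff i f (shift i s x) - pdiff i f (shift i 0 x)) \<le> 2 * M" for s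
        using norm_triangle_ineq4[of "pdiff i f (shift i s x)" "pdiff i f (shift i 0 x)"] M(2)[of "shift i s x"] M(2)[of "shift i 0 x"]
        by linarith
    qed (use C1dir_deriv[OF f] in auto)
    moreover have "norm (t *\<^sub>R pdiff i f x) \<le> \<bar>t\<bar> * M" using M(2)[of x] by (simp add: mult_left_mono)
    ultimately have "norm (f (shift i t x) - f x) \<le> \<bar>t\<bar> * (3 * M)"
      using norm_triangle_ineq2[of "f (shift i t x) - f x" "t *\<^sub>R pdiff i f x"] by simp
    then show ?thesis unfolding norm_scaleR using that by (simp add: field_simps)
  qed
  then show ?thesis using M(1) by (intro exI[of _ "3 * M"]) auto
qed

text \<open>Difference quotients have integral zero by translation invariance, and they converge
  dominatedly to the derivative.\<close>

lemma integral_pdiff_zero: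
  fixes f :: "real^'d::finite \<Rightarrow> 'a::{banach,second_countable_topology}"
  assumes f: "C1dir i f"
  shows "(LINT x|torus. pdiff i f x) = 0"
proof -
  define t where "t n = 1 / real (Suc n)" for n
  have t: "t \<longlonglongrightarrow> 0" "\<And>n. t n \<noteq> 0" "\<And>n. 0 \<le> t n" "\<And>n. t n \<le> 2 * pi"
  proof -
    show "t \<longlonglongrightarrow> 0" unfolding t_def using LIMSEQ_inverse_real_of_nat by (simp add: inverse_eq_divide)
    show "t n \<le> 2 * pi" for n
      using pi_gt3 order_trans[of "t n" 1 "2 * pi"] by (simp add: t_def)
  qed (auto simp: t_def)
  obtain M where M: "\<forall>t x. t \<noteq> 0 \<longrightarrow> norm ((f (shift i t x) - f x) /\<^sub>R t) \<le> M"
    using C1dir_difference_quotient_bound[OF f] by blast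
  note c = C1dir_cont[OF f] C1dir_periodic[OF f]
  have [measurable]: "f \<in> borel_measurable borel" "pdiff i f \<in> borel_measurable borel"
    by (intro borel_measurable_continuous_onI c C1dir_cont_pdiff[OF f])+
  have cs: "continuous_on UNIV (\<lambda>x. f (shift i s x))" for s
    by (rule continuous_on_compose2[OF c(1)]) (auto intro!: continuous_intros)
  note ps = periodic_comp_shift[OF c(2)]
  have "(\<lambda>n. LINT x|torus. (f (shift i (t n) x) - f x) /\<^sub>R t n) \<longlonglongrightarrow> (LINT x|torus. pdiff i f x)"
  proof (rule integral_dominated_convergence[where w="\<lambda>_. M"])
    show "AE x in torus. (\<lambda>n. (f (shift i (t n) x) - f x) /\<^sub>R t n) \<longlonglongrightarrow> pdiff i f x"
      using C1dir_difference_quotient[OF f t(1,2)] by simp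
    show "AE x in torus. norm ((f (shift i (t n) x) - f x) /\<^sub>R t n) \<le> M" for n
      using M t(2) by simp
    show "(\<lambda>x. (f (shift i (t n) x) - f x) /\<^sub>R t n) \<in> borel_measurable torus" for n
      by (intro measurable_torus borel_measurable_continuous_onI continuous_intros cs c)
  qed auto
  moreover have zero: "(LINT x|torus. (f (shift i (t n) x) - f x) /\<^sub>R t n) = 0" for n
    using torus_integral_shift[OF c(2,1) t(3,4), where i=i]
    by (simp add: Bochner_Integration.integral_diff integrable_torus_continuous[OF ps cs] integrable_torus_continuous[OF c(2,1)])
  ultimately have "(\<lambda>n::nat. 0) \<longlonglongrightarrow> (LINT x|torus. pdiff i f x)"
    by (simp only: zero)
  then show ?thesis by (simp add: LIMSEQ_const_iff)
qed

section \<open>Fourier series\<close>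

definition ek :: "int^'d::finite \<Rightarrow> real^'d \<Rightarrow> complex" where
  "ek k x = cis (\<Sum>i\<in>UNIV. of_int (k $ i) * x $ i)"

lemma norm_ek [simp]: "cmod (ek k x) = 1"
  by (simp add: ek_def)

lemma ek_add: "ek (k + l) x = ek k x * ek l x"
  by (simp add: ek_def cis_mult sum.distrib distrib_right)

lemma ek_0 [simp]: "ek 0 x = 1"
  by (simp add: ek_def)

lemma cnj_ek: "cnj (ek k x) = ek (- k) x"
  by (simp add: ek_def cis_cnj sum_negf)

lemma ek_shift: "ek k (shift i t x) = cis (of_int (k $ i) * t) * ek k x"
proof -
  have "(\<Sum>j\<in>UNIV. of_int (k $ j) * shift i t x $ j) = of_int (k $ i) * t + (\<Sum>j\<in>UNIV. of_int (k $ j) * x $ j)"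
    unfolding shift_component
    by (subst (1 2) sum.remove[of UNIV i]) (auto simp: algebra_simps intro!: sum.cong)
  then show ?thesis by (simp only: ek_def cis_mult)
qed

lemma periodic_ek: "periodic (ek k)"
proof -
  have "cis (of_int n * (2 * pi)) = 1" for n
    using cis_multiple_2pi[of "of_int n"] by (simp add: mult.commute)
  then show ?thesis unfolding periodic_shift by (simp only: ek_shift) simp
qed

lemma continuous_ek: "continuous_on UNIV (ek k)"
  unfolding ek_def by (intro continuous_intros)

lemma ek_measurable [measurable]: "ek k \<in> borel_measurable borel"
  by (intro borel_measurable_continuous_onI continuous_ek)

lemma ek_has_deriv:
  "((\<lambda>t. ek k (shift i t x)) has_vector_derivative \<i> * of_int (k $ i) * ek k x) (at 0)"
proof -
  have "((\<lambda>t. cis (of_int (k $ i) * t)) has_vector_derivative \<i> * of_int (k $ i)) (at 0)"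
  proof -
    have "((\<lambda>z. exp (\<i> * (of_int (k $ i) * z))) has_field_derivative \<i> * of_int (k $ i)) (at (of_real 0))"
      by (auto intro!: derivative_eq_intros)
    from has_vector_derivative_real_field[OF this] show ?thesis by (simp add: cis_conv_exp)
  qed
  then show ?thesis unfolding ek_shift by (rule has_vector_derivative_mult_left)
qed

lemma C1dir_ek: "C1dir i (ek k)" and pdiff_ek: "pdiff i (ek k) = (\<lambda>x. \<i> * of_int (k $ i) * ek k x)"
proof -
  have "continuous_on UNIV (\<lambda>x. \<i> * of_int (k $ i) * ek k x)"
    by (intro continuous_intros continuous_ek)
  from C1dirI[OF periodic_ek continuous_ek this ek_has_deriv]
  show "C1dir i (ek k)" "pdiff i (ek k) = (\<lambda>x. \<i> * of_int (k $ i) * ek k x)" by auto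
qed

text \<open>A character with k_i nonzero is a multiple of its own derivative in direction
  \<open>i\<close>, whose integral vanishes.\<close>

lemma integral_ek: "(LINT x|torus. ek k x) = (if k = 0 then of_real (vol TYPE('d::finite)) else 0)" for k :: "int^'d"
proof (cases "k = 0")
  case True
  then show ?thesis by (simp add: vol_def scaleR_conv_of_real)
next
  case False
  then obtain i where "k $ i \<noteq> 0" by (auto simp: vec_eq_iff)
  moreover have "\<i> * of_int (k $ i) * (LINT x|torus. ek k x) = 0"
    using integral_pdiff_zero[OF C1dir_ek, of i k] by (simp add: pdiff_ek)
  ultimately show ?thesis using False by simp
qed

section \<open>Trigonometric polynomials and uniqueness of Fourier coefficients\<close>

inductive trig :: "(real^'d::finite \<Rightarrow> complex) \<Rightarrow> bool" where
  monomial: "trig (\<lambda>x. c * ek k x)"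
| add: "trig p \<Longrightarrow> trig q \<Longrightarrow> trig (\<lambda>x. p x + q x)"

lemma trig_const: "trig (\<lambda>x. c)"
  using trig.monomial[of c 0] by simp

lemma trig_mult:
  assumes "trig p" "trig q"
  shows "trig (\<lambda>x. p x * q x)"
  using assms
proof (induction p)
  case (monomial c k)
  then show ?case
  proof (induction q)
    case (monomial c' k')
    show ?case using trig.monomial[of "c * c'" "k + k'"] by (simp add: ek_add mult_ac)
  qed (simp add: distrib_left trig.add)
qed (simp add: distrib_right trig.add)

lemma trig_integral_zero:
  assumes f: "integrable torus f" "\<And>k. (LINT x|torus. f x * ek k x) = 0" and "trig p"
  shows "integrable torus (\<lambda>x. f x * p x) \<and> (LINT x|torus. f x * p x) = 0"
  using \<open>trig p\<close>
proof (induction rule: trig.induct)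
  case (monomial c k)
  have [measurable]: "f \<in> borel_measurable torus" using f(1) by simp
  have "(\<lambda>x. f x * ek k x) \<in> borel_measurable torus" by measurable
  then have "integrable torus (\<lambda>x. f x * ek k x)"
    by (intro Bochner_Integration.integrable_bound[OF f(1)]) (simp_all add: norm_mult)
  then have "integrable torus (\<lambda>x. c * (f x * ek k x))" "(LINT x|torus. c * (f x * ek k x)) = 0"
    using f(2) by simp_all
  then show ?case by (simp add: mult_ac)
qed (simp add: distrib_left)

text \<open>The half-open cell is not compact; wrapping it onto a product of circles glues opposite
  faces, makes the target compact and stays injective on the cell.\<close>

definition circ :: "real^'d::finite \<Rightarrow> complex^'d" where
  "circ x = (\<chi> i. cis (x $ i))"

lemma circ_component [simp]: "circ x $ i = cis (x $ i)"
  by (simp add: circ_def)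

lemma continuous_circ: "continuous_on S circ"
  unfolding circ_def by (intro continuous_intros)

lemma circ_inj: "inj_on circ cell"
proof (rule inj_onI)
  fix x y :: "real^'a" assume xy: "x \<in> cell" "y \<in> cell" "circ x = circ y"
  have "x $ i = y $ i" for i
  proof -
    have arg: "Arg2pi (cis a) = a" if "0 \<le> a" "a < 2 * pi" for a
      by (rule Arg2pi_unique[of 1]) (use that in \<open>auto simp: cis_conv_exp\<close>)
    have "cis (x $ i) = cis (y $ i)" using arg_cong[OF xy(3), of "\<lambda>z. z $ i"] by simp
    moreover have "Arg2pi (cis (x $ i)) = x $ i" "Arg2pi (cis (y $ i)) = y $ i"
      using xy(1,2) by (intro arg; simp add: cell_def)+
    ultimately show ?thesis by metis
  qed
  then show "x = y" by (simp add: vec_eq_iff)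
qed

lemma ek_axis: "ek (axis i n) x = cis (of_int n * x $ i)"
  unfolding ek_def by (subst sum.remove[of UNIV i]) (auto simp: axis_def)

text \<open>This is Stone-Weierstrass on the product of circles.\<close>

lemma continuous_integral_zero:
  fixes f :: "real^'d::finite \<Rightarrow> complex" and h :: "complex^'d \<Rightarrow> real"
  assumes f: "integrable torus f" "\<And>k. (LINT x|torus. f x * ek k x) = 0"
    and h: "continuous_on UNIV h"
  shows "(LINT x|torus. h (circ x) *\<^sub>R f x) = 0"
proof -
  define K :: "(complex^'d) set" where "K = {z. \<forall>i. cmod (z $ i) = 1}"
  have circK: "circ x \<in> K" for x by (simp add: K_def)
  have Kimg: "\<exists>x. z = circ x" if "z \<in> K" for z
  proof -
    have "\<exists>a. z $ i = cis a" for i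
      using that Arg2pi[of "z $ i"] by (intro exI[of _ "Arg2pi (z $ i)"]) (simp add: K_def cis_conv_exp is_Arg_def)
    then obtain a where "\<And>i. z $ i = cis (a i)" by metis
    then show ?thesis by (intro exI[of _ "\<chi> i. a i"]) (simp add: vec_eq_iff)
  qed
  have "compact K"
  proof -
    have "K = circ ` cbox 0 (\<chi> i. 2 * pi)"
    proof safe
      fix z assume "z \<in> K"
      then have "\<exists>a. 0 \<le> a \<and> a \<le> 2 * pi \<and> z $ i = cis a" for i
        using Arg2pi[of "z $ i"] by (intro exI[of _ "Arg2pi (z $ i)"]) (auto simp: K_def cis_conv_exp is_Arg_def)
      then obtain a where "\<And>i. 0 \<le> a i \<and> a i \<le> 2 * pi \<and> z $ i = cis (a i)" by metis
      then show "z \<in> circ ` cbox 0 (\<chi> i. 2 * pi)"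
        by (intro image_eqI[of _ _ "\<chi> i. a i"]) (auto simp: vec_eq_iff mem_box_cart)
    qed (simp add: K_def)
    then show ?thesis by (simp add: compact_continuous_image continuous_circ)
  qed
  have [measurable]: "circ \<in> borel_measurable borel"
    by (intro borel_measurable_continuous_onI continuous_circ)
  have [measurable]: "h \<in> borel_measurable borel"
    by (intro borel_measurable_continuous_onI h)
  \<comment> \<open>The real algebra for Stone-Weierstrass: functions on the circles whose pullback
    is a trigonometric polynomial. Real and imaginary parts of the coordinates pull back to cosines
    and sines and separate points.\<close>
  define P where "P g \<longleftrightarrow> continuous_on K g \<and> trig (\<lambda>x. complex_of_real (g (circ x)))" for g
  have half: "trig (\<lambda>x. complex_of_real (Re (cis (x $ i))))" "trig (\<lambda>x. complex_of_real (Im (cis (x $ i))))" for i :: 'd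
  proof -
    have "trig (\<lambda>x. 1/2 * ek (axis i 1) x + 1/2 * ek (axis i (- 1)) x)"
      by (intro trig.intros)
    moreover have "1/2 * ek (axis i 1) x + 1/2 * ek (axis i (- 1)) x = complex_of_real (Re (cis (x $ i)))" for x
      by (simp add: ek_axis complex_eq_iff)
    ultimately show "trig (\<lambda>x. complex_of_real (Re (cis (x $ i))))" by (simp only:)
    have "trig (\<lambda>x. (- \<i>/2) * ek (axis i 1) x + \<i>/2 * ek (axis i (- 1)) x)"
      by (intro trig.intros)
    moreover have "(- \<i>/2) * ek (axis i 1) x + \<i>/2 * ek (axis i (- 1)) x = complex_of_real (Im (cis (x $ i)))" for x
      by (simp add: ek_axis complex_eq_iff)
    ultimately show "trig (\<lambda>x. complex_of_real (Im (cis (x $ i))))" by (simp only:)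
  qed
  have ex: "\<exists>g. P g \<and> (\<forall>z\<in>K. \<bar>h z - g z\<bar> < e)" if "e > 0" for e
  proof (rule Stone_Weierstrass_HOL[OF \<open>compact K\<close>])
    show "P (\<lambda>x. c)" for c by (auto simp: P_def trig_const)
    show "P g \<Longrightarrow> continuous_on K g" for g by (simp add: P_def)
    show "P f \<and> P g \<Longrightarrow> P (\<lambda>x. f x + g x)" "P f \<and> P g \<Longrightarrow> P (\<lambda>x. f x * g x)" for f g
      by (auto simp: P_def intro: continuous_intros trig.add trig_mult)
    show "\<exists>g. P g \<and> g z \<noteq> g w" if zw: "z \<in> K \<and> w \<in> K \<and> z \<noteq> w" for z w
    proof -
      obtain i where i: "z $ i \<noteq> w $ i" using zw by (auto simp: vec_eq_iff)
      have "P (\<lambda>z. Re (z $ i))" "P (\<lambda>z. Im (z $ i))"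
        unfolding P_def using half by (auto intro!: continuous_intros)
      then show ?thesis using i by (metis complex_eqI)
    qed
    show "continuous_on K h" using h continuous_on_subset by blast
  qed fact
  obtain B where B: "\<And>z. z \<in> K \<Longrightarrow> \<bar>h z\<bar> \<le> B"
    using compact_imp_bounded[OF compact_continuous_image[OF continuous_on_subset[OF h] \<open>compact K\<close>]]
    unfolding bounded_iff by auto
  have int_h: "integrable torus (\<lambda>x. h (circ x) *\<^sub>R f x)"
  proof (rule Bochner_Integration.integrable_bound)
    show "integrable torus (\<lambda>x. B *\<^sub>R f x)" using f(1) by simp
    have "cmod (h (circ x) *\<^sub>R f x) \<le> cmod (B *\<^sub>R f x)" for x
      using B[OF circK[of x]] by (auto simp: intro!: mult_right_mono)
    then show "AE x in torus. norm (h (circ x) *\<^sub>R f x) \<le> norm (B *\<^sub>R f x)" by simp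
  qed (use f(1) in measurable)
  have small: "cmod (LINT x|torus. h (circ x) *\<^sub>R f x) \<le> e * (LINT x|torus. cmod (f x))" if e: "e > 0" for e
  proof -
    obtain g where g: "P g" "\<And>z. z \<in> K \<Longrightarrow> \<bar>h z - g z\<bar> < e" using ex[OF e] by blast
    note gz = trig_integral_zero[OF f, of "\<lambda>x. complex_of_real (g (circ x))"]
    have "(LINT x|torus. h (circ x) *\<^sub>R f x) = (LINT x|torus. h (circ x) *\<^sub>R f x - f x * complex_of_real (g (circ x)))"
      using gz g(1) by (subst Bochner_Integration.integral_diff) (auto simp: P_def int_h)
    also have "cmod \<dots> \<le> (LINT x|torus. cmod (h (circ x) *\<^sub>R f x - f x * complex_of_real (g (circ x))))"
      by (rule Bochner_Integration.integral_norm_bound)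
    also have "\<dots> \<le> (LINT x|torus. e * cmod (f x))"
    proof (rule integral_mono)
      show "integrable torus (\<lambda>x. cmod (h (circ x) *\<^sub>R f x - f x * complex_of_real (g (circ x))))"
        using gz g(1) by (auto simp: P_def int_h)
      show "integrable torus (\<lambda>x. e * cmod (f x))" using f(1) by simp
      show "cmod (h (circ x) *\<^sub>R f x - f x * complex_of_real (g (circ x))) \<le> e * cmod (f x)" for x
      proof -
        have "h (circ x) *\<^sub>R f x - f x * complex_of_real (g (circ x)) = (h (circ x) - g (circ x)) *\<^sub>R f x"
          by (simp add: scaleR_conv_of_real algebra_simps)
        then show ?thesis using g(2)[OF circK[of x]] by (simp add: mult_right_mono)
      qed
    qed
    finally show ?thesis by simp
  qed
  \<comment> \<open>The summand 1 keeps the denominator positive even if the integral of |f|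
    vanishes.\<close>
  have le: "cmod (LINT x|torus. h (circ x) *\<^sub>R f x) \<le> e" if "e > 0" for e
  proof -
    have "cmod (LINT x|torus. h (circ x) *\<^sub>R f x) \<le> e / ((LINT x|torus. cmod (f x)) + 1) * (LINT x|torus. cmod (f x))"
      by (rule small) (use that in \<open>auto intro!: divide_pos_pos add_nonneg_pos\<close>)
    also have "\<dots> \<le> e * 1"
    proof -
      define I where "I = (LINT x|torus. cmod (f x))"
      have "0 \<le> I" by (simp add: I_def)
      then have "0 < I + 1" "e * I \<le> e * 1 * (I + 1)" using that by (simp_all add: algebra_simps)
      then show ?thesis unfolding I_def[symmetric] by (simp add: divide_le_eq)
    qed
    finally show ?thesis by simp
  qed
  have "cmod (LINT x|torus. h (circ x) *\<^sub>R f x) \<le> 0"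
    by (rule field_le_epsilon) (use le in auto)
  then show ?thesis by simp
qed

text \<open>Closed sets are stable under intersection and generate the Borel sets, so by the
  pi-lambda argument all set integrals vanish. Real and imaginary part are then zero
  densities.\<close>

lemma AE_zero_from_closed:
  fixes g :: "real^'d::finite \<Rightarrow> complex"
  assumes g: "integrable lborel g" and closed: "\<And>A. closed A \<Longrightarrow> (LINT x:A|lborel. g x) = 0"
  shows "AE x in lborel. g x = 0"
proof -
  have int: "set_integrable lborel A g" if "A \<in> sets borel" for A
    unfolding set_integrable_def using integrable_mult_indicator[of A lborel g] that g by simp
  have zero: "(LINT x:A|lborel. g x) = 0" if "A \<in> sets borel" for A
  proof -
    have "Int_stable (Collect closed :: (real^'d) set set)" "(Collect closed :: (real^'d) set set) \<subseteq> Pow UNIV"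
      "A \<in> sigma_sets UNIV (Collect closed)"
      using that by (auto simp: borel_eq_closed Int_stable_def)
    then show ?thesis
    proof (induction rule: sigma_sets_induct_disjoint)
      case (basic A)
      then show ?case using closed by simp
    next
      case empty
      show ?case by (simp add: set_lebesgue_integral_def)
    next
      case (compl A)
      then have A: "A \<in> sets borel" by (simp add: borel_eq_closed)
      have "(LINT x:UNIV|lborel. g x) = (LINT x:A|lborel. g x) + (LINT x:(UNIV - A)|lborel. g x)"
        using A by (subst set_integral_Un[symmetric]) (auto intro!: int)
      then show ?case using compl closed[of UNIV] by simp
    next
      case (union A)
      then have A: "A i \<in> sets borel" for i by (auto simp: borel_eq_closed)
      have "(LINT x:(\<Union>i. A i)|lborel. g x) = (\<Sum>i. LINT x:A i|lborel. g x)"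
        using A union(1) by (intro lebesgue_integral_countable_add int) (auto simp: disjoint_family_on_def)
      then show ?case using union by simp
    qed
  qed
  have "AE x in lborel. Re (g x) = 0" "AE x in lborel. Im (g x) = 0"
  proof -
    have "(LINT x:A|lborel. Re (g x)) = 0" "(LINT x:A|lborel. Im (g x)) = 0" if A: "A \<in> sets lborel" for A
    proof -
      have "(LINT x:A|lborel. Re (g x)) = Re (LINT x:A|lborel. g x)" "(LINT x:A|lborel. Im (g x)) = Im (LINT x:A|lborel. g x)"
        using int[of A] A unfolding set_lebesgue_integral_def set_integrable_def by (simp_all flip: integral_Re integral_Im)
      then show "(LINT x:A|lborel. Re (g x)) = 0" "(LINT x:A|lborel. Im (g x)) = 0" using zero[of A] A by simp_all
    qed
    then show "AE x in lborel. Re (g x) = 0" "AE x in lborel. Im (g x) = 0"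
      using g by (intro density_unique_real; simp)+
  qed
  then show ?thesis by eventually_elim (simp add: complex_eq_iff)
qed

lemma AE_torus_iff: "(AE x in torus. P x) \<longleftrightarrow> (AE x in lborel. x \<in> cell \<longrightarrow> P x)"
  unfolding torus_eq by (rule AE_restrict_space_iff) simp

lemma integrable_torus_iff:
  fixes f :: "real^'d::finite \<Rightarrow> 'a::{banach,second_countable_topology}"
  shows "integrable torus f \<longleftrightarrow> integrable lborel (\<lambda>x. indicator cell x *\<^sub>R f x)"
  unfolding torus_eq by (rule integrable_restrict_space) simp

text \<open>Continuous functions of \<open>circ x\<close> integrate to zero against
  \<open>f\<close>. They approximate the indicator of a compact subset of the cell, and such subsets
  exhaust the cell part of any closed set.\<close>

theorem fourier_uniqueness:
  fixes f :: "real^'d::finite \<Rightarrow> complex"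
  assumes f: "integrable torus f" "\<And>k. (LINT x|torus. f x * ek k x) = 0"
  shows "AE x in torus. f x = 0"
proof -
  define g where "g x = indicator cell x *\<^sub>R f x" for x
  have g: "integrable lborel g" using f(1) unfolding integrable_torus_iff g_def .
  have zeroQ: "(LINT x:Q|lborel. g x) = 0" if Q: "compact Q" "Q \<subseteq> cell" for Q
  proof (cases "Q = {}")
    case False
    define C where "C = circ ` Q"
    have C: "closed C" "C \<noteq> {}"
      using Q False compact_imp_closed[OF compact_continuous_image[OF continuous_circ]] by (auto simp: C_def)
    \<comment> \<open>Cutoffs by the distance to the image of \<open>Q\<close>. They are 1 on
      \<open>Q\<close>, and at any other point of the cell they eventually vanish, because
      \<open>circ\<close> is injective there and the image is closed.\<close>
    define h where "h n z = max 0 (1 - real n * infdist z C)" for n z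
    have hcont: "continuous_on UNIV (h n)" for n unfolding h_def by (intro continuous_intros)
    have [measurable]: "circ \<in> borel_measurable borel"
      by (intro borel_measurable_continuous_onI continuous_circ)
    have [measurable]: "h n \<in> borel_measurable borel" for n
      by (intro borel_measurable_continuous_onI hcont)
    have [measurable]: "Q \<in> sets borel" using Q(1) by (simp add: borel_compact)
    have lim: "(\<lambda>n. h n (circ x)) \<longlonglongrightarrow> indicator Q x" if "x \<in> cell" for x
    proof (cases "x \<in> Q")
      case True
      then have "infdist (circ x) C = 0" by (auto simp: C_def)
      then show ?thesis using True by (simp add: h_def)
    next
      case False
      then have "circ x \<notin> C" using inj_onD[OF circ_inj _ that] Q(2) by (auto simp: C_def)
      then have pos: "infdist (circ x) C > 0" using C infdist_pos_not_in_closed by blast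
      then obtain N where N: "1 < real N * infdist (circ x) C" using ex_less_of_nat_mult by blast
      have "h n (circ x) = 0" if "n \<ge> N" for n
      proof -
        have "real N * infdist (circ x) C \<le> real n * infdist (circ x) C"
          using that pos by (intro mult_right_mono) auto
        then show ?thesis using N by (simp add: h_def)
      qed
      then have "\<forall>\<^sub>F n in sequentially. h n (circ x) = 0" by (auto simp: eventually_sequentially)
      then show ?thesis using False by (simp add: tendsto_eventually)
    qed
    have "(\<lambda>n. LINT x|torus. h n (circ x) *\<^sub>R f x) \<longlonglongrightarrow> (LINT x|torus. indicator Q x *\<^sub>R f x)"
    proof (rule integral_dominated_convergence[where w="\<lambda>x. norm (f x)"])
      show "AE x in torus. (\<lambda>n. h n (circ x) *\<^sub>R f x) \<longlonglongrightarrow> indicator Q x *\<^sub>R f x"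
        by (intro AE_I2 tendsto_scaleR tendsto_const lim) simp
      have "norm (h n (circ x) *\<^sub>R f x) \<le> norm (f x)" for n x
        by (auto simp: h_def mult_left_le_one_le infdist_nonneg intro!: mult_left_le_one_le)
      then show "AE x in torus. norm (h n (circ x) *\<^sub>R f x) \<le> norm (f x)" for n by simp
      show "(\<lambda>x. indicator Q x *\<^sub>R f x) \<in> borel_measurable torus"
        "(\<lambda>x. h n (circ x) *\<^sub>R f x) \<in> borel_measurable torus" for n
        using f(1) by measurable
    qed (use f(1) in auto)
    then have "(LINT x|torus. indicator Q x *\<^sub>R f x) = 0"
      by (simp add: continuous_integral_zero[OF f hcont] LIMSEQ_const_iff)
    then show ?thesis
      by (simp add: integral_torus set_lebesgue_integral_def g_def mult.commute)
  qed (simp add: set_lebesgue_integral_def)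
  have "AE x in lborel. g x = 0"
  proof (rule AE_zero_from_closed[OF g])
    fix A :: "(real^'d) set" assume A: "closed A"
    \<comment> \<open>Keeping away from the upper faces makes these sets compact inside the
      half-open cell; they increase to the part of \<open>A\<close> in the cell.\<close>
    define Q where "Q n = A \<inter> cbox 0 (\<chi> i. 2 * pi - 1 / real (Suc n))" for n
    have Q: "compact (Q n)" "Q n \<subseteq> cell" for n
    proof -
      have less: "2 * pi - 1 / real (Suc n) < 2 * pi" by simp
      show "Q n \<subseteq> cell"
      proof
        fix x assume "x \<in> Q n"
        then have b: "0 \<le> x $ i" "x $ i \<le> 2 * pi - 1 / real (Suc n)" for i
          by (auto simp: Q_def mem_box_cart simp del: of_nat_Suc)
        show "x \<in> cell" unfolding cell_def using b(1) le_less_trans[OF b(2) less] by blast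
      qed
    qed (use A in \<open>auto simp: Q_def closed_Int_compact\<close>)
    have [measurable]: "A \<in> sets borel" "Q n \<in> sets borel" for n
      using A Q(1) by (simp_all add: borel_compact)
    have "(\<lambda>n. LINT x|lborel. indicator (Q n) x *\<^sub>R g x) \<longlonglongrightarrow> (LINT x|lborel. indicator A x *\<^sub>R g x)"
    proof (rule integral_dominated_convergence[where w="\<lambda>x. norm (g x)"])
      have "(\<lambda>n. indicator (Q n) x *\<^sub>R g x) \<longlonglongrightarrow> indicator A x *\<^sub>R g x" for x
      proof (cases "x \<in> cell \<inter> A")
        case True
        have "\<forall>\<^sub>F n in sequentially. \<forall>i. x $ i \<le> 2 * pi - 1 / real (Suc n)"
        proof (subst eventually_all_finite, safe)
          fix i
          have "(\<lambda>n. 2 * pi - 1 / real (Suc n)) \<longlonglongrightarrow> 2 * pi - 0"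
            by (intro tendsto_intros) (use LIMSEQ_inverse_real_of_nat in \<open>simp add: inverse_eq_divide\<close>)
          moreover have "x $ i < 2 * pi - 0" using True by (simp add: cell_def)
          ultimately have "\<forall>\<^sub>F n in sequentially. x $ i < 2 * pi - 1 / real (Suc n)"
            by (rule order_tendstoD(1))
          then show "\<forall>\<^sub>F n in sequentially. x $ i \<le> 2 * pi - 1 / real (Suc n)"
            by eventually_elim simp
        qed
        then have "\<forall>\<^sub>F n in sequentially. indicator (Q n) x *\<^sub>R g x = indicator A x *\<^sub>R g x"
          by eventually_elim (use True in \<open>auto simp: Q_def mem_box_cart cell_def indicator_def\<close>)
        then show ?thesis by (rule tendsto_eventually)
      next
        case False
        then have "indicator (Q n) x *\<^sub>R g x = 0" "indicator A x *\<^sub>R g x = 0" for n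
          using Q(2)[of n] by (auto simp: g_def indicator_def Q_def)
        then show ?thesis by (simp only: tendsto_const)
      qed
      then show "AE x in lborel. (\<lambda>n. indicator (Q n) x *\<^sub>R g x) \<longlonglongrightarrow> indicator A x *\<^sub>R g x" by simp
      show "AE x in lborel. norm (indicator (Q n) x *\<^sub>R g x) \<le> norm (g x)" for n
        by (simp add: indicator_def)
    qed (use g in auto)
    then show "(LINT x:A|lborel. g x) = 0"
      using zeroQ[OF Q] by (simp add: set_lebesgue_integral_def LIMSEQ_const_iff)
  qed
  then show ?thesis unfolding AE_torus_iff by eventually_elim (auto simp: g_def)
qed

section \<open>Square-integrable functions on the torus\<close>

definition L2p :: "(real^'d::finite \<Rightarrow> complex) set" where
  "L2p = {f. periodic f \<and> f \<in> borel_measurable borel \<and> integrable torus (\<lambda>x. (cmod (f x))\<^sup>2)}"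

lemma
  assumes "f \<in> L2p"
  shows L2p_periodic: "periodic f" and L2p_borel: "f \<in> borel_measurable borel"
    and L2p_measurable: "f \<in> borel_measurable torus"
    and L2p_sq: "integrable torus (\<lambda>x. (cmod (f x))\<^sup>2)"
  using assms measurable_torus by (auto simp: L2p_def)

lemma L2p_mult_integrable:
  assumes "f \<in> L2p" "g \<in> L2p"
  shows "integrable torus (\<lambda>x. f x * g x)"
proof (rule Bochner_Integration.integrable_bound)
  show "integrable torus (\<lambda>x. (cmod (f x))\<^sup>2 + (cmod (g x))\<^sup>2)"
    using assms by (intro Bochner_Integration.integrable_add L2p_sq)
  show "(\<lambda>x. f x * g x) \<in> borel_measurable torus"
    using assms L2p_measurable by (intro borel_measurable_times)
  show "AE x in torus. norm (f x * g x) \<le> norm ((cmod (f x))\<^sup>2 + (cmod (g x))\<^sup>2)"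
    using cmod_mult_le_power2 by auto
qed

lemma bounded_mult_L2p:
  assumes f: "f \<in> L2p" and a: "periodic a" "a \<in> borel_measurable borel" "\<And>x. cmod (a x) \<le> M"
  shows "(\<lambda>x. a x * f x) \<in> L2p" and "(LINT x|torus. (cmod (a x * f x))\<^sup>2) \<le> M\<^sup>2 * (LINT x|torus. (cmod (f x))\<^sup>2)"
proof -
  have le: "(cmod (a x * f x))\<^sup>2 \<le> M\<^sup>2 * (cmod (f x))\<^sup>2" for x
    unfolding norm_mult power_mult_distrib using a(3) by (intro mult_right_mono power_mono) auto
  have m[measurable]: "(\<lambda>x. a x * f x) \<in> borel_measurable borel"
    using a(2) L2p_borel[OF f] by (intro borel_measurable_times)
  have int: "integrable torus (\<lambda>x. M\<^sup>2 * (cmod (f x))\<^sup>2)" using L2p_sq[OF f] by simp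
  have int2: "integrable torus (\<lambda>x. (cmod (a x * f x))\<^sup>2)"
    by (rule Bochner_Integration.integrable_bound[OF int]) (use le in auto)
  then show "(\<lambda>x. a x * f x) \<in> L2p"
    using m a(1) L2p_periodic[OF f] by (auto simp: L2p_def periodic_def)
  show "(LINT x|torus. (cmod (a x * f x))\<^sup>2) \<le> M\<^sup>2 * (LINT x|torus. (cmod (f x))\<^sup>2)"
    using integral_mono[OF int2 int le] by simp
qed

lemma continuous_L2p:
  assumes "periodic f" "continuous_on UNIV f"
  shows "f \<in> L2p"
proof -
  have "continuous_on UNIV (\<lambda>x. (cmod (f x))\<^sup>2)" by (intro continuous_intros assms)
  moreover have "periodic (\<lambda>x. (cmod (f x))\<^sup>2)" using assms(1) by (simp add: periodic_def)
  ultimately show ?thesis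
    using assms integrable_torus_continuous borel_measurable_continuous_onI by (auto simp: L2p_def)
qed

lemma ek_L2p: "ek k \<in> L2p"
  by (intro continuous_L2p periodic_ek continuous_ek)

lemma const_L2p: "(\<lambda>x. c) \<in> L2p"
  by (intro continuous_L2p) (auto simp: periodic_def)

lemma L2p_integrable: "f \<in> L2p \<Longrightarrow> integrable torus f"
  using L2p_mult_integrable[OF _ const_L2p[of 1]] by simp

lemma L2p_add:
  assumes f: "f \<in> L2p" and g: "g \<in> L2p"
  shows "(\<lambda>x. f x + g x) \<in> L2p"
proof -
  have [measurable]: "(\<lambda>x. f x + g x) \<in> borel_measurable borel"
    using f g L2p_borel by (intro borel_measurable_add)
  have "integrable torus (\<lambda>x. 2 * (cmod (f x))\<^sup>2 + 2 * (cmod (g x))\<^sup>2)"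
    using L2p_sq f g by (intro Bochner_Integration.integrable_add) auto
  then have "integrable torus (\<lambda>x. (cmod (f x + g x))\<^sup>2)"
    by (rule Bochner_Integration.integrable_bound) (use norm_add_power2_le[where 'a=complex] in auto)
  then show ?thesis using L2p_periodic[OF f] L2p_periodic[OF g] by (auto simp: L2p_def periodic_def)
qed

lemma L2p_cmult:
  assumes f: "f \<in> L2p"
  shows "(\<lambda>x. c * f x) \<in> L2p"
  by (rule bounded_mult_L2p(1)[OF f, of _ "cmod c"]) (auto simp: periodic_def)

lemma L2p_scaleR: "f \<in> L2p \<Longrightarrow> (\<lambda>x. r *\<^sub>R f x) \<in> L2p"
  using L2p_cmult[of f "of_real r"] by (simp add: scaleR_conv_of_real)

lemma L2p_diff: "f \<in> L2p \<Longrightarrow> g \<in> L2p \<Longrightarrow> (\<lambda>x. f x - g x) \<in> L2p"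
  using L2p_add[of f "\<lambda>x. - 1 * g x"] L2p_cmult[of g "- 1"] by simp

lemma L2p_sum: "(\<And>k. k \<in> A \<Longrightarrow> f k \<in> L2p) \<Longrightarrow> (\<lambda>x. \<Sum>k\<in>A. f k x) \<in> L2p"
  by (induction A rule: infinite_finite_induct) (auto intro: L2p_add const_L2p)

lemma L2p_cnj:
  assumes "f \<in> L2p" shows "(\<lambda>x. cnj (f x)) \<in> L2p"
proof -
  have "(\<lambda>x. cnj (f x)) \<in> borel_measurable borel"
    using measurable_compose[OF L2p_borel[OF assms] borel_measurable_continuous_onI[of cnj]]
    by (simp add: continuous_on_cnj)
  then show ?thesis using assms by (auto simp: L2p_def periodic_def)
qed

section \<open>Fourier coefficients: Bessel, Riesz-Fischer and Parseval\<close>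

definition fc :: "(real^'d::finite \<Rightarrow> complex) \<Rightarrow> int^'d \<Rightarrow> complex" where
  "fc f k = (LINT x|torus. f x * ek (- k) x) / of_real (vol TYPE('d))"

lemma integrable_mult_ek:
  assumes "integrable torus f"
  shows "integrable torus (\<lambda>x. f x * ek k x)"
proof -
  have [measurable]: "f \<in> borel_measurable torus" using assms by simp
  have "(\<lambda>x. f x * ek k x) \<in> borel_measurable torus" by measurable
  then show ?thesis by (intro Bochner_Integration.integrable_bound[OF assms]) (simp_all add: norm_mult)
qed

lemma fc_add: "integrable torus f \<Longrightarrow> integrable torus g \<Longrightarrow> fc (\<lambda>x. f x + g x) k = fc f k + fc g k"
  unfolding fc_def by (simp add: distrib_right integrable_mult_ek add_divide_distrib)

lemma fc_diff: "integrable torus f \<Longrightarrow> integrable torus g \<Longrightarrow> fc (\<lambda>x. f x - g x) k = fc f k - fc g k"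
  unfolding fc_def by (simp add: left_diff_distrib integrable_mult_ek diff_divide_distrib)

lemma fc_cmult: "fc (\<lambda>x. c * f x) k = c * fc f k"
  unfolding fc_def by (simp add: mult.assoc)

lemma fc_scaleR: "fc (\<lambda>x. r *\<^sub>R f x) k = of_real r * fc f k"
  using fc_cmult[of "of_real r" f k] by (simp add: scaleR_conv_of_real)

lemma fc_0: "fc (\<lambda>x. 0) k = 0"
  by (simp add: fc_def)

lemma fc_sum:
  assumes "\<And>j. j \<in> A \<Longrightarrow> integrable torus (f j)"
  shows "fc (\<lambda>x. \<Sum>j\<in>A. f j x) k = (\<Sum>j\<in>A. fc (f j) k)"
  using assms by (induction A rule: infinite_finite_induct) (auto simp: fc_0 fc_add)

lemma fc_ek: "fc (ek l) k = (if k = l then 1 else 0)"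
  using vol_pos[where 'd='a] by (auto simp: fc_def ek_add[symmetric] integral_ek)

lemma fc_cong_AE:
  assumes "f \<in> borel_measurable torus" "g \<in> borel_measurable torus" "AE x in torus. f x = g x"
  shows "fc f k = fc g k"
proof -
  have "(LINT x|torus. f x * ek (- k) x) = (LINT x|torus. g x * ek (- k) x)"
    using assms by (intro integral_cong_AE) auto
  then show ?thesis by (simp add: fc_def)
qed

lemma fc_inject:
  assumes "integrable torus f" "integrable torus g" "\<And>k. fc f k = fc g k"
  shows "AE x in torus. f x = g x"
proof -
  have "(LINT x|torus. (f x - g x) * ek k x) = 0" for k
  proof -
    have "fc (\<lambda>x. f x - g x) (- k) = 0" using assms by (simp add: fc_diff)
    then show ?thesis using vol_pos[where 'd='a] by (simp add: fc_def)
  qed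
  then have "AE x in torus. f x - g x = 0"
    using assms by (intro fourier_uniqueness) auto
  then show ?thesis by simp
qed

definition psum :: "(int^'d::finite) set \<Rightarrow> (int^'d \<Rightarrow> complex) \<Rightarrow> real^'d \<Rightarrow> complex" where
  "psum F c x = (\<Sum>k\<in>F. c k * ek k x)"

lemma psum_L2p: "psum F c \<in> L2p"
  unfolding psum_def[abs_def] by (intro L2p_sum L2p_cmult ek_L2p)

lemma fc_psum: "finite F \<Longrightarrow> fc (psum F c) k = (if k \<in> F then c k else 0)"
  unfolding psum_def[abs_def]
  by (subst fc_sum) (auto simp: fc_cmult fc_ek if_distrib[of "(*) _"] intro!: L2p_integrable L2p_cmult ek_L2p cong: if_cong)

lemma integral_mult_cnj_psum:
  fixes f :: "real^'d::finite \<Rightarrow> complex"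
  assumes f: "f \<in> L2p"
  shows "(LINT x|torus. f x * cnj (psum F c x)) = of_real (vol TYPE('d)) * (\<Sum>k\<in>F. fc f k * cnj (c k))"
proof -
  have "(LINT x|torus. f x * cnj (psum F c x)) = (LINT x|torus. (\<Sum>k\<in>F. cnj (c k) * (f x * ek (- k) x)))"
    by (simp add: psum_def sum_distrib_left cnj_ek mult_ac)
  also have "\<dots> = (\<Sum>k\<in>F. cnj (c k) * (LINT x|torus. f x * ek (- k) x))"
    using integrable_mult_ek[OF L2p_integrable[OF f]] by (subst Bochner_Integration.integral_sum) auto
  also have "\<dots> = of_real (vol TYPE('d)) * (\<Sum>k\<in>F. fc f k * cnj (c k))"
    using vol_pos[where 'd='d] by (simp add: fc_def sum_distrib_left mult_ac)
  finally show ?thesis .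
qed

text \<open>Pythagoras: in the expanded square, the cross term and the norm of the partial sum
  reduce to the same sum. Agreement of \<open>c\<close> with the coefficients is asked only on
  \<open>F\<close>, so a partial sum can be compared with itself.\<close>

lemma integral_diff_psum:
  fixes f :: "real^'d::finite \<Rightarrow> complex"
  assumes f: "f \<in> L2p" and "finite F" and c: "\<And>k. k \<in> F \<Longrightarrow> c k = fc f k"
  shows "(LINT x|torus. (cmod (f x - psum F c x))\<^sup>2)
    = (LINT x|torus. (cmod (f x))\<^sup>2) - vol TYPE('d) * (\<Sum>k\<in>F. (cmod (fc f k))\<^sup>2)"
proof -
  let ?v = "vol TYPE('d)"
  have s: "(\<Sum>k\<in>F. fc f k * cnj (c k)) = of_real (\<Sum>k\<in>F. (cmod (fc f k))\<^sup>2)"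
    unfolding of_real_sum by (intro sum.cong) (auto simp: c complex_norm_square[symmetric])
  have "(\<Sum>k\<in>F. fc (psum F c) k * cnj (c k)) = (\<Sum>k\<in>F. fc f k * cnj (c k))"
    using \<open>finite F\<close> by (intro sum.cong) (auto simp: fc_psum c)
  note p = integral_mult_cnj_psum[OF psum_L2p, of F c F c, unfolded this s]
  note fp = integral_mult_cnj_psum[OF f, of F c, unfolded s]
  have pw: "(cmod (f x - psum F c x))\<^sup>2 = (cmod (f x))\<^sup>2 - 2 * Re (f x * cnj (psum F c x)) + Re (psum F c x * cnj (psum F c x))" for x
    by (simp only: cmod_power2) (simp add: power2_eq_square algebra_simps)
  have i: "integrable torus (\<lambda>x. f x * cnj (psum F c x))" "integrable torus (\<lambda>x. psum F c x * cnj (psum F c x))"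
    by (intro L2p_mult_integrable f L2p_cnj psum_L2p)+
  have "(LINT x|torus. (cmod (f x - psum F c x))\<^sup>2) = (LINT x|torus. (cmod (f x))\<^sup>2)
      - 2 * Re (LINT x|torus. f x * cnj (psum F c x)) + Re (LINT x|torus. psum F c x * cnj (psum F c x))"
    unfolding pw
      Bochner_Integration.integral_add[OF Bochner_Integration.integrable_diff[OF L2p_sq[OF f] integrable_mult_right[OF integrable_Re[OF i(1)]]] integrable_Re[OF i(2)]]
      Bochner_Integration.integral_diff[OF L2p_sq[OF f] integrable_mult_right[OF integrable_Re[OF i(1)]]]
      integral_Re[OF i(1)] integral_Re[OF i(2)] Bochner_Integration.integral_mult_right_zero ..
  then show ?thesis unfolding p fp by simp
qed

lemma bessel:
  fixes f :: "real^'d::finite \<Rightarrow> complex"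
  assumes f: "f \<in> L2p" and "finite F"
  shows "vol TYPE('d) * (\<Sum>k\<in>F. (cmod (fc f k))\<^sup>2) \<le> (LINT x|torus. (cmod (f x))\<^sup>2)"
proof -
  have "0 \<le> (LINT x|torus. (cmod (f x - psum F (fc f) x))\<^sup>2)" by simp
  then show ?thesis using integral_diff_psum[OF assms, of "fc f"] by simp
qed

lemma square_summable_fc:
  fixes f :: "real^'d::finite \<Rightarrow> complex"
  assumes "f \<in> L2p"
  shows "square_summable (fc f)"
proof (rule square_summableI)
  show "(\<Sum>k\<in>F. (cmod (fc f k))\<^sup>2) \<le> (LINT x|torus. (cmod (f x))\<^sup>2) / vol TYPE('d)" if "finite F" for F
    using bessel[OF assms that] vol_pos[where 'd='d] by (simp add: field_simps)
qed

definition fhat :: "(real^'d::finite \<Rightarrow> complex) \<Rightarrow> (int^'d) l2" where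
  "fhat f = Abs_l2 (fc f)"

lemma cf_fhat: "f \<in> L2p \<Longrightarrow> cf (fhat f) k = fc f k"
  unfolding fhat_def using square_summable_fc by (subst Abs_l2_inverse) auto

lemma l2_tail:
  fixes u :: "'i l2"
  assumes "\<epsilon> > 0"
  shows "\<exists>F. finite F \<and> (\<forall>G. finite G \<longrightarrow> G \<inter> F = {} \<longrightarrow> (\<Sum>k\<in>G. (cmod (cf u k))\<^sup>2) \<le> \<epsilon>)"
proof -
  obtain F where F: "finite F" "dist (\<Sum>k\<in>F. (cmod (cf u k))\<^sup>2) ((norm u)\<^sup>2) \<le> \<epsilon>"
    using infsum_finite_approximation[OF summable_cf assms, of u] unfolding norm_l2_sq by blast
  have "(\<Sum>k\<in>G. (cmod (cf u k))\<^sup>2) \<le> \<epsilon>" if G: "finite G" "G \<inter> F = {}" for G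
  proof -
    have "(\<Sum>k\<in>G \<union> F. (cmod (cf u k))\<^sup>2) \<le> (norm u)\<^sup>2" using G F by (intro sum_cf_le) auto
    then show ?thesis using F G by (simp add: sum.union_disjoint dist_real_def)
  qed
  then show ?thesis using F(1) by blast
qed

text \<open>Partial sums with rapidly small tails have summable differences in L^1, hence converge
  almost everywhere. The approximation clause is kept in the conclusion because Parseval is derived
  from it.\<close>

theorem riesz_fischer:
  fixes u :: "(int^'d::finite) l2"
  shows "\<exists>f\<in>L2p. (\<forall>k. fc f k = cf u k) \<and>
    (\<forall>\<epsilon>>0. \<exists>F. finite F \<and> (LINT x|torus. (cmod (f x - psum F (cf u) x))\<^sup>2) \<le> \<epsilon>)"
proof -
  let ?v = "vol TYPE('d)"
  have "\<exists>F. \<forall>n. finite (F n) \<and> (\<forall>G. finite G \<longrightarrow> G \<inter> F n = {} \<longrightarrow> (\<Sum>k\<in>G. (cmod (cf u k))\<^sup>2) \<le> (1/4) ^ n)"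
    by (intro choice allI l2_tail) simp
  then obtain F0 where F0: "\<And>n. finite (F0 n)"
    "\<And>n G. finite G \<Longrightarrow> G \<inter> F0 n = {} \<Longrightarrow> (\<Sum>k\<in>G. (cmod (cf u k))\<^sup>2) \<le> (1/4) ^ n" by metis
  define F where "F n = (\<Union>m\<le>n. F0 m)" for n
  have fin: "finite (F n)" for n using F0(1) by (auto simp: F_def)
  have F_mono: "m \<le> n \<Longrightarrow> F m \<subseteq> F n" for m n by (force simp: F_def)
  have tail: "(\<Sum>k\<in>G. (cmod (cf u k))\<^sup>2) \<le> (1/4) ^ n" if "finite G" "G \<inter> F n = {}" for G n
    using that by (intro F0(2)) (auto simp: F_def)
  define s where "s n = psum (F n) (cf u)" for n
  have sL[simp]: "s n \<in> L2p" for n unfolding s_def by (rule psum_L2p)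
  have [measurable]: "s n \<in> borel_measurable borel" for n using L2p_borel[OF sL] .
  have sdiff: "s m x - s n x = psum (F m - F n) (cf u) x" if "n \<le> m" for m n x
    unfolding s_def psum_def using fin F_mono[OF that] by (simp add: sum_diff)
  have sq: "(LINT x|torus. (cmod (s m x - s n x))\<^sup>2) \<le> ?v * (1/4) ^ n" if "n \<le> m" for m n
  proof -
    let ?D = "F m - F n"
    \<comment> \<open>Pythagoras for the partial sum against itself: the left side is 0, which
      leaves its exact norm.\<close>
    have "(LINT x|torus. (cmod (psum ?D (cf u) x - psum ?D (cf u) x))\<^sup>2)
      = (LINT x|torus. (cmod (psum ?D (cf u) x))\<^sup>2) - ?v * (\<Sum>k\<in>?D. (cmod (fc (psum ?D (cf u)) k))\<^sup>2)"
      using fin by (intro integral_diff_psum psum_L2p) (auto simp: fc_psum)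
    then have "(LINT x|torus. (cmod (s m x - s n x))\<^sup>2) = ?v * (\<Sum>k\<in>?D. (cmod (cf u k))\<^sup>2)"
      using fin by (simp add: sdiff[OF that] fc_psum)
    also have "\<dots> \<le> ?v * (1/4) ^ n"
      using fin vol_pos[where 'd='d] by (intro mult_left_mono tail) (auto simp: less_imp_le)
    finally show ?thesis .
  qed
  text \<open>The weights \<open>2^n\<close> turn the quadratic decay into a summable bound in \<open>L\<^sup>1\<close>.\<close>
  have L1: "(LINT x|torus. cmod (s m x - s n x)) \<le> ?v * (1/2) ^ n" if "n \<le> m" for m n
  proof -
    have D: "(\<lambda>x. s m x - s n x) \<in> L2p" by (intro L2p_diff sL)
    have pw: "cmod a \<le> (1/2) ^ n / 2 + 2 ^ n / 2 * (cmod a)\<^sup>2" for a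
    proof -
      have "0 \<le> (2 ^ n * cmod a - 1)\<^sup>2" by simp
      then have "2 * 2 ^ n * cmod a \<le> 1 + 2 ^ n * 2 ^ n * (cmod a)\<^sup>2"
        by (simp add: power2_eq_square algebra_simps)
      then show ?thesis by (simp add: field_simps power_divide)
    qed
    have "(LINT x|torus. cmod (s m x - s n x)) \<le> (LINT x|torus. (1/2) ^ n / 2 + 2 ^ n / 2 * (cmod (s m x - s n x))\<^sup>2)"
      using L2p_integrable[OF D] L2p_sq[OF D] pw by (intro integral_mono) auto
    also have "\<dots> = ?v * ((1/2) ^ n / 2) + 2 ^ n / 2 * (LINT x|torus. (cmod (s m x - s n x))\<^sup>2)"
      using L2p_sq[OF D] by (subst Bochner_Integration.integral_add) (auto simp: vol_def)
    also have "\<dots> \<le> ?v * ((1/2) ^ n / 2) + 2 ^ n / 2 * (?v * (1/4) ^ n)"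
      using sq[OF that] by (intro add_left_mono mult_left_mono) auto
    also have "\<dots> = ?v * (1/2) ^ n"
    proof -
      have "(2::real) ^ n * (1/4) ^ n = (1/2) ^ n" by (simp flip: power_mult_distrib)
      then show ?thesis by (simp add: algebra_simps)
    qed
    finally show ?thesis .
  qed
  define d where "d n x = cmod (s (Suc n) x - s n x)" for n x
  have [measurable]: "d n \<in> borel_measurable borel" for n unfolding d_def by measurable
  have "(\<integral>\<^sup>+x. (\<Sum>n. ennreal (d n x)) \<partial>torus) = (\<Sum>n. \<integral>\<^sup>+x. ennreal (d n x) \<partial>torus)"
    by (rule nn_integral_suminf) measurable
  also have "\<dots> \<le> (\<Sum>n. ennreal (?v * (1/2) ^ n))"
  proof (intro suminf_le)
    fix n
    have "(\<integral>\<^sup>+x. ennreal (d n x) \<partial>torus) = ennreal (LINT x|torus. d n x)"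
      unfolding d_def by (intro nn_integral_eq_integral integrable_norm L2p_integrable L2p_diff sL) auto
    then show "(\<integral>\<^sup>+x. ennreal (d n x) \<partial>torus) \<le> ennreal (?v * (1/2) ^ n)"
      using L1[of n "Suc n"] by (auto simp: d_def intro: ennreal_leI)
  qed auto
  also have "\<dots> = ennreal (\<Sum>n. ?v * (1/2) ^ n)"
    using vol_pos[where 'd='d] by (intro suminf_ennreal2 summable_mult summable_geometric) (auto simp: less_imp_le)
  also have "\<dots> < \<infinity>" by simp
  finally have "AE x in torus. (\<Sum>n. ennreal (d n x)) \<noteq> \<infinity>"
    by (intro nn_integral_PInf_AE) auto
  then have conv: "AE x in torus. convergent (\<lambda>n. s n x)"
  proof eventually_elim
    case (elim x)
    then have "summable (\<lambda>n. d n x)"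
      by (intro summable_suminf_not_top) (auto simp: d_def)
    then have "summable (\<lambda>n. s (Suc n) x - s n x)"
      unfolding d_def by (rule summable_norm_cancel)
    then have "convergent (\<lambda>n. \<Sum>i<n. s (Suc i) x - s i x)" by (simp add: summable_iff_convergent)
    then have "convergent (\<lambda>n. s n x - s 0 x)" by (simp add: sum_lessThan_telescope[of "\<lambda>n. s n x"])
    then obtain L where "(\<lambda>n. s n x - s 0 x) \<longlonglongrightarrow> L" by (auto simp: convergent_def)
    from tendsto_add[OF this tendsto_const[of "s 0 x"]]
    have "(\<lambda>n. s n x) \<longlonglongrightarrow> L + s 0 x" by simp
    then show ?case by (auto simp: convergent_def)
  qed
  \<comment> \<open>\<open>lim\<close> is defined even where the sequence diverges; this makes
    \<open>f\<close> Borel and periodic at every point, as \<open>L2p\<close> requires.\<close>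
  define f where "f x = lim (\<lambda>n. s n x)" for x
  have fm[measurable]: "f \<in> borel_measurable borel"
    unfolding f_def by measurable
  have fper: "periodic f"
    using L2p_periodic[OF sL] by (simp add: f_def periodic_def)
  \<comment> \<open>Fatou carries the L^2 estimate between \<open>s m\<close> and \<open>s n\<close>
    over to the limit in \<open>m\<close>.\<close>
  have fatou: "(\<integral>\<^sup>+x. ennreal ((cmod (f x - s n x))\<^sup>2) \<partial>torus) \<le> ennreal (?v * (1/4) ^ n)" for n
  proof -
    have "AE x in torus. ennreal ((cmod (f x - s n x))\<^sup>2) = liminf (\<lambda>m. ennreal ((cmod (s m x - s n x))\<^sup>2))"
      using conv
    proof eventually_elim
      case (elim x)
      then have "(\<lambda>m. s m x) \<longlonglongrightarrow> f x" by (simp add: f_def convergent_LIMSEQ_iff)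
      then have "(\<lambda>m. ennreal ((cmod (s m x - s n x))\<^sup>2)) \<longlonglongrightarrow> ennreal ((cmod (f x - s n x))\<^sup>2)"
        by (intro tendsto_ennrealI tendsto_intros)
      then show ?case by (rule lim_imp_Liminf[OF trivial_limit_sequentially, symmetric])
    qed
    then have "(\<integral>\<^sup>+x. ennreal ((cmod (f x - s n x))\<^sup>2) \<partial>torus) = (\<integral>\<^sup>+x. liminf (\<lambda>m. ennreal ((cmod (s m x - s n x))\<^sup>2)) \<partial>torus)"
      by (rule nn_integral_cong_AE)
    also have "\<dots> \<le> liminf (\<lambda>m. \<integral>\<^sup>+x. ennreal ((cmod (s m x - s n x))\<^sup>2) \<partial>torus)"
      by (rule nn_integral_liminf) measurable
    also have "\<dots> \<le> liminf (\<lambda>m. ennreal (?v * (1/4) ^ n))"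
    proof (rule Liminf_mono, rule eventually_sequentiallyI)
      fix m assume "n \<le> m"
      have "(\<integral>\<^sup>+x. ennreal ((cmod (s m x - s n x))\<^sup>2) \<partial>torus) = ennreal (LINT x|torus. (cmod (s m x - s n x))\<^sup>2)"
        by (intro nn_integral_eq_integral L2p_sq L2p_diff sL) auto
      then show "(\<integral>\<^sup>+x. ennreal ((cmod (s m x - s n x))\<^sup>2) \<partial>torus) \<le> ennreal (?v * (1/4) ^ n)"
        using sq[OF \<open>n \<le> m\<close>] by (auto intro: ennreal_leI)
    qed
    also have "\<dots> = ennreal (?v * (1/4) ^ n)" by (simp add: Liminf_const)
    finally show ?thesis .
  qed
  have fs: "(\<lambda>x. f x - s n x) \<in> L2p" for n
  proof -
    have "(\<integral>\<^sup>+x. ennreal ((cmod (f x - s n x))\<^sup>2) \<partial>torus) < \<infinity>"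
      by (rule le_less_trans[OF fatou]) simp
    then have "integrable torus (\<lambda>x. (cmod (f x - s n x))\<^sup>2)"
      by (intro integrableI_nonneg) auto
    then show ?thesis using fper L2p_periodic[OF sL] by (auto simp: L2p_def periodic_def)
  qed
  have fL: "f \<in> L2p" using L2p_add[OF fs[of 0] sL[of 0]] by simp
  have sqf: "(LINT x|torus. (cmod (f x - s n x))\<^sup>2) \<le> ?v * (1/4) ^ n" for n
  proof -
    have "ennreal (LINT x|torus. (cmod (f x - s n x))\<^sup>2) \<le> ennreal (?v * (1/4) ^ n)"
      using fatou[of n] nn_integral_eq_integral[OF L2p_sq[OF fs[of n]]] by simp
    then show ?thesis using vol_pos[where 'd='d] by (simp add: ennreal_le_iff)
  qed
  have "fc f k = cf u k" for k
  proof -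
    \<comment> \<open>Compare through \<open>s n\<close>: Bessel bounds the coefficient of
      \<open>f - s n\<close>, and the tail bound covers a \<open>k\<close> that is not yet in
      \<open>F n\<close>.\<close>
    have "cmod (fc f k - cf u k) \<le> 2 * (1/2) ^ n" for n
    proof -
      have half: "(1/4) ^ n = ((1/2::real) ^ n)\<^sup>2"
        by (simp add: power2_eq_square flip: power_mult_distrib)
      have "?v * (cmod (fc (\<lambda>x. f x - s n x) k))\<^sup>2 \<le> ?v * (1/4) ^ n"
        using order_trans[OF bessel[OF fs[of n], of "{k}"] sqf[of n]] by simp
      then have "(cmod (fc (\<lambda>x. f x - s n x) k))\<^sup>2 \<le> ((1/2) ^ n)\<^sup>2"
        using vol_pos[where 'd='d] by (simp add: half)
      then have "cmod (fc (\<lambda>x. f x - s n x) k) \<le> (1/2) ^ n" by (rule power2_le_imp_le) simp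
      moreover have "(cmod (fc (s n) k - cf u k))\<^sup>2 \<le> ((1/2) ^ n)\<^sup>2"
        unfolding half[symmetric] using tail[of "{k}" n] fin by (auto simp: s_def fc_psum)
      then have "cmod (fc (s n) k - cf u k) \<le> (1/2) ^ n" by (rule power2_le_imp_le) simp
      moreover have "fc (\<lambda>x. f x - s n x) k = fc f k - fc (s n) k"
        using L2p_integrable[OF fL] L2p_integrable[OF sL] by (simp add: fc_diff)
      ultimately show ?thesis
        using norm_triangle_ineq[of "fc f k - fc (s n) k" "fc (s n) k - cf u k"] by simp
    qed
    moreover have "(\<lambda>n. 2 * (1/2::real) ^ n) \<longlonglongrightarrow> 0"
      by (intro tendsto_mult_right_zero LIMSEQ_power_zero) simp
    ultimately have "cmod (fc f k - cf u k) \<le> 0"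
      by (intro LIMSEQ_le_const[of "\<lambda>n. 2 * (1/2::real) ^ n"]) auto
    then show ?thesis by simp
  qed
  moreover have "\<exists>F. finite F \<and> (LINT x|torus. (cmod (f x - psum F (cf u) x))\<^sup>2) \<le> \<epsilon>" if "\<epsilon> > 0" for \<epsilon>
  proof -
    have "\<epsilon> / ?v > 0" using \<open>\<epsilon> > 0\<close> vol_pos[where 'd='d] by simp
    then obtain n where "(1/4) ^ n < \<epsilon> / ?v"
      using real_arch_pow_inv[of "\<epsilon> / ?v" "1/4"] by auto
    then have "?v * (1/4) ^ n \<le> \<epsilon>" using vol_pos[where 'd='d] by (simp add: field_simps)
    then show ?thesis using sqf[of n] fin[of n] unfolding s_def by (intro exI[of _ "F n"]) auto
  qed
  ultimately show ?thesis using fL by blast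
qed

text \<open>Riesz-Fischer applied to the coefficients of \<open>f\<close> returns \<open>f\<close>
  up to a null set, by uniqueness. The partial sums that come with it give one inequality and Bessel
  gives the other.\<close>

theorem parseval_norm:
  fixes f :: "real^'d::finite \<Rightarrow> complex"
  assumes f: "f \<in> L2p"
  shows "(LINT x|torus. (cmod (f x))\<^sup>2) = vol TYPE('d) * (norm (fhat f))\<^sup>2"
proof -
  let ?v = "vol TYPE('d)"
  obtain g where g: "g \<in> L2p" "\<And>k. fc g k = cf (fhat f) k"
    "\<forall>\<epsilon>>0. \<exists>F. finite F \<and> (LINT x|torus. (cmod (g x - psum F (cf (fhat f)) x))\<^sup>2) \<le> \<epsilon>"
    using riesz_fischer[of "fhat f"] by blast
  have fg: "AE x in torus. f x = g x"
    using f g by (intro fc_inject L2p_integrable) (auto simp: cf_fhat)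
  have eq: "(LINT x|torus. (cmod (f x))\<^sup>2) = (LINT x|torus. (cmod (g x))\<^sup>2)"
    using L2p_sq[OF f] L2p_sq[OF g(1)] fg by (intro integral_cong_AE) auto
  have "(LINT x|torus. (cmod (g x))\<^sup>2) \<le> ?v * (norm (fhat f))\<^sup>2 + \<epsilon>" if "\<epsilon> > 0" for \<epsilon>
  proof -
    obtain F where F: "finite F" "(LINT x|torus. (cmod (g x - psum F (cf (fhat f)) x))\<^sup>2) \<le> \<epsilon>"
      using g(3) \<open>\<epsilon> > 0\<close> by blast
    have "?v * (\<Sum>k\<in>F. (cmod (fc g k))\<^sup>2) \<le> ?v * (norm (fhat f))\<^sup>2"
      unfolding g(2) using vol_pos[where 'd='d] by (intro mult_left_mono sum_cf_le F) auto
    then show ?thesis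
      using integral_diff_psum[OF g(1) F(1), of "cf (fhat f)"] F(2) g(2) by simp
  qed
  then have "(LINT x|torus. (cmod (g x))\<^sup>2) \<le> ?v * (norm (fhat f))\<^sup>2" by (rule field_le_epsilon)
  moreover have "norm (fhat f) \<le> sqrt ((LINT x|torus. (cmod (f x))\<^sup>2) / ?v)"
  proof (rule norm_l2_leI)
    show "(\<Sum>k\<in>G. (cmod (cf (fhat f) k))\<^sup>2) \<le> (sqrt ((LINT x|torus. (cmod (f x))\<^sup>2) / ?v))\<^sup>2" if "finite G" for G
      using bessel[OF f that] vol_pos[where 'd='d] by (simp add: cf_fhat[OF f] field_simps)
  qed (use vol_pos[where 'd='d] in auto)
  then have "(norm (fhat f))\<^sup>2 \<le> (LINT x|torus. (cmod (f x))\<^sup>2) / ?v"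
    using vol_pos[where 'd='d] by (simp add: real_le_rsqrt real_sqrt_ge_zero sqrt_ge_absD)
  then have "?v * (norm (fhat f))\<^sup>2 \<le> (LINT x|torus. (cmod (f x))\<^sup>2)"
    using vol_pos[where 'd='d] by (simp add: field_simps)
  ultimately show ?thesis using eq by simp
qed

lemma
  assumes "f \<in> L2p" "g \<in> L2p"
  shows fhat_add: "fhat (\<lambda>x. f x + g x) = fhat f + fhat g"
    and fhat_diff: "fhat (\<lambda>x. f x - g x) = fhat f - fhat g"
  using assms by (auto intro!: l2_eqI simp: cf_fhat L2p_add L2p_diff fc_add fc_diff L2p_integrable)

lemma fhat_cmult: "f \<in> L2p \<Longrightarrow> fhat (\<lambda>x. c * f x) = cscale c (fhat f)"
  by (auto intro!: l2_eqI simp: cf_fhat L2p_cmult fc_cmult)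

text \<open>Polarization; only the real part appears because \<open>inner\<close> on
  \<open>l2\<close> is real.\<close>

theorem parseval:
  fixes f g :: "real^'d::finite \<Rightarrow> complex"
  assumes f: "f \<in> L2p" and g: "g \<in> L2p"
  shows "Re (LINT x|torus. f x * cnj (g x)) = vol TYPE('d) * inner (fhat f) (fhat g)"
proof -
  have pw: "4 * Re (a * cnj b) = (cmod (a + b))\<^sup>2 - (cmod (a - b))\<^sup>2" for a b
    by (simp only: cmod_power2) (simp add: power2_eq_square algebra_simps)
  have i: "integrable torus (\<lambda>x. f x * cnj (g x))" by (intro L2p_mult_integrable L2p_cnj f g)
  have "4 * Re (LINT x|torus. f x * cnj (g x)) = (LINT x|torus. 4 * Re (f x * cnj (g x)))"
    unfolding Bochner_Integration.integral_mult_right_zero integral_Re[OF i] ..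
  also have "\<dots> = (LINT x|torus. (cmod (f x + g x))\<^sup>2) - (LINT x|torus. (cmod (f x - g x))\<^sup>2)"
    unfolding pw by (intro Bochner_Integration.integral_diff L2p_sq L2p_add L2p_diff f g)
  also have "\<dots> = vol TYPE('d) * ((norm (fhat f + fhat g))\<^sup>2 - (norm (fhat f - fhat g))\<^sup>2)"
    using f g by (simp add: parseval_norm L2p_add L2p_diff fhat_add fhat_diff right_diff_distrib)
  also have "(norm (fhat f + fhat g))\<^sup>2 - (norm (fhat f - fhat g))\<^sup>2 = 4 * inner (fhat f) (fhat g)"
    by (simp add: power2_norm_eq_inner inner_add inner_diff inner_commute algebra_simps)
  finally show ?thesis by simp
qed

section \<open>Weak derivatives and convolutions\<close>

lemma C1dir_mult:
  fixes f g :: "real^'d::finite \<Rightarrow> 'a::real_normed_algebra"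
  assumes f: "C1dir i f" and g: "C1dir i g"
  shows "C1dir i (\<lambda>x. f x * g x)" and "pdiff i (\<lambda>x. f x * g x) = (\<lambda>x. f x * pdiff i g x + pdiff i f x * g x)"
proof -
  have der: "((\<lambda>t. f (shift i t x) * g (shift i t x)) has_vector_derivative f x * pdiff i g x + pdiff i f x * g x) (at 0)" for x
    using has_vector_derivative_mult[OF C1dir_deriv0[OF f, of x] C1dir_deriv0[OF g, of x]] by simp
  have cont: "continuous_on UNIV (\<lambda>x. f x * pdiff i g x + pdiff i f x * g x)" "continuous_on UNIV (\<lambda>x. f x * g x)"
    by (intro continuous_intros C1dir_cont[OF f] C1dir_cont_pdiff[OF f] C1dir_cont[OF g] C1dir_cont_pdiff[OF g])+
  have per: "periodic (\<lambda>x. f x * g x)"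
    using C1dir_periodic[OF f] C1dir_periodic[OF g] by (simp add: periodic_def)
  show "C1dir i (\<lambda>x. f x * g x)" "pdiff i (\<lambda>x. f x * g x) = (\<lambda>x. f x * pdiff i g x + pdiff i f x * g x)"
    by (rule C1dirI[OF per cont(2,1) der])+
qed

lemma C1dir_bounded_linear:
  fixes f :: "real^'d::finite \<Rightarrow> 'a::real_normed_vector"
  assumes L: "bounded_linear L" and f: "C1dir i f"
  shows "C1dir i (\<lambda>x. L (f x))" and "pdiff i (\<lambda>x. L (f x)) = (\<lambda>x. L (pdiff i f x))"
proof -
  have der: "((\<lambda>t. L (f (shift i t x))) has_vector_derivative L (pdiff i f x)) (at 0)" for x
    using bounded_linear.has_vector_derivative[OF L C1dir_deriv0[OF f]] .
  have cont: "continuous_on UNIV (\<lambda>x. L (pdiff i f x))" "continuous_on UNIV (\<lambda>x. L (f x))"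
    by (intro bounded_linear.continuous_on[OF L] C1dir_cont[OF f] C1dir_cont_pdiff[OF f])+
  have per: "periodic (\<lambda>x. L (f x))"
    using C1dir_periodic[OF f] by (simp add: periodic_def)
  show "C1dir i (\<lambda>x. L (f x))" "pdiff i (\<lambda>x. L (f x)) = (\<lambda>x. L (pdiff i f x))"
    by (rule C1dirI[OF per cont(2,1) der])+
qed

lemma C1dir_add:
  assumes f: "C1dir i f" and g: "C1dir i g"
  shows "C1dir i (\<lambda>x. f x + g x)" and "pdiff i (\<lambda>x. f x + g x) = (\<lambda>x. pdiff i f x + pdiff i g x)"
proof -
  have der: "((\<lambda>t. f (shift i t x) + g (shift i t x)) has_vector_derivative pdiff i f x + pdiff i g x) (at 0)" for x
    by (intro has_vector_derivative_add C1dir_deriv0 f g)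
  have cont: "continuous_on UNIV (\<lambda>x. pdiff i f x + pdiff i g x)" "continuous_on UNIV (\<lambda>x. f x + g x)"
    by (intro continuous_intros C1dir_cont[OF f] C1dir_cont_pdiff[OF f] C1dir_cont[OF g] C1dir_cont_pdiff[OF g])+
  have per: "periodic (\<lambda>x. f x + g x)"
    using C1dir_periodic[OF f] C1dir_periodic[OF g] by (simp add: periodic_def)
  show "C1dir i (\<lambda>x. f x + g x)" "pdiff i (\<lambda>x. f x + g x) = (\<lambda>x. pdiff i f x + pdiff i g x)"
    by (rule C1dirI[OF per cont(2,1) der])+
qed

lemma C1dir_L2p: "C1dir i \<psi> \<Longrightarrow> \<psi> \<in> L2p" "C1dir i \<psi> \<Longrightarrow> pdiff i \<psi> \<in> L2p"
  by (intro continuous_L2p C1dir_periodic C1dir_cont C1dir_periodic_pdiff C1dir_cont_pdiff; assumption)+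

text \<open>The derivative of \<psi> times the character of \<open>- k\<close> has integral
  zero.\<close>

lemma fc_pdiff:
  assumes \<psi>: "C1dir i \<psi>"
  shows "fc (pdiff i \<psi>) k = \<i> * of_int (k $ i) * fc \<psi> k"
proof -
  have "0 = (LINT x|torus. \<psi> x * (\<i> * of_int ((- k) $ i) * ek (- k) x) + pdiff i \<psi> x * ek (- k) x)"
    using integral_pdiff_zero[OF C1dir_mult(1)[OF \<psi> C1dir_ek[where k="- k"]]]
    by (simp add: C1dir_mult(2)[OF \<psi> C1dir_ek] pdiff_ek)
  also have "\<dots> = (LINT x|torus. pdiff i \<psi> x * ek (- k) x - (\<i> * of_int (k $ i)) * (\<psi> x * ek (- k) x))"
    by (simp add: algebra_simps)
  also have "\<dots> = (LINT x|torus. pdiff i \<psi> x * ek (- k) x) - (\<i> * of_int (k $ i)) * (LINT x|torus. \<psi> x * ek (- k) x)"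
    by (simp only: Bochner_Integration.integral_diff[OF integrable_mult_ek[OF L2p_integrable[OF C1dir_L2p(2)[OF \<psi>]]]
            integrable_mult_right[OF integrable_mult_ek[OF L2p_integrable[OF C1dir_L2p(1)[OF \<psi>]]]]] integral_mult_right_zero)
  finally show ?thesis by (simp add: fc_def)
qed

text \<open>Moves a Fourier multiplier from one factor to the other. The real parts agree by
  \<open>parseval\<close>; multiplying \<open>P\<close> and \<open>Q\<close> by \<i> gives the
  imaginary parts.\<close>

lemma parseval_swap:
  assumes L: "f \<in> L2p" "g \<in> L2p" "P \<in> L2p" "Q \<in> L2p"
    and eq: "\<And>k. fc g k * cnj (fc P k) = fc f k * cnj (fc Q k)"
  shows "(LINT x|torus. g x * cnj (P x)) = (LINT x|torus. f x * cnj (Q x))"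
proof -
  have re: "Re (LINT x|torus. g x * cnj (P x)) = Re (LINT x|torus. f x * cnj (Q x))"
    if "P \<in> L2p" "Q \<in> L2p" "\<And>k. fc g k * cnj (fc P k) = fc f k * cnj (fc Q k)" for P Q
    using L(1,2) that by (simp add: parseval inner_l2_def cf_fhat del: times_complex.sel)
  have "Re (LINT x|torus. g x * cnj (\<i> * P x)) = Re (LINT x|torus. f x * cnj (\<i> * Q x))"
    by (rule re) (use L eq in \<open>auto intro: L2p_cmult simp: fc_cmult mult.left_commute\<close>)
  moreover have "(LINT x|torus. h x * cnj (\<i> * R x)) = - \<i> * (LINT x|torus. h x * cnj (R x))" for h R :: "real^'a \<Rightarrow> complex"
    by (simp flip: integral_mult_right_zero add: mult.left_commute)
  ultimately have "Im (LINT x|torus. g x * cnj (P x)) = Im (LINT x|torus. f x * cnj (Q x))" by simp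
  with re[OF L(3,4) eq] show ?thesis by (simp add: complex_eq_iff)
qed

text \<open>The weak derivative within \<open>L\<^sup>2\<close>, read off from Fourier coefficients.\<close>

definition wd :: "'d::finite \<Rightarrow> (real^'d \<Rightarrow> complex) \<Rightarrow> (real^'d \<Rightarrow> complex) \<Rightarrow> bool" where
  "wd i f g \<longleftrightarrow> f \<in> L2p \<and> g \<in> L2p \<and> (\<forall>k. fc g k = \<i> * of_int (k $ i) * fc f k)"

lemma wd_integral_by_parts:
  assumes \<psi>: "C1dir i \<psi>" and y: "wd i y g"
  shows "(LINT x|torus. g x * \<psi> x) = - (LINT x|torus. y x * pdiff i \<psi> x)"
proof -
  note c = C1dir_bounded_linear[OF bounded_linear_cnj \<psi>]
  have "(LINT x|torus. g x * cnj (cnj (\<psi> x))) = (LINT x|torus. y x * cnj ((- 1) * cnj (pdiff i \<psi> x)))"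
  proof (rule parseval_swap)
    show "fc g k * cnj (fc (\<lambda>x. cnj (\<psi> x)) k) = fc y k * cnj (fc (\<lambda>x. (- 1) * cnj (pdiff i \<psi> x)) k)" for k
      using y fc_pdiff[OF c(1), of k] unfolding c(2) fc_cmult by (simp add: wd_def)
    show "(\<lambda>x. (- 1) * cnj (pdiff i \<psi> x)) \<in> L2p" by (intro L2p_cmult L2p_cnj C1dir_L2p[OF \<psi>])
  qed (use y C1dir_L2p[OF \<psi>] in \<open>auto simp: wd_def intro: L2p_cnj\<close>)
  then show ?thesis by simp
qed

lemma wd_C1dir: "C1dir i \<psi> \<Longrightarrow> wd i \<psi> (pdiff i \<psi>)"
  unfolding wd_def using C1dir_L2p fc_pdiff by blast

lemma wd_add: "wd i f g \<Longrightarrow> wd i f' g' \<Longrightarrow> wd i (\<lambda>x. f x + f' x) (\<lambda>x. g x + g' x)"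
  unfolding wd_def by (auto intro: L2p_add simp: fc_add L2p_integrable algebra_simps)

lemma wd_scaleR: "wd i f g \<Longrightarrow> wd i (\<lambda>x. r *\<^sub>R f x) (\<lambda>x. r *\<^sub>R g x)"
  unfolding wd_def by (auto intro: L2p_scaleR simp: fc_scaleR)

lemma real_mult_L2p:
  fixes a :: "real^'d::finite \<Rightarrow> real"
  assumes "periodic a" "continuous_on UNIV a" "f \<in> L2p"
  shows "(\<lambda>x. a x *\<^sub>R f x) \<in> L2p"
proof -
  obtain M where "M > 0" "\<And>x. norm (a x) \<le> M" using continuous_periodic_bounded[OF assms(1,2)] by blast
  then have "(\<lambda>x. complex_of_real (a x) * f x) \<in> L2p"
    using assms by (intro bounded_mult_L2p(1)[of _ _ M] borel_measurable_continuous_onI continuous_on_of_real)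
      (auto simp: periodic_def)
  then show ?thesis by (simp add: scaleR_conv_of_real)
qed

text \<open>Integration by parts against \<open>a\<close> times a character produces the Leibniz
  rule on coefficients.\<close>

lemma wd_mult:
  fixes a :: "real^'d::finite \<Rightarrow> real"
  assumes a: "C1dir i a" and y: "wd i y g"
  shows "wd i (\<lambda>x. a x *\<^sub>R y x) (\<lambda>x. pdiff i a x *\<^sub>R y x + a x *\<^sub>R g x)"
proof -
  have L: "y \<in> L2p" "g \<in> L2p" using y by (auto simp: wd_def)
  have aL: "(\<lambda>x. a x *\<^sub>R y x) \<in> L2p" "(\<lambda>x. pdiff i a x *\<^sub>R y x) \<in> L2p" "(\<lambda>x. a x *\<^sub>R g x) \<in> L2p"
    using L by (auto intro!: real_mult_L2p C1dir_periodic[OF a] C1dir_cont[OF a] C1dir_periodic_pdiff[OF a] C1dir_cont_pdiff[OF a])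
  have "fc (\<lambda>x. pdiff i a x *\<^sub>R y x + a x *\<^sub>R g x) k = \<i> * of_int (k $ i) * fc (\<lambda>x. a x *\<^sub>R y x) k" for k
  proof -
    note a' = C1dir_bounded_linear[OF bounded_linear_of_real a]
    \<comment> \<open>This product is only known to be once differentiable in direction
      \<open>i\<close>, so it is not a test function for \<open>weak_deriv\<close>;
      \<open>wd_integral_by_parts\<close> admits it.\<close>
    define \<psi> where "\<psi> x = complex_of_real (a x) * ek (- k) x" for x
    have \<psi>: "C1dir i \<psi>" unfolding \<psi>_def by (intro C1dir_mult(1) a'(1) C1dir_ek)
    have \<psi>': "pdiff i \<psi> x = of_real (pdiff i a x) * ek (- k) x - \<i> * of_int (k $ i) * \<psi> x" for x
      unfolding \<psi>_def C1dir_mult(2)[OF a'(1) C1dir_ek] a'(2) pdiff_ek by (simp add: algebra_simps)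
    have "(LINT x|torus. (a x *\<^sub>R g x) * ek (- k) x) = - (LINT x|torus. y x * pdiff i \<psi> x)"
      using wd_integral_by_parts[OF \<psi> y] by (simp add: \<psi>_def scaleR_conv_of_real mult_ac)
    also have "(LINT x|torus. y x * pdiff i \<psi> x) = (LINT x|torus. (pdiff i a x *\<^sub>R y x) * ek (- k) x
        - \<i> * of_int (k $ i) * ((a x *\<^sub>R y x) * ek (- k) x))"
      unfolding \<psi>' by (simp add: \<psi>_def scaleR_conv_of_real algebra_simps)
    also have "\<dots> = (LINT x|torus. (pdiff i a x *\<^sub>R y x) * ek (- k) x) - \<i> * of_int (k $ i) * (LINT x|torus. (a x *\<^sub>R y x) * ek (- k) x)"
      by (simp only: Bochner_Integration.integral_diff[OF integrable_mult_ek[OF L2p_integrable[OF aL(2)]]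
            integrable_mult_right[OF integrable_mult_ek[OF L2p_integrable[OF aL(1)]]]] integral_mult_right_zero)
    finally have "fc (\<lambda>x. a x *\<^sub>R g x) k = - fc (\<lambda>x. pdiff i a x *\<^sub>R y x) k + \<i> * of_int (k $ i) * fc (\<lambda>x. a x *\<^sub>R y x) k"
      by (simp add: fc_def diff_divide_distrib)
    then show ?thesis using aL by (simp add: fc_add L2p_integrable)
  qed
  then show ?thesis using aL L2p_add unfolding wd_def by blast
qed

text \<open>The Fourier symbol of the iterated partial derivative along \<alpha>.\<close>

definition dsymbol :: "'d::finite list \<Rightarrow> int^'d \<Rightarrow> complex" where
  "dsymbol \<alpha> k = prod_list (map (\<lambda>i. \<i> * of_int (k $ i)) \<alpha>)"

lemma dsymbol_simps [simp]: "dsymbol [] k = 1" "dsymbol (i # \<alpha>) k = \<i> * of_int (k $ i) * dsymbol \<alpha> k"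
  by (simp_all add: dsymbol_def)

lemma dsymbol_minus: "dsymbol \<alpha> (- k) = (- 1) ^ length \<alpha> * dsymbol \<alpha> k"
  by (induction \<alpha>) auto

text \<open>Test functions in \<open>weak_deriv\<close> are real-valued, so characters enter through
  real parts; the complex factor \<open>c\<close> covers cosine and sine at once.\<close>

lemma pdiff_Re_ek:
  shows "C1dir i (\<lambda>x. Re (c * ek k x))" and "pdiff i (\<lambda>x. Re (c * ek k x)) = (\<lambda>x. Re ((\<i> * of_int (k $ i) * c) * ek k x))"
  using C1dir_bounded_linear[OF bounded_linear_compose[OF bounded_linear_Re bounded_linear_mult_right[of c]] C1dir_ek[of i k]]
  by (simp_all add: pdiff_ek mult_ac del: times_complex.sel)

lemma pdiffs_Re_ek: "pdiffs \<alpha> (\<lambda>x. Re (c * ek k x)) = (\<lambda>x. Re ((dsymbol \<alpha> k * c) * ek k x))"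
proof (induction \<alpha>)
  case (Cons i \<alpha>)
  show ?case unfolding pdiffs.simps Cons pdiff_Re_ek(2) by (simp add: mult_ac del: times_complex.sel)
qed simp

lemma Re_ek_Ck: "(\<lambda>x. Re (c * ek k x)) \<in> Ck n"
proof -
  have "periodic (\<lambda>x. Re (c * ek k x))" "continuous_on UNIV (\<lambda>x. Re (c * ek k x))"
    "(\<lambda>t. Re (c * ek k (shift i t x))) differentiable (at 0)" for c i x
    using pdiff_Re_ek(1)[of i c k] unfolding C1dir_def by blast+
  then show ?thesis by (simp add: Ck_def pdiffs_Re_ek del: times_complex.sel)
qed

lemma Lp_1_iff: "f \<in> Lp 1 \<longleftrightarrow> periodic f \<and> f \<in> borel_measurable borel \<and> integrable torus f"
proof -
  have "real_of_ereal 1 = 1" by (simp add: one_ereal_def)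
  then show ?thesis by (auto simp: Lp_def integrable_norm_iff)
qed

lemma Lp_2: "Lp 2 = L2p"
proof -
  have "real_of_ereal 2 = 2" using real_of_ereal.simps(1)[of 2] by simp
  then show ?thesis by (auto simp: Lp_def L2p_def)
qed

lemma L2p_Lp_1: "f \<in> L2p \<Longrightarrow> f \<in> Lp 1"
  using L2p_integrable L2p_periodic L2p_borel by (auto simp: Lp_1_iff)

text \<open>Real and imaginary parts of a character are admissible test functions, and the two
  identities are recombined into one for the character.\<close>

lemma weak_deriv_fc:
  fixes f g :: "real^'d::finite \<Rightarrow> complex"
  assumes "weak_deriv \<alpha> f g"
  shows "fc g k = dsymbol \<alpha> k * fc f k"
proof -
  let ?s = "(- 1 :: real) ^ length \<alpha>"
  have i: "integrable torus f" "integrable torus g" using assms by (auto simp: weak_deriv_def Lp_1_iff)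
  have test: "(LINT x|torus. Re ((dsymbol \<alpha> l * c) * ek l x) *\<^sub>R f x) = ?s *\<^sub>R (LINT x|torus. Re (c * ek l x) *\<^sub>R g x)" for c l
    using assms[unfolded weak_deriv_def, THEN conjunct2, THEN conjunct2, rule_format, OF Re_ek_Ck]
    unfolding pdiffs_Re_ek .
  have int: "integrable torus (\<lambda>x. Re (c * ek l x) *\<^sub>R h x)" if "integrable torus h" for c l and h :: "real^'d \<Rightarrow> complex"
  proof (rule Bochner_Integration.integrable_bound)
    show "integrable torus (\<lambda>x. c * h x)" using that by simp
    have [measurable]: "h \<in> borel_measurable torus" using that by simp
    show "(\<lambda>x. Re (c * ek l x) *\<^sub>R h x) \<in> borel_measurable torus" by measurable
    have "\<bar>Re (c * ek l x)\<bar> \<le> cmod c" for x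
      using abs_Re_le_cmod[of "c * ek l x"] by (simp add: norm_mult del: times_complex.sel)
    then show "AE x in torus. norm (Re (c * ek l x) *\<^sub>R h x) \<le> norm (c * h x)"
      by (simp add: norm_mult mult_right_mono del: times_complex.sel)
  qed
  \<comment> \<open>z = Re z + \<i> Re (- \<i> z), so two real test functions recover the complex
    one.\<close>
  have comb: "(LINT x|torus. Re (c * ek l x) *\<^sub>R h x) + \<i> * (LINT x|torus. Re (- \<i> * c * ek l x) *\<^sub>R h x)
      = (LINT x|torus. c * (h x * ek l x))"
    if "integrable torus h" for c l and h :: "real^'d \<Rightarrow> complex"
  proof -
    have "complex_of_real (Re z) + \<i> * complex_of_real (Re (- \<i> * z)) = z" for z by (simp add: complex_eq_iff)
    from arg_cong[OF this[of "c * ek l x" for x], of "\<lambda>w. w * h x" for x]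
    have "Re (c * ek l x) *\<^sub>R h x + \<i> * (Re (- \<i> * c * ek l x) *\<^sub>R h x) = c * (h x * ek l x)" for x
      unfolding scaleR_conv_of_real distrib_right mult.assoc mult.commute[of "h x" "ek l x"] .
    then show ?thesis
      by (simp only: integral_mult_right_zero[symmetric] Bochner_Integration.integral_add[symmetric, OF int integrable_mult_right[OF int], OF that that])
  qed
  have "dsymbol \<alpha> l * (LINT x|torus. f x * ek l x) = of_real ?s * (LINT x|torus. g x * ek l x)" for l
  proof -
    have "dsymbol \<alpha> l * (LINT x|torus. f x * ek l x) = (LINT x|torus. Re (dsymbol \<alpha> l * 1 * ek l x) *\<^sub>R f x)
        + \<i> * (LINT x|torus. Re (dsymbol \<alpha> l * (- \<i>) * ek l x) *\<^sub>R f x)"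
      using comb[OF i(1), of "dsymbol \<alpha> l" l] by (simp add: mult.commute del: times_complex.sel)
    also have "\<dots> = of_real ?s * ((LINT x|torus. Re (1 * ek l x) *\<^sub>R g x) + \<i> * (LINT x|torus. Re ((- \<i>) * ek l x) *\<^sub>R g x))"
      unfolding test by (simp add: scaleR_conv_of_real algebra_simps)
    also have "(LINT x|torus. Re (1 * ek l x) *\<^sub>R g x) + \<i> * (LINT x|torus. Re ((- \<i>) * ek l x) *\<^sub>R g x) = (LINT x|torus. g x * ek l x)"
      using comb[OF i(2), of 1 l] by simp
    finally show ?thesis .
  qed
  \<comment> \<open>\<open>fc\<close> integrates against the character of \<open>- k\<close>; the
    sign from \<open>dsymbol_minus\<close> cancels the sign in the weak derivative.\<close>
  from this[of "- k"] have "?s * dsymbol \<alpha> k * fc f k = of_real ?s * fc g k"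
    by (simp add: fc_def dsymbol_minus)
  then show ?thesis by simp
qed

text \<open>The converse within L^2: Parseval moves the symbol onto the test function, and its
  conjugation supplies the sign of integration by parts.\<close>

lemma weak_derivI:
  fixes f g :: "real^'d::finite \<Rightarrow> complex"
  assumes L: "f \<in> L2p" "g \<in> L2p" and fc: "\<And>k. fc g k = dsymbol \<alpha> k * fc f k"
  shows "weak_deriv \<alpha> f g"
  unfolding weak_deriv_def
proof (intro conjI allI impI)
  fix \<phi> :: "real^'d \<Rightarrow> real" assume \<phi>: "\<forall>k. \<phi> \<in> Ck k"
  have per: "periodic (pdiffs \<beta> \<phi>)" for \<beta>
    using \<phi> by (induction \<beta>) (auto simp: Ck_def intro: periodic_pdiff)
  have cont: "continuous_on UNIV (pdiffs \<beta> \<phi>)" for \<beta>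
    using \<phi>[rule_format, of "length \<beta>"] by (auto simp: Ck_def)
  have C1: "C1dir i (pdiffs \<beta> \<phi>)" for i \<beta>
    using \<phi>[rule_format, of "Suc (length \<beta>)"] per cont cont[of "i # \<beta>"] by (auto simp: Ck_def C1dir_def)
  have cL: "(\<lambda>x. complex_of_real (pdiffs \<beta> \<phi> x)) \<in> L2p" for \<beta>
    by (intro continuous_L2p continuous_on_of_real cont) (use per in \<open>simp add: periodic_def\<close>)
  have coeff: "fc (\<lambda>x. of_real (pdiffs \<beta> \<phi> x)) k = dsymbol \<beta> k * fc (\<lambda>x. of_real (\<phi> x)) k" for \<beta> k
  proof (induction \<beta>)
    case (Cons i \<beta>)
    note c = C1dir_bounded_linear[OF bounded_linear_of_real C1[of i \<beta>]]
    show ?case using fc_pdiff[OF c(1), of k] unfolding c(2) by (simp add: Cons)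
  qed simp
  have cs: "cnj (dsymbol \<alpha> k) = (- 1) ^ length \<alpha> * dsymbol \<alpha> k" for k
    by (induction \<alpha>) auto
  have "(LINT x|torus. f x * cnj (of_real (pdiffs \<alpha> \<phi> x))) = (LINT x|torus. g x * cnj ((- 1) ^ length \<alpha> * of_real (\<phi> x)))"
  proof (rule parseval_swap)
    show "(\<lambda>x. (- 1) ^ length \<alpha> * complex_of_real (\<phi> x)) \<in> L2p" using cL[of "[]"] by (intro L2p_cmult) simp
    show "fc f k * cnj (fc (\<lambda>x. of_real (pdiffs \<alpha> \<phi> x)) k) = fc g k * cnj (fc (\<lambda>x. (- 1) ^ length \<alpha> * of_real (\<phi> x)) k)" for k
      unfolding coeff fc fc_cmult by (simp add: cs)
  qed (use L cL in auto)
  also have "\<dots> = (- 1) ^ length \<alpha> * (LINT x|torus. g x * of_real (\<phi> x))"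
    by (simp flip: integral_mult_right_zero add: mult.left_commute)
  finally show "(LINT x|torus. pdiffs \<alpha> \<phi> x *\<^sub>R f x) = (- 1) ^ length \<alpha> *\<^sub>R (LINT x|torus. \<phi> x *\<^sub>R g x)"
    by (simp add: scaleR_conv_of_real mult.commute)
qed (use L L2p_Lp_1 in auto)

text \<open>\<open>wpdiff\<close> is an arbitrary representative, a priori only in
  \<open>Lp 1\<close>. Equal coefficients identify it with \<open>g\<close> almost everywhere, and
  square-integrability is inherited from \<open>g\<close>.\<close>

lemma wd_wpdiff:
  assumes "wd i f g"
  shows "wd i f (wpdiff i f)" and "AE x in torus. wpdiff i f x = g x"
proof -
  have L: "f \<in> L2p" "g \<in> L2p" using assms by (auto simp: wd_def)
  have "weak_deriv [i] f g" using assms by (intro weak_derivI) (auto simp: wd_def)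
  then have w: "weak_deriv [i] f (wpdiff i f)" unfolding wpdiff_def by (rule someI[where P="weak_deriv [i] f"])
  then have 1: "wpdiff i f \<in> Lp 1" by (simp add: weak_deriv_def)
  have fc: "fc (wpdiff i f) k = \<i> * of_int (k $ i) * fc f k" for k using weak_deriv_fc[OF w, of k] by simp
  show ae: "AE x in torus. wpdiff i f x = g x"
    using 1 L L2p_integrable fc assms by (intro fc_inject) (auto simp: Lp_1_iff wd_def)
  have "integrable torus (\<lambda>x. (cmod (wpdiff i f x))\<^sup>2) \<longleftrightarrow> integrable torus (\<lambda>x. (cmod (g x))\<^sup>2)"
    by (rule integrable_cong_AE) (use 1 ae L2p_measurable[OF L(2)] in \<open>auto simp: Lp_1_iff\<close>)
  then have "wpdiff i f \<in> L2p" using 1 L2p_sq[OF L(2)] by (auto simp: Lp_1_iff L2p_def)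
  then show "wd i f (wpdiff i f)" using L fc by (auto simp: wd_def)
qed

section \<open>Convolutions with continuous kernels\<close>

lemma conv_integrand_measurable:
  fixes f :: "real^'d::finite \<Rightarrow> 'a::{banach,second_countable_topology}"
  assumes "continuous_on UNIV w" "f \<in> borel_measurable torus"
  shows "(\<lambda>y. w (x - y) *\<^sub>R f y) \<in> borel_measurable torus"
proof -
  have "continuous_on UNIV (\<lambda>y. w (x - y))"
    by (rule continuous_on_compose2[OF assms(1)]) (auto intro!: continuous_intros)
  then have "(\<lambda>y. w (x - y)) \<in> borel_measurable torus"
    by (intro measurable_torus borel_measurable_continuous_onI)
  then show ?thesis using assms(2) by (intro borel_measurable_scaleR)
qed

lemma conv_integrand_integrable:
  fixes f :: "real^'d::finite \<Rightarrow> 'a::{banach,second_countable_topology}"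
  assumes w: "periodic w" "continuous_on UNIV w" and f: "integrable torus f"
  shows "integrable torus (\<lambda>y. w (x - y) *\<^sub>R f y)"
proof -
  obtain M where M: "M > 0" "\<And>x. norm (w x) \<le> M" using continuous_periodic_bounded[OF w] by blast
  show ?thesis
  proof (rule Bochner_Integration.integrable_bound)
    show "integrable torus (\<lambda>y. M *\<^sub>R f y)" using f by simp
    show "(\<lambda>y. w (x - y) *\<^sub>R f y) \<in> borel_measurable torus"
      by (rule conv_integrand_measurable[OF w(2) borel_measurable_integrable[OF f]])
    have "norm (w (x - y) *\<^sub>R f y) \<le> norm (M *\<^sub>R f y)" for y
      using M(1) M(2)[of "x - y"] by (simp add: mult_right_mono)
    then show "AE y in torus. norm (w (x - y) *\<^sub>R f y) \<le> norm (M *\<^sub>R f y)" by simp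
  qed
qed

lemma conv_norm_le:
  fixes f :: "real^'d::finite \<Rightarrow> 'a::{banach,second_countable_topology}"
  assumes w: "periodic w" "continuous_on UNIV w" and f: "integrable torus f" and M: "\<And>x. \<bar>w x\<bar> \<le> M"
  shows "norm (conv w f x) \<le> M * (LINT y|torus. norm (f y))"
proof -
  have "norm (conv w f x) \<le> (LINT y|torus. norm (w (x - y) *\<^sub>R f y))"
    unfolding conv_def by (rule Bochner_Integration.integral_norm_bound)
  also have "\<dots> \<le> (LINT y|torus. M * norm (f y))"
  proof (rule integral_mono)
    show "norm (w (x - y) *\<^sub>R f y) \<le> M * norm (f y)" for y
      using M[of "x - y"] by (simp add: mult_right_mono)
    show "integrable torus (\<lambda>y. norm (w (x - y) *\<^sub>R f y))"
      by (intro integrable_norm conv_integrand_integrable w f)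
    show "integrable torus (\<lambda>y. M * norm (f y))" using f by simp
  qed
  finally show ?thesis by simp
qed

lemma conv_periodic: "periodic w \<Longrightarrow> periodic (conv w f)"
proof -
  assume w: "periodic w"
  have "w (x + axis i (2 * pi) - y) = w (x - y)" for i x y
  proof -
    have "w ((x - y) + axis i (2 * pi)) = w (x - y)" using w unfolding periodic_def by blast
    then show ?thesis by (simp add: algebra_simps)
  qed
  then show ?thesis unfolding periodic_def conv_def by simp
qed

lemma conv_continuous:
  fixes f :: "real^'d::finite \<Rightarrow> 'a::{banach,second_countable_topology}"
  assumes w: "periodic w" "continuous_on UNIV w" and f: "integrable torus f"
  shows "continuous_on UNIV (conv w f)"
proof -
  obtain M where M: "M > 0" "\<And>x. norm (w x) \<le> M" using continuous_periodic_bounded[OF w] by blast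
  have "(\<lambda>n. conv w f (X n)) \<longlonglongrightarrow> conv w f x" if X: "X \<longlonglongrightarrow> x" for X x
    unfolding conv_def
  proof (rule integral_dominated_convergence[where w="\<lambda>y. M * norm (f y)"])
    show "AE y in torus. (\<lambda>n. w (X n - y) *\<^sub>R f y) \<longlonglongrightarrow> w (x - y) *\<^sub>R f y"
      by (intro AE_I2 tendsto_scaleR tendsto_const continuous_on_tendsto_compose[OF w(2)] tendsto_diff X) auto
    show "AE y in torus. norm (w (X n - y) *\<^sub>R f y) \<le> M * norm (f y)" for n
      using M(2) by (intro AE_I2) (simp add: mult_right_mono)
    show "integrable torus (\<lambda>y. M * norm (f y))" using f by simp
  qed (rule conv_integrand_measurable[OF w(2) borel_measurable_integrable[OF f]])+
  then show ?thesis by (auto simp: continuous_on_sequentially comp_def)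
qed

text \<open>The difference quotients of the kernel are bounded uniformly, so a multiple of |f|
  dominates and the derivative falls on the kernel; \<open>f\<close> need only be
  integrable.\<close>

lemma
  fixes f :: "real^'d::finite \<Rightarrow> 'a::{banach,second_countable_topology}"
  assumes w: "C1dir i w" and f: "integrable torus f"
  shows C1dir_conv: "C1dir i (conv w f)" and pdiff_conv: "pdiff i (conv w f) = conv (pdiff i w) f"
proof -
  note c = C1dir_periodic[OF w] C1dir_cont[OF w] and c' = C1dir_periodic_pdiff[OF w] C1dir_cont_pdiff[OF w]
  obtain M where M: "\<forall>t x. t \<noteq> 0 \<longrightarrow> norm ((w (shift i t x) - w x) /\<^sub>R t) \<le> M"
    using C1dir_difference_quotient_bound[OF w] by blast
  have der: "((\<lambda>t. conv w f (shift i t x)) has_vector_derivative conv (pdiff i w) f x) (at 0)" for x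
  proof -
    have lim: "(\<lambda>n. (conv w f (shift i (t n) x) - conv w f x) /\<^sub>R t n) \<longlonglongrightarrow> conv (pdiff i w) f x"
      if t: "t \<longlonglongrightarrow> 0" "\<And>n. t n \<noteq> 0" for t
    proof -
      have eq: "(conv w f (shift i (t n) x) - conv w f x) /\<^sub>R t n
          = (LINT y|torus. ((w (shift i (t n) (x - y)) - w (x - y)) /\<^sub>R t n) *\<^sub>R f y)" for n
      proof -
        have "conv w f (shift i (t n) x) - conv w f x
          = (LINT y|torus. w (shift i (t n) x - y) *\<^sub>R f y - w (x - y) *\<^sub>R f y)"
          unfolding conv_def
          by (rule Bochner_Integration.integral_diff[symmetric]; rule conv_integrand_integrable[OF c f])
        also have "\<dots> /\<^sub>R t n = (LINT y|torus. (w (shift i (t n) x - y) *\<^sub>R f y - w (x - y) *\<^sub>R f y) /\<^sub>R t n)"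
          by simp
        also have "\<dots> = (LINT y|torus. ((w (shift i (t n) (x - y)) - w (x - y)) /\<^sub>R t n) *\<^sub>R f y)"
          by (intro Bochner_Integration.integral_cong) (auto simp: scaleR_diff_left[symmetric] diff_add_eq)
        finally show ?thesis .
      qed
      show ?thesis
        unfolding eq conv_def[of "pdiff i w"]
      proof (rule integral_dominated_convergence[where w="\<lambda>y. M * norm (f y)"])
        show "AE y in torus. (\<lambda>n. ((w (shift i (t n) (x - y)) - w (x - y)) /\<^sub>R t n) *\<^sub>R f y) \<longlonglongrightarrow> pdiff i w (x - y) *\<^sub>R f y"
          by (intro AE_I2 tendsto_scaleR tendsto_const C1dir_difference_quotient[OF w t])
        have "norm (((w (shift i (t n) (x - y)) - w (x - y)) /\<^sub>R t n) *\<^sub>R f y) \<le> M * norm (f y)" for n y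
          unfolding norm_scaleR[of _ "f y"] using M[rule_format, of "t n" "x - y"] t(2) by (intro mult_right_mono) auto
        then show "AE y in torus. norm (((w (shift i (t n) (x - y)) - w (x - y)) /\<^sub>R t n) *\<^sub>R f y) \<le> M * norm (f y)" for n
          by simp
        show "(\<lambda>y. ((w (shift i (t n) (x - y)) - w (x - y)) /\<^sub>R t n) *\<^sub>R f y) \<in> borel_measurable torus" for n
        proof -
          have "(\<lambda>y. (w (shift i (t n) x - y) *\<^sub>R f y - w (x - y) *\<^sub>R f y) /\<^sub>R t n) \<in> borel_measurable torus"
            using f by (intro borel_measurable_scaleR borel_measurable_diff borel_measurable_const conv_integrand_measurable c) auto
          then show ?thesis by (simp add: scaleR_diff_left[symmetric] diff_add_eq)
        qed
        show "(\<lambda>y. pdiff i w (x - y) *\<^sub>R f y) \<in> borel_measurable torus"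
          by (rule conv_integrand_measurable[OF c'(2) borel_measurable_integrable[OF f]])
        show "integrable torus (\<lambda>y. M * norm (f y))" using f by simp
      qed
    qed
    have "((\<lambda>t. (conv w f (shift i t x) - conv w f x) /\<^sub>R t) \<longlongrightarrow> conv (pdiff i w) f x) (at 0)"
      unfolding tendsto_at_iff_sequentially comp_def using lim by simp
    then show ?thesis unfolding has_vector_derivative_at_0_iff by simp
  qed
  from C1dirI[OF conv_periodic[OF c(1)] conv_continuous[OF c f] conv_continuous[OF c' f] der]
  show "C1dir i (conv w f)" "pdiff i (conv w f) = conv (pdiff i w) f" .
qed

section \<open>Regularity and positivity of the stationary state\<close>

lemma C1dir_exp:
  fixes u :: "real^'d::finite \<Rightarrow> real"
  assumes u: "C1dir i u"
  shows "C1dir i (\<lambda>x. exp (u x))"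
proof -
  have der: "((\<lambda>t. exp (u (shift i t x))) has_vector_derivative exp (u x) * pdiff i u x) (at 0)" for x
  proof -
    have "((\<lambda>t. u (shift i t x)) has_real_derivative pdiff i u x) (at 0)"
      using C1dir_deriv0[OF u] by (simp add: has_real_derivative_iff_has_vector_derivative)
    from DERIV_chain2[OF DERIV_exp this] show ?thesis
      by (simp add: has_real_derivative_iff_has_vector_derivative)
  qed
  have cont: "continuous_on UNIV (\<lambda>x. exp (u x) * pdiff i u x)" "continuous_on UNIV (\<lambda>x. exp (u x))"
    by (intro continuous_intros C1dir_cont[OF u] C1dir_cont_pdiff[OF u])+
  have per: "periodic (\<lambda>x. exp (u x))" using C1dir_periodic[OF u] by (simp add: periodic_def)
  show ?thesis by (rule C1dirI(1)[OF per cont(2,1) der])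
qed

lemma
  assumes "f \<in> Ck 2"
  shows Ck2_C1dir: "C1dir i f" and Ck2_C1dir_pdiff: "C1dir j (pdiff i f)"
proof -
  have per: "periodic f"
    and d: "\<And>\<alpha> i x. length \<alpha> < 2 \<Longrightarrow> (\<lambda>t. pdiffs \<alpha> f (shift i t x)) differentiable (at (0::real))"
    and c: "\<And>\<alpha>. length \<alpha> \<le> 2 \<Longrightarrow> continuous_on UNIV (pdiffs \<alpha> f)"
    using assms by (auto simp: Ck_def)
  show "C1dir i f" using per d[of "[]"] c[of "[]"] c[of "[i]"] by (auto simp: C1dir_def)
  show "C1dir j (pdiff i f)" using periodic_pdiff[OF per] d[of "[i]"] c[of "[i]"] c[of "[j, i]"] by (auto simp: C1dir_def)
qed

text \<open>Bootstrapping: convolving an integrable density with \<open>W\<close> is already C1,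
  hence so are the exponent and the density. A bounded exponent keeps the density away from
  zero.\<close>

lemma stationary_state_props:
  fixes V W \<mu> :: "real^'d::finite \<Rightarrow> real"
  assumes V: "V \<in> Ck 2" and W: "W \<in> Ck 2" and st: "stationary_state \<sigma> V W \<mu>"
  shows "integrable torus \<mu>" and "C1dir i \<mu>" and "\<exists>m>0. \<forall>x. m \<le> \<mu> x"
proof -
  define g where "g x = exp (- (1 / \<sigma>) * (V x + conv W \<mu> x))" for x
  define Z where "Z = (LINT x|torus. g x)"
  have "\<forall>x. \<mu> x = 1 / Z * g x"
    using st unfolding stationary_state_def Let_def g_def Z_def by blast
  then have \<mu>: "\<mu> \<in> Lp 1" "(LINT x|torus. \<mu> x) = 1" "\<And>x. \<mu> x = 1 / Z * g x"
    using st unfolding stationary_state_def by blast+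
  have one: "real_of_ereal 1 = 1" by (simp add: one_ereal_def)
  have "periodic \<mu>" "\<mu> \<in> borel_measurable borel" "integrable torus (\<lambda>x. norm (\<mu> x))"
    using \<mu>(1) by (auto simp: Lp_def one)
  then show int: "integrable torus \<mu>" by (subst (asm) integrable_norm_iff) auto
  have "Z \<noteq> 0"
  proof
    \<comment> \<open>Division by zero gives 0, so the density would vanish, against total mass
      1.\<close>
    assume "Z = 0"
    then have "(LINT x|torus. \<mu> x) = 0" by (simp add: \<mu>(3))
    then show False using \<mu>(2) by simp
  qed
  moreover have "Z \<ge> 0" unfolding Z_def by (simp add: g_def)
  ultimately have Z: "Z > 0" by simp
  define u where "u x = - (1 / \<sigma>) * (V x + conv W \<mu> x)" for x
  have u: "C1dir i u" for i
    unfolding u_def using C1dir_bounded_linear(1)[OF bounded_linear_mult_right C1dir_add(1)[OF Ck2_C1dir[OF V] C1dir_conv[OF Ck2_C1dir[OF W] int]]] .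
  have \<mu>eq: "\<mu> = (\<lambda>x. 1 / Z * exp (u x))" using \<mu>(3) by (auto simp: g_def u_def)
  show "C1dir i \<mu>"
    unfolding \<mu>eq by (rule C1dir_bounded_linear(1)[OF bounded_linear_mult_right C1dir_exp[OF u]])
  obtain M where M: "\<And>x. norm (u x) \<le> M"
    using continuous_periodic_bounded[OF C1dir_periodic[OF u] C1dir_cont[OF u]] by blast
  have "1 / Z * exp (- M) \<le> \<mu> x" for x
    unfolding \<mu>eq using M[of x] Z by (intro mult_left_mono) (auto simp: abs_le_iff)
  then show "\<exists>m>0. \<forall>x. m \<le> \<mu> x" using Z by (intro exI[of _ "1 / Z * exp (- M)"]) auto
qed

section \<open>Transport of operators to Fourier coefficients\<close>

definition synth :: "(int^'d::finite) l2 \<Rightarrow> real^'d \<Rightarrow> complex" where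
  "synth u = (SOME f. f \<in> L2p \<and> fhat f = u)"

lemma synth: "synth u \<in> L2p" "fhat (synth u) = u"
proof -
  obtain f where "f \<in> L2p" "\<And>k. fc f k = cf u k" using riesz_fischer[of u] by blast
  then have "f \<in> L2p \<and> fhat f = u" by (auto intro!: l2_eqI simp: cf_fhat)
  then have "synth u \<in> L2p \<and> fhat (synth u) = u" unfolding synth_def by (rule someI[where P="\<lambda>f. f \<in> L2p \<and> fhat f = u"])
  then show "synth u \<in> L2p" "fhat (synth u) = u" by auto
qed

definition fop :: "((real^'d::finite \<Rightarrow> complex) \<Rightarrow> real^'d \<Rightarrow> complex) \<Rightarrow> (int^'d) l2 \<Rightarrow> (int^'d) l2" where
  "fop T u = fhat (T (synth u))"

text \<open>\<open>synth\<close> picks a representative and \<open>T\<close> is not assumed to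
  respect almost everywhere equality. The L^2 bound makes the image on coefficients independent of
  the choice.\<close>

lemma
  fixes T :: "(real^'d::finite \<Rightarrow> complex) \<Rightarrow> real^'d \<Rightarrow> complex"
  assumes maps: "\<And>f. f \<in> L2p \<Longrightarrow> T f \<in> L2p"
    and add: "\<And>f g. f \<in> L2p \<Longrightarrow> g \<in> L2p \<Longrightarrow> T (\<lambda>x. f x + g x) = (\<lambda>x. T f x + T g x)"
    and scale: "\<And>f c. f \<in> L2p \<Longrightarrow> T (\<lambda>x. c * f x) = (\<lambda>x. c * T f x)"
    and bound: "\<And>f. f \<in> L2p \<Longrightarrow> (LINT x|torus. (cmod (T f x))\<^sup>2) \<le> C\<^sup>2 * (LINT x|torus. (cmod (f x))\<^sup>2)"
    and "C \<ge> 0"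
  shows fop_fhat: "f \<in> L2p \<Longrightarrow> fop T (fhat f) = fhat (T f)" and clin_fop: "clin (fop T)"
proof -
  have norm_le: "norm (fhat (T f)) \<le> C * norm (fhat f)" if "f \<in> L2p" for f
  proof (rule power2_le_imp_le)
    have "vol TYPE('d) * (norm (fhat (T f)))\<^sup>2 \<le> vol TYPE('d) * (C * norm (fhat f))\<^sup>2"
      using bound[OF that] by (simp add: parseval_norm maps that power_mult_distrib mult.left_commute)
    then show "(norm (fhat (T f)))\<^sup>2 \<le> (C * norm (fhat f))\<^sup>2" using vol_pos[where 'd='d] by simp
  qed (use \<open>C \<ge> 0\<close> in simp)
  have fop: "fop T (fhat f) = fhat (T f)" if f: "f \<in> L2p" for f
  proof -
    \<comment> \<open>The difference of two representatives: its coefficients vanish, hence by the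
      bound so do those of its image.\<close>
    define g where "g x = synth (fhat f) x + (- 1) * f x" for x
    have mf: "(\<lambda>x. (- 1) * f x) \<in> L2p" by (intro L2p_cmult f)
    have g: "g \<in> L2p" unfolding g_def by (intro L2p_add synth mf)
    have "fhat g = 0"
      unfolding g_def fhat_add[OF synth(1) mf] fhat_cmult[OF f] synth(2) by (rule l2_eqI) simp
    then have "fhat (T g) = 0" using norm_le[OF g] by simp
    moreover have "fhat (T g) = fhat (T (synth (fhat f))) + cscale (- 1) (fhat (T f))"
      unfolding g_def add[OF synth(1) mf] scale[OF f]
        fhat_add[OF maps[OF synth(1)] L2p_cmult[OF maps[OF f]]] fhat_cmult[OF maps[OF f]] ..
    ultimately have zero: "fhat (T (synth (fhat f))) + cscale (- 1) (fhat (T f)) = 0" by simp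
    have "cf (fhat (T (synth (fhat f)))) k = cf (fhat (T f)) k" for k
      using arg_cong[OF zero, of "\<lambda>v. cf v k"] by simp
    then show ?thesis unfolding fop_def by (rule l2_eqI)
  qed
  show "f \<in> L2p \<Longrightarrow> fop T (fhat f) = fhat (T f)" by (rule fop)
  show "clin (fop T)"
  proof (rule clinI)
    fix u v :: "(int^'d) l2" and c
    have "fop T (fhat (\<lambda>x. synth u x + synth v x)) = fhat (T (synth u)) + fhat (T (synth v))"
      by (subst fop) (auto intro: L2p_add synth simp: add synth fhat_add maps)
    then show "fop T (u + v) = fop T u + fop T v" by (simp add: fhat_add synth fop_def[of T u] fop_def[of T v])
    have "fop T (fhat (\<lambda>x. c * synth u x)) = cscale c (fhat (T (synth u)))"
      by (subst fop) (auto intro: L2p_cmult synth simp: scale synth fhat_cmult maps)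
    then show "fop T (cscale c u) = cscale c (fop T u)" by (simp add: fhat_cmult synth fop_def[of T u])
    show "norm (fop T u) \<le> C * norm u" using norm_le[OF synth(1), of u] by (simp add: synth fop_def)
  qed
qed

lemma
  fixes a :: "real^'d::finite \<Rightarrow> real"
  assumes a: "periodic a" "continuous_on UNIV a"
  shows fop_mult: "f \<in> L2p \<Longrightarrow> fop (\<lambda>f x. a x *\<^sub>R f x) (fhat f) = fhat (\<lambda>x. a x *\<^sub>R f x)"
    and clin_fop_mult: "clin (fop (\<lambda>f x. a x *\<^sub>R f x))"
proof -
  obtain M where M: "M > 0" "\<And>x. norm (a x) \<le> M" using continuous_periodic_bounded[OF a] by blast
  have bound: "(LINT x|torus. (cmod (a x *\<^sub>R f x))\<^sup>2) \<le> M\<^sup>2 * (LINT x|torus. (cmod (f x))\<^sup>2)" if "f \<in> L2p" for f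
    using bounded_mult_L2p(2)[OF that, of "\<lambda>x. of_real (a x)" M] a M
    by (simp add: scaleR_conv_of_real periodic_def borel_measurable_continuous_onI continuous_on_of_real)
  have add: "(\<lambda>x. a x *\<^sub>R (f x + g x)) = (\<lambda>x. a x *\<^sub>R f x + a x *\<^sub>R g x)" for f g :: "real^'d \<Rightarrow> complex"
    by (simp add: scaleR_add_right)
  have scale: "(\<lambda>x. a x *\<^sub>R (c * f x)) = (\<lambda>x. c * (a x *\<^sub>R f x))" for c and f :: "real^'d \<Rightarrow> complex"
    by simp
  note T = fop_fhat[of "\<lambda>f x. a x *\<^sub>R f x", OF real_mult_L2p[OF a] add scale bound less_imp_le[OF M(1)]]
    clin_fop[of "\<lambda>f x. a x *\<^sub>R f x", OF real_mult_L2p[OF a] add scale bound less_imp_le[OF M(1)]]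
  show "f \<in> L2p \<Longrightarrow> fop (\<lambda>f x. a x *\<^sub>R f x) (fhat f) = fhat (\<lambda>x. a x *\<^sub>R f x)" "clin (fop (\<lambda>f x. a x *\<^sub>R f x))"
    using T by auto
qed

text \<open>The convolution is bounded pointwise by \<open>M\<close> times the L^1 norm, and
  Cauchy-Schwarz on the finite measure space bounds that by the L^2 norm; together the constant is
  \<open>M * ?v\<close>.\<close>

lemma
  fixes w :: "real^'d::finite \<Rightarrow> real"
  assumes w: "periodic w" "continuous_on UNIV w"
  shows conv_L2p: "f \<in> L2p \<Longrightarrow> conv w f \<in> L2p"
    and fop_conv: "f \<in> L2p \<Longrightarrow> fop (conv w) (fhat f) = fhat (conv w f)" and clin_fop_conv: "clin (fop (conv w))"
proof -
  let ?v = "vol TYPE('d)"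
  obtain M where M: "M > 0" "\<And>x. norm (w x) \<le> M" using continuous_periodic_bounded[OF w] by blast
  show maps: "conv w f \<in> L2p" if "f \<in> L2p" for f
    by (intro continuous_L2p conv_periodic conv_continuous w L2p_integrable that)
  have add: "conv w (\<lambda>x. f x + g x) = (\<lambda>x. conv w f x + conv w g x)" if "f \<in> L2p" "g \<in> L2p" for f g :: "real^'d \<Rightarrow> complex"
    unfolding conv_def scaleR_add_right
    by (intro ext Bochner_Integration.integral_add conv_integrand_integrable w L2p_integrable that)
  have scale: "conv w (\<lambda>x. c * f x) = (\<lambda>x. c * conv w f x)" for c and f :: "real^'d \<Rightarrow> complex"
  proof -
    have "w (x - y) *\<^sub>R (c * f y) = c * (w (x - y) *\<^sub>R f y)" for x y by simp
    then show ?thesis unfolding conv_def by (simp only: integral_mult_right_zero)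
  qed
  have L1: "(LINT x|torus. cmod (f x))\<^sup>2 \<le> ?v * (LINT x|torus. (cmod (f x))\<^sup>2)" if f: "f \<in> L2p" for f :: "real^'d \<Rightarrow> complex"
  proof -
    define I where "I = (LINT x|torus. cmod (f x))"
    \<comment> \<open>The mean of |f|; a nonnegative variance about the mean is Cauchy-Schwarz
      against the constant 1.\<close>
    define c where "c = I / ?v"
    note i = L2p_sq[OF f] integrable_norm[OF L2p_integrable[OF f]]
    have "0 \<le> (LINT x|torus. (cmod (f x) - c)\<^sup>2)" by simp
    also have "\<dots> = (LINT x|torus. (cmod (f x))\<^sup>2 - 2 * c * cmod (f x) + c\<^sup>2)"
      by (simp add: power2_diff algebra_simps)
    also have "\<dots> = (LINT x|torus. (cmod (f x))\<^sup>2) - 2 * c * I + ?v * c\<^sup>2"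
      using i by (simp add: I_def vol_def)
    finally show ?thesis
      using vol_pos[where 'd='d] by (simp add: c_def I_def[symmetric] power2_eq_square field_simps)
  qed
  have bound: "(LINT x|torus. (cmod (conv w f x))\<^sup>2) \<le> (M * ?v)\<^sup>2 * (LINT x|torus. (cmod (f x))\<^sup>2)" if f: "f \<in> L2p" for f :: "real^'d \<Rightarrow> complex"
  proof -
    define I where "I = (LINT x|torus. cmod (f x))"
    have "(cmod (conv w f x))\<^sup>2 \<le> (M * I)\<^sup>2" for x
      unfolding I_def using M by (intro power_mono conv_norm_le w L2p_integrable f) auto
    then have "(LINT x|torus. (cmod (conv w f x))\<^sup>2) \<le> (LINT x|(torus :: (real^'d) measure). (M * I)\<^sup>2)"
      by (intro integral_mono L2p_sq maps f) auto
    also have "\<dots> = ?v * M\<^sup>2 * I\<^sup>2" by (simp add: vol_def power_mult_distrib)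
    also have "\<dots> \<le> ?v * M\<^sup>2 * (?v * (LINT x|torus. (cmod (f x))\<^sup>2))"
      unfolding I_def using vol_pos[where 'd='d] by (intro mult_left_mono L1 f) auto
    finally show ?thesis by (simp add: power2_eq_square mult_ac)
  qed
  have nn: "M * ?v \<ge> 0" using M(1) vol_pos[where 'd='d] by simp
  show "f \<in> L2p \<Longrightarrow> fop (conv w) (fhat f) = fhat (conv w f)"
    by (rule fop_fhat[where T="conv w" and C="M * ?v"])
      (erule maps | erule (1) add | rule scale | erule bound | rule nn | assumption)+
  show "clin (fop (conv w))"
    by (rule clin_fop[where T="conv w" and C="M * ?v"])
      (erule maps | erule (1) add | rule scale | erule bound | rule nn)+
qed

section \<open>The linearized McKean-Vlasov operator\<close>

lemma finite_int_vec_bounded: "finite {k :: int^'d::finite. \<forall>i. \<bar>real_of_int (k $ i)\<bar> \<le> N}"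
proof (rule finite_subset)
  show "{k :: int^'d. \<forall>i. \<bar>real_of_int (k $ i)\<bar> \<le> N} \<subseteq> vec_lambda ` PiE UNIV (\<lambda>_. {- \<lceil>N\<rceil>..\<lceil>N\<rceil>})"
  proof
    fix k :: "int^'d" assume "k \<in> {k. \<forall>i. \<bar>real_of_int (k $ i)\<bar> \<le> N}"
    then have "real_of_int \<bar>k $ i\<bar> \<le> N" for i by simp
    from ceiling_mono[OF this] have "\<bar>k $ i\<bar> \<le> \<lceil>N\<rceil>" for i
      unfolding ceiling_of_int .
    then have "(\<lambda>i. k $ i) \<in> PiE UNIV (\<lambda>_. {- \<lceil>N\<rceil>..\<lceil>N\<rceil>})" by (auto simp: abs_le_iff minus_le_iff)
    then show "k \<in> vec_lambda ` PiE UNIV (\<lambda>_. {- \<lceil>N\<rceil>..\<lceil>N\<rceil>})" by (intro image_eqI[of _ _ "\<lambda>i. k $ i"]) auto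
  qed
qed (intro finite_imageI finite_PiE; simp)

section \<open>Frequency weights and the domain in Fourier variables\<close>

definition freq1 :: "int^'d::finite \<Rightarrow> real" where
  "freq1 k = 1 + (\<Sum>i\<in>UNIV. \<bar>real_of_int (k $ i)\<bar>)"

definition freq2 :: "real \<Rightarrow> int^'d::finite \<Rightarrow> real" where
  "freq2 \<sigma> k = \<sigma> * (\<Sum>i\<in>UNIV. (real_of_int (k $ i))\<^sup>2)"

lemma freq1_ge_1: "freq1 k \<ge> 1"
  by (simp add: freq1_def sum_nonneg)

lemma abs_le_freq1: "\<bar>real_of_int (k $ i)\<bar> \<le> freq1 k"
  using member_le_sum[of i UNIV "\<lambda>i. \<bar>real_of_int (k $ i)\<bar>"] by (simp add: freq1_def)

text \<open>The condition bounds a sum over coordinates of c t^2 - |t|. Each summand is at least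
  -1/(4 c), by completing the square, so each single one is bounded above and thereby each
  coordinate of \<open>k\<close>.\<close>

lemma freq_small:
  assumes "\<sigma> > 0" "\<epsilon> > 0"
  shows "finite {k :: int^'d::finite. freq1 k > \<epsilon> * (1 + freq2 \<sigma> k)}"
proof -
  define c where "c = \<epsilon> * \<sigma>"
  have c: "c > 0" using assms by (simp add: c_def)
  \<comment> \<open>1 bounds the whole sum; the other term compensates the lower bounds of the
    remaining coordinates.\<close>
  define D where "D = 1 + real CARD('d) / (4 * c)"
  have D: "D > 0" using c by (simp add: D_def add_pos_nonneg)
  show ?thesis
  proof (rule finite_subset[OF _ finite_int_vec_bounded], safe)
    fix k :: "int^'d" and i
    assume k: "\<epsilon> * (1 + freq2 \<sigma> k) < freq1 k"
    define g where "g j = c * (real_of_int (k $ j))\<^sup>2 - \<bar>real_of_int (k $ j)\<bar>" for j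
    have "(\<Sum>j\<in>UNIV. g j) < 1"
    proof -
      have "(\<Sum>j\<in>UNIV. g j) = \<epsilon> * freq2 \<sigma> k - (freq1 k - 1)"
        by (simp add: g_def sum_subtractf sum_distrib_left[symmetric] c_def freq1_def freq2_def mult.assoc)
      then show ?thesis using k assms(2) by (simp add: distrib_left)
    qed
    moreover have "- (1 / (4 * c)) \<le> g j" for j
    proof -
      define t where "t = \<bar>real_of_int (k $ j)\<bar>"
      have "0 \<le> (2 * c * t - 1)\<^sup>2" by simp
      then have "0 \<le> 4 * c * (c * t\<^sup>2 - t) + 1" by (simp add: power2_eq_square algebra_simps)
      then have "- (1 / (4 * c)) \<le> c * t\<^sup>2 - t" using c by (simp add: field_simps)
      then show ?thesis by (simp add: g_def t_def)
    qed
    then have "(\<Sum>j\<in>UNIV - {i}. - (1 / (4 * c))) \<le> (\<Sum>j\<in>UNIV - {i}. g j)" by (intro sum_mono)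
    moreover have "(\<Sum>j\<in>UNIV. g j) = g i + (\<Sum>j\<in>UNIV - {i}. g j)" by (simp add: sum.remove)
    moreover have "real (card (UNIV - {i})) * (1 / (4 * c)) \<le> real CARD('d) * (1 / (4 * c))"
      using c by (intro mult_right_mono of_nat_mono card_mono) auto
    ultimately have gi: "g i < D" by (simp add: D_def)
    \<comment> \<open>Beyond this value t \<ge> 1 and c t - 1 > D, hence c t^2 - t \<ge> D, which
      contradicts \<open>gi\<close>.\<close>
    show "\<bar>real_of_int (k $ i)\<bar> \<le> (1 + D) / c + 1"
    proof (rule ccontr)
      define t where "t = \<bar>real_of_int (k $ i)\<bar>"
      assume "\<not> \<bar>real_of_int (k $ i)\<bar> \<le> (1 + D) / c + 1"
      then have t: "t > (1 + D) / c + 1" by (simp add: t_def)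
      then have "c * t > 1 + D + c" using c by (simp add: field_simps)
      moreover have "(1 + D) / c > 0" using c D by simp
      then have "t \<ge> 1" using t by linarith
      ultimately have "1 * D \<le> t * (c * t - 1)" using c D by (intro mult_mono) auto
      also have "\<dots> = g i" by (simp add: g_def t_def power2_eq_square algebra_simps)
      finally show False using gi by simp
    qed
  qed
qed

lemma cmod_dsymbol_le:
  assumes "length \<alpha> \<le> 2" "\<sigma> > 0"
  shows "cmod (dsymbol \<alpha> k) \<le> (1 + 1 / \<sigma>) * (1 + freq2 \<sigma> k)"
proof -
  define N where "N = (\<Sum>i\<in>UNIV. (real_of_int (k $ i))\<^sup>2)"
  have le: "(real_of_int (k $ i))\<^sup>2 \<le> N" for i
    unfolding N_def by (intro member_le_sum) auto
  have N: "0 \<le> N" by (simp add: N_def sum_nonneg)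
  have ab: "\<bar>a * b\<bar> \<le> (a\<^sup>2 + b\<^sup>2) / 2" for a b :: real
    using sum_squares_bound[of "\<bar>a\<bar>" "\<bar>b\<bar>"] by (simp add: abs_mult)
  have "cmod (dsymbol \<alpha> k) \<le> 1 + N"
  proof -
    consider "\<alpha> = []" | i where "\<alpha> = [i]" | i j where "\<alpha> = [i, j]"
      using assms(1) by (cases \<alpha> rule: list.exhaust; cases "tl \<alpha>" rule: list.exhaust) auto
    then show ?thesis
    proof cases
      case (2 i)
      then show ?thesis using ab[of "real_of_int (k $ i)" 1] le[of i] N by (simp add: norm_mult)
    next
      case (3 i j)
      then show ?thesis using ab[of "real_of_int (k $ i)" "real_of_int (k $ j)"] le[of i] le[of j] N
        by (simp add: norm_mult abs_mult)
    qed (use N in auto)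
  qed
  also have "\<dots> \<le> (1 + 1 / \<sigma>) * (1 + freq2 \<sigma> k)"
    using N assms(2) by (simp add: freq2_def N_def[symmetric] field_simps)
  finally show ?thesis .
qed

text \<open>The operator needs only first and pure second derivatives. The symbol of
  \<open>[i, i]\<close> is the square of that of \<open>[i]\<close>, so \<open>E i\<close> is also
  the derivative of \<open>D i\<close>.\<close>

lemma Wkp_wd:
  assumes "y \<in> Wkp 2 2"
  shows "y \<in> L2p" and "\<exists>D E. \<forall>i. wd i y (D i) \<and> wd i (D i) (E i)"
proof -
  show y: "y \<in> L2p" using assms unfolding Wkp_def Lp_2 by blast
  have ex: "\<exists>g\<in>L2p. weak_deriv \<alpha> y g" if "length \<alpha> \<le> 2" for \<alpha>
    using assms that unfolding Wkp_def Lp_2 by blast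
  have "\<exists>D E. wd i y D \<and> wd i D E" for i
  proof -
    obtain D where D: "D \<in> L2p" "weak_deriv [i] y D" using ex[of "[i]"] by auto
    obtain E where E: "E \<in> L2p" "weak_deriv [i, i] y E" using ex[of "[i, i]"] by auto
    have "wd i y D" using D y weak_deriv_fc[OF D(2)] by (simp add: wd_def)
    moreover have "wd i D E" using D E weak_deriv_fc[OF D(2)] weak_deriv_fc[OF E(2)] by (simp add: wd_def)
    ultimately show ?thesis by blast
  qed
  then show "\<exists>D E. \<forall>i. wd i y (D i) \<and> wd i (D i) (E i)" by metis
qed

text \<open>Symbols of order at most two are dominated by 1 + \<sigma> |k|^2, so the weak
  derivatives are synthesized from bounded multiples of \<open>u\<close>.\<close>

lemma synth_Wkp:
  assumes "\<sigma> > 0" and u: "\<And>k. cf u k = of_real (1 + freq2 \<sigma> k) * cf v k"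
  shows "synth v \<in> Wkp 2 2"
proof -
  have pos: "1 + freq2 \<sigma> k > 0" for k using assms(1) by (simp add: freq2_def add_pos_nonneg sum_nonneg)
  have "\<exists>g\<in>Lp 2. weak_deriv \<alpha> (synth v) g" if "length \<alpha> \<le> 2" for \<alpha>
  proof -
    define m where "m k = dsymbol \<alpha> k / of_real (1 + freq2 \<sigma> k)" for k
    have m: "cmod (m k) \<le> 1 + 1 / \<sigma>" for k
      using cmod_dsymbol_le[OF that assms(1), of k] pos[of k]
      by (simp add: m_def norm_divide divide_le_eq del: of_real_add)
    have "fc (synth (dmul m u)) k = dsymbol \<alpha> k * fc (synth v) k" for k
    proof -
      have "of_real (1 + freq2 \<sigma> k) \<noteq> (0::complex)" using pos[of k] unfolding of_real_eq_0_iff by simp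
      moreover have "fc (synth w) k = cf w k" for w
        using cf_fhat[OF synth(1), of w k] by (simp add: synth)
      ultimately show ?thesis by (simp add: cf_dmul[OF m] m_def u del: of_real_add)
    qed
    then have "weak_deriv \<alpha> (synth v) (synth (dmul m u))" by (intro weak_derivI synth)
    then show ?thesis using synth(1)[of "dmul m u"] unfolding Lp_2 by blast
  qed
  then show ?thesis using synth(1) unfolding Wkp_def Lp_2 by blast
qed

locale mckean_vlasov =
  fixes \<sigma> :: real and V W \<mu> :: "real^'d::finite \<Rightarrow> real"
  assumes \<sigma>_pos: "\<sigma> > 0" and V: "V \<in> Ck 2" and W: "W \<in> Ck 2" and stationary: "stationary_state \<sigma> V W \<mu>"
begin

lemmas \<mu>_int = stationary_state_props(1)[OF V W stationary]
  and \<mu>_C1 = stationary_state_props(2)[OF V W stationary]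

abbreviation "mlt a \<equiv> fop (\<lambda>f x. a x *\<^sub>R f x)"

definition base :: "(int^'d) l2 \<Rightarrow> (int^'d) l2" where
  "base = dmul (\<lambda>k. 1 / of_real (freq1 k))"

definition deriv_base :: "'d \<Rightarrow> (int^'d) l2 \<Rightarrow> (int^'d) l2" where
  "deriv_base i = dmul (\<lambda>k. \<i> * of_int (k $ i) / of_real (freq1 k))"

text \<open>
  The part of the operator of order at most one, as a function of \<open>h = (1 + \<bar>k\<bar>) y\<close> in Fourier
  variables; precomposing with \<open>1 / (1 + \<bar>k\<bar>)\<close> makes it bounded.
\<close>

definition lower_order :: "(int^'d) l2 \<Rightarrow> (int^'d) l2" where
  "lower_order h = (\<Sum>i\<in>UNIV. (mlt (pdiff i (pdiff i V)) (base h) + mlt (pdiff i V) (deriv_base i h))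
     + ((mlt (conv (pdiff i (pdiff i W)) \<mu>) (base h) + mlt (conv (pdiff i W) \<mu>) (deriv_base i h))
       + (mlt (pdiff i \<mu>) (fop (conv (pdiff i W)) (base h)) + mlt \<mu> (fop (conv (pdiff i (pdiff i W))) (base h)))))"

lemma base_bounds: "cmod (1 / of_real (freq1 k)) \<le> 1" "cmod (\<i> * of_int (k $ i) / of_real (freq1 k)) \<le> 1"
  using freq1_ge_1[of k] abs_le_freq1[of k i] by (simp_all add: norm_divide norm_mult divide_le_eq)

lemma C2_continuous:
  assumes "f \<in> Ck 2"
  shows "periodic (pdiff i (pdiff i f))" "continuous_on UNIV (pdiff i (pdiff i f))"
  using C1dir_periodic_pdiff[OF Ck2_C1dir_pdiff[OF assms]] C1dir_cont_pdiff[OF Ck2_C1dir_pdiff[OF assms]] by auto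

lemmas Vi_C1 = Ck2_C1dir_pdiff[OF V] and Wi_C1 = Ck2_C1dir_pdiff[OF W]

lemma cWi_C1: "C1dir j (conv (pdiff i W) f)" "pdiff j (conv (pdiff i W) f) = conv (pdiff j (pdiff i W)) f"
  if "integrable torus f" for f :: "real^'d \<Rightarrow> 'b::{banach,second_countable_topology}"
  using C1dir_conv[OF Wi_C1 that] pdiff_conv[OF Wi_C1 that] by auto

lemma cWii_continuous:
  "periodic (conv (pdiff i (pdiff i W)) \<mu>)" "continuous_on UNIV (conv (pdiff i (pdiff i W)) \<mu>)"
  by (rule conv_periodic[OF C2_continuous(1)[OF W]], rule conv_continuous[OF C2_continuous[OF W] \<mu>_int])

lemma clin_lower_order: "clin lower_order"
proof -
  have b: "clin base" "clin (deriv_base i)" for i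
    unfolding base_def deriv_base_def by (rule clin_dmul[OF base_bounds(1)] clin_dmul[OF base_bounds(2)])+
  have m: "clin (mlt a)" if "periodic a" "continuous_on UNIV a" for a :: "real^'d \<Rightarrow> real"
    by (rule clin_fop_mult[OF that])
  have m1: "clin (mlt a)" if "C1dir i a" for a :: "real^'d \<Rightarrow> real" and i
    by (rule m[OF C1dir_periodic[OF that] C1dir_cont[OF that]])
  have c: "clin (fop (conv w))" if "periodic w" "continuous_on UNIV w" for w :: "real^'d \<Rightarrow> real"
    by (rule clin_fop_conv[OF that])
  note ms = m[OF C2_continuous[OF V]] m1[OF Vi_C1] m[OF cWii_continuous] m1[OF cWi_C1(1)[OF \<mu>_int]]
    m[OF C1dir_periodic_pdiff[OF \<mu>_C1] C1dir_cont_pdiff[OF \<mu>_C1]] m1[OF \<mu>_C1]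
    c[OF C1dir_periodic[OF Wi_C1] C1dir_cont[OF Wi_C1]] c[OF C2_continuous[OF W]]
  show ?thesis
    unfolding lower_order_def[abs_def]
    by (intro clin_sum clin_add clin_compose[OF ms(1) b(1)] clin_compose[OF ms(2) b(2)] clin_compose[OF ms(3) b(1)]
        clin_compose[OF ms(4) b(2)] clin_compose[OF ms(5) clin_compose[OF ms(7) b(1)]]
        clin_compose[OF ms(6) clin_compose[OF ms(8) b(1)]])
qed

text \<open>By the product rule only \<sigma> times the pure second derivatives is of order two, and
  it yields the diagonal part. Derivatives of a convolution fall on \<open>W\<close>, so those terms
  cost \<open>y\<close> no regularity.\<close>

lemma McKV_lin_fourier:
  assumes y: "y \<in> Wkp 2 2"
  shows "McKV_lin \<sigma> V W \<mu> y \<in> L2p"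
    and "pencil lower_order freq1 (freq2 \<sigma>) z (fhat y) (fhat (\<lambda>x. z * y x - McKV_lin \<sigma> V W \<mu> y x))"
proof -
  have yL: "y \<in> L2p" by (rule Wkp_wd(1)[OF y])
  obtain D E where D: "\<And>i. wd i y (D i)" and E: "\<And>i. wd i (D i) (E i)" using Wkp_wd(2)[OF y] by blast
  have DL: "D i \<in> L2p" and EL: "E i \<in> L2p" for i using D E by (auto simp: wd_def)
  define F1 where "F1 i x = \<sigma> *\<^sub>R wpdiff i y x + pdiff i V x *\<^sub>R y x" for i x
  define F2 where "F2 i x = conv (pdiff i W) \<mu> x *\<^sub>R y x + \<mu> x *\<^sub>R conv (pdiff i W) y x" for i x
  define g1 where "g1 i x = \<sigma> *\<^sub>R E i x + (pdiff i (pdiff i V) x *\<^sub>R y x + pdiff i V x *\<^sub>R D i x)" for i x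
  define g2 where "g2 i x = (conv (pdiff i (pdiff i W)) \<mu> x *\<^sub>R y x + conv (pdiff i W) \<mu> x *\<^sub>R D i x)
     + (pdiff i \<mu> x *\<^sub>R conv (pdiff i W) y x + \<mu> x *\<^sub>R conv (pdiff i (pdiff i W)) y x)" for i x
  \<comment> \<open>\<open>wpdiff i y\<close> and \<open>D i\<close> have the same coefficients, and
    \<open>wd\<close> sees nothing else beyond membership in \<open>L2p\<close>.\<close>
  have wE: "wd i (wpdiff i y) (E i)" for i
    using wd_wpdiff(1)[OF D] D E unfolding wd_def by metis
  note cy = cWi_C1[OF L2p_integrable[OF yL]]
  have w1: "wd i (F1 i) (g1 i)" for i
    unfolding F1_def g1_def by (rule wd_add[OF wd_scaleR[OF wE] wd_mult[OF Vi_C1 D]])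
  have w2: "wd i (F2 i) (g2 i)" for i
    using wd_add[OF wd_mult[OF cWi_C1(1)[OF \<mu>_int] D[of i]] wd_mult[OF \<mu>_C1 wd_C1dir[OF cy(1)]]]
    unfolding F2_def g2_def cy(2) cWi_C1(2)[OF \<mu>_int] .
  have T: "McKV_lin \<sigma> V W \<mu> y = (\<lambda>x. (\<Sum>i\<in>UNIV. wpdiff i (F1 i) x) + (\<Sum>i\<in>UNIV. wpdiff i (F2 i) x))"
    unfolding McKV_lin_def wdiv_def F1_def[abs_def] F2_def[abs_def] ..
  have wL: "wpdiff i (F1 i) \<in> L2p" "wpdiff i (F2 i) \<in> L2p" for i
    using wd_wpdiff(1)[OF w1] wd_wpdiff(1)[OF w2] by (auto simp: wd_def)
  have wfc: "fc (wpdiff i (F1 i)) k = fc (g1 i) k" "fc (wpdiff i (F2 i)) k = fc (g2 i) k" for i k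
    using wd_wpdiff(1)[OF w1] w1 wd_wpdiff(1)[OF w2] w2 unfolding wd_def by metis+
  show TL: "McKV_lin \<sigma> V W \<mu> y \<in> L2p"
    unfolding T by (intro L2p_add L2p_sum wL)
  \<comment> \<open>|k_i| equals - \<i> sgn(k_i) times \<i> k_i: bounded sign multipliers applied to
    the first derivatives show that \<open>freq1\<close> times the coefficients of \<open>y\<close>
    is square-summable.\<close>
  define h where "h = fhat y + (\<Sum>i\<in>UNIV. dmul (\<lambda>k. - \<i> * of_int (sgn (k $ i))) (fhat (D i)))"
  have sgn_bound: "cmod (- \<i> * of_int (sgn (k $ i))) \<le> 1" for k :: "int^'d" and i
    by (simp add: norm_mult sgn_if)
  have h: "cf h k = of_real (freq1 k) * cf (fhat y) k" for k
  proof -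
    have e: "- \<i> * of_int (sgn (k $ i)) * fc (D i) k = of_real \<bar>real_of_int (k $ i)\<bar> * fc y k" for i
    proof -
      have "fc (D i) k = \<i> * of_int (k $ i) * fc y k" using D[of i] by (simp add: wd_def)
      then show ?thesis by (auto simp: sgn_if mult.assoc[symmetric])
    qed
    then show ?thesis
      unfolding h_def cf_arith cf_sum cf_dmul[OF sgn_bound] cf_fhat[OF yL] cf_fhat[OF DL] e
      by (simp add: freq1_def sum_distrib_right distrib_right)
  qed
  have nz: "complex_of_real (freq1 k) \<noteq> 0" for k :: "int^'d" using freq1_ge_1[of k] unfolding of_real_eq_0_iff by linarith
  have bh: "base h = fhat y"
    unfolding base_def using nz by (intro l2_eqI) (simp add: cf_dmul[OF base_bounds(1)] h)
  have dbh: "deriv_base i h = fhat (D i)" for i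
    unfolding deriv_base_def using nz D[of i] by (intro l2_eqI) (simp add: cf_dmul[OF base_bounds(2)] h cf_fhat yL DL wd_def)
  \<comment> \<open>The coefficients of y - \<sigma> times its Laplacian: the second domain witness
    of the pencil.\<close>
  define u where "u = fhat (\<lambda>x. y x + (\<Sum>i\<in>UNIV. (- \<sigma>) *\<^sub>R E i x))"
  have sE: "fc (\<lambda>x. \<Sum>i\<in>UNIV. c *\<^sub>R E i x) k = - of_real c * of_real (\<Sum>i\<in>UNIV. (real_of_int (k $ i))\<^sup>2) * fc y k" for c k
  proof -
    have "fc (E i) k = - of_real ((real_of_int (k $ i))\<^sup>2) * fc y k" for i
      using D[of i] E[of i] by (simp add: wd_def power2_eq_square algebra_simps)
    then show ?thesis
      by (subst fc_sum) (auto intro: L2p_integrable L2p_scaleR EL simp: fc_scaleR sum_distrib_left sum_distrib_right mult_ac sum_negf)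
  qed
  have u: "cf u k = of_real (1 + freq2 \<sigma> k) * cf (fhat y) k" for k
  proof -
    have sL: "(\<lambda>x. \<Sum>i\<in>UNIV. (- \<sigma>) *\<^sub>R E i x) \<in> L2p" by (intro L2p_sum L2p_scaleR EL)
    have "cf u k = fc y k + fc (\<lambda>x. \<Sum>i\<in>UNIV. (- \<sigma>) *\<^sub>R E i x) k"
      unfolding u_def cf_fhat[OF L2p_add[OF yL sL]] by (rule fc_add[OF L2p_integrable[OF yL] L2p_integrable[OF sL]])
    then show ?thesis unfolding sE by (simp add: cf_fhat yL freq2_def distrib_right)
  qed
  have fT: "fc (McKV_lin \<sigma> V W \<mu> y) k = - of_real (freq2 \<sigma> k) * fc y k + cf (lower_order h) k" for k
  proof -
    have i: "integrable torus (wpdiff i (F1 i))" "integrable torus (wpdiff i (F2 i))" for i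
      using wL L2p_integrable by auto
    have "fc (McKV_lin \<sigma> V W \<mu> y) k = (\<Sum>i\<in>UNIV. fc (g1 i) k) + (\<Sum>i\<in>UNIV. fc (g2 i) k)"
      unfolding T by (subst fc_add) (auto simp: fc_sum i wfc)
    also have "\<dots> = (\<Sum>i\<in>UNIV. fc (\<lambda>x. \<sigma> *\<^sub>R E i x) k) + (\<Sum>i\<in>UNIV. fc (\<lambda>x. pdiff i (pdiff i V) x *\<^sub>R y x + pdiff i V x *\<^sub>R D i x) k + fc (g2 i) k)"
    proof -
      have "fc (g1 i) k = fc (\<lambda>x. \<sigma> *\<^sub>R E i x) k + fc (\<lambda>x. pdiff i (pdiff i V) x *\<^sub>R y x + pdiff i V x *\<^sub>R D i x) k" for i
        unfolding g1_def
        by (intro fc_add L2p_integrable L2p_scaleR EL L2p_add real_mult_L2p C2_continuous[OF V] C1dir_periodic[OF Vi_C1] C1dir_cont[OF Vi_C1] yL DL)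
      then show ?thesis by (simp add: sum.distrib)
    qed
    also have "(\<Sum>i\<in>UNIV. fc (\<lambda>x. \<sigma> *\<^sub>R E i x) k) = - of_real (freq2 \<sigma> k) * fc y k"
      using sE[of \<sigma> k] by (subst (asm) fc_sum) (auto intro: L2p_integrable L2p_scaleR EL simp: freq2_def)
    also have "(\<Sum>i\<in>UNIV. fc (\<lambda>x. pdiff i (pdiff i V) x *\<^sub>R y x + pdiff i V x *\<^sub>R D i x) k + fc (g2 i) k) = cf (lower_order h) k"
    proof -
      have mL: "(\<lambda>x. a x *\<^sub>R f x) \<in> L2p \<and> fc (\<lambda>x. a x *\<^sub>R f x) k = cf (mlt a (fhat f)) k"
        if "periodic a" "continuous_on UNIV a" "f \<in> L2p" for a and f :: "real^'d \<Rightarrow> complex"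
        using real_mult_L2p[OF that] fop_mult[OF that] by (simp add: cf_fhat)
      have cL: "conv w y \<in> L2p" "fhat (conv w y) = fop (conv w) (fhat y)"
        if "periodic w" "continuous_on UNIV w" for w :: "real^'d \<Rightarrow> real"
        using conv_L2p[OF that yL] fop_conv[OF that yL] by auto
      note c1 = cL[OF C1dir_periodic[OF Wi_C1] C1dir_cont[OF Wi_C1]] and c2 = cL[OF C2_continuous[OF W]]
      note m1 = mL[OF C2_continuous[OF V] yL] and m2 = mL[OF C1dir_periodic[OF Vi_C1] C1dir_cont[OF Vi_C1] DL]
        and m3 = mL[OF cWii_continuous yL] and m4 = mL[OF C1dir_periodic[OF cWi_C1(1)[OF \<mu>_int]] C1dir_cont[OF cWi_C1(1)[OF \<mu>_int]] DL]
        and m5 = mL[OF C1dir_periodic_pdiff[OF \<mu>_C1] C1dir_cont_pdiff[OF \<mu>_C1] c1(1)]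
        and m6 = mL[OF C1dir_periodic[OF \<mu>_C1] C1dir_cont[OF \<mu>_C1] c2(1)]
      have "fc (\<lambda>x. pdiff i (pdiff i V) x *\<^sub>R y x + pdiff i V x *\<^sub>R D i x) k + fc (g2 i) k
        = cf ((mlt (pdiff i (pdiff i V)) (fhat y) + mlt (pdiff i V) (fhat (D i)))
     + ((mlt (conv (pdiff i (pdiff i W)) \<mu>) (fhat y) + mlt (conv (pdiff i W) \<mu>) (fhat (D i)))
       + (mlt (pdiff i \<mu>) (fop (conv (pdiff i W)) (fhat y)) + mlt \<mu> (fop (conv (pdiff i (pdiff i W))) (fhat y))))) k" for i
      proof -
        note ms = m1[of i] m2[of i i] m3[of i] m4[of i i] m5[of i i] m6[of i]
        note L = ms(1)[THEN conjunct1] ms(2)[THEN conjunct1] ms(3)[THEN conjunct1] ms(4)[THEN conjunct1]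
          ms(5)[THEN conjunct1] ms(6)[THEN conjunct1]
        note Q = ms(1)[THEN conjunct2] ms(2)[THEN conjunct2] ms(3)[THEN conjunct2] ms(4)[THEN conjunct2]
          ms(5)[THEN conjunct2] ms(6)[THEN conjunct2]
        note I = L[THEN L2p_integrable]
        note I34 = L2p_integrable[OF L2p_add[OF L(3,4)]] and I56 = L2p_integrable[OF L2p_add[OF L(5,6)]]
        show ?thesis
          unfolding g2_def fc_add[OF I34 I56] fc_add[OF I(1,2)] fc_add[OF I(3,4)] fc_add[OF I(5,6)] Q c1(2) c2(2) cf_arith ..
      qed
      then show ?thesis unfolding lower_order_def bh dbh cf_sum by simp
    qed
    finally show ?thesis .
  qed
  have "cf (fhat (\<lambda>x. z * y x - McKV_lin \<sigma> V W \<mu> y x)) k = (z + of_real (freq2 \<sigma> k)) * cf (fhat y) k - cf (lower_order h) k" for k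
    using fT[of k] yL TL by (simp add: cf_fhat L2p_diff L2p_cmult fc_diff L2p_integrable fc_cmult algebra_simps)
  then show "pencil lower_order freq1 (freq2 \<sigma>) z (fhat y) (fhat (\<lambda>x. z * y x - McKV_lin \<sigma> V W \<mu> y x))"
    unfolding pencil_def using h u by blast
qed

section \<open>Comparison of the weighted norm with the coefficient norm\<close>

lemma density_bounds:
  obtains m M where "m > 0" "M > 0"
    "\<And>x a. 0 \<le> a \<Longrightarrow> 0 \<le> a * inverse (\<mu> x) \<and> a * inverse (\<mu> x) \<le> inverse m * a \<and> a \<le> M * (a * inverse (\<mu> x))"
proof -
  obtain M where M: "M > 0" "\<And>x. norm (\<mu> x) \<le> M"
    using continuous_periodic_bounded[OF C1dir_periodic[OF \<mu>_C1] C1dir_cont[OF \<mu>_C1]] by blast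
  obtain m where m: "m > 0" "\<And>x. m \<le> \<mu> x" using stationary_state_props(3)[OF V W stationary] by blast
  show thesis
  proof (rule that[OF m(1) M(1)], intro conjI)
    fix x and a :: real
    assume a: "0 \<le> a"
    have \<mu>x: "0 < \<mu> x" "\<mu> x \<le> M" using m(1) m(2)[of x] M(2)[of x] by auto
    show "0 \<le> a * inverse (\<mu> x)" using a \<mu>x by simp
    show "a * inverse (\<mu> x) \<le> inverse m * a"
      using a m(1) m(2)[of x] by (subst mult.commute) (intro mult_right_mono le_imp_inverse_le; simp)
    have "a * \<mu> x \<le> a * M" using a \<mu>x by (intro mult_left_mono) auto
    then show "a \<le> M * (a * inverse (\<mu> x))" using \<mu>x by (simp add: field_simps)
  qed
qed

lemma \<mu>_borel [measurable]: "\<mu> \<in> borel_measurable borel"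
  by (intro borel_measurable_continuous_onI C1dir_cont[OF \<mu>_C1])

lemma X_space_L2p: "X_space \<mu> \<subseteq> L2p"
proof
  fix f assume f: "f \<in> X_space \<mu>"
  obtain m M where "m > 0" "M > 0"
    and b: "\<And>x a. 0 \<le> a \<Longrightarrow> 0 \<le> a * inverse (\<mu> x) \<and> a * inverse (\<mu> x) \<le> inverse m * a \<and> a \<le> M * (a * inverse (\<mu> x))"
    using density_bounds by metis
  have [measurable]: "f \<in> borel_measurable borel" using f by (simp add: X_space_def)
  have "integrable torus (\<lambda>x. M * ((cmod (f x))\<^sup>2 * inverse (\<mu> x)))" using f by (simp add: X_space_def)
  then have "integrable torus (\<lambda>x. (cmod (f x))\<^sup>2)"
  proof (rule Bochner_Integration.integrable_bound)
    have "norm ((cmod (f x))\<^sup>2) \<le> norm (M * ((cmod (f x))\<^sup>2 * inverse (\<mu> x)))" for x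
      unfolding real_norm_def abs_of_nonneg[OF zero_le_power2]
      using b[of "(cmod (f x))\<^sup>2" x] by (intro order_trans[OF _ abs_ge_self]) simp
    then show "AE x in torus. norm ((cmod (f x))\<^sup>2) \<le> norm (M * ((cmod (f x))\<^sup>2 * inverse (\<mu> x)))"
      by simp
  qed measurable
  then show "f \<in> L2p" using f by (simp add: X_space_def L2p_def)
qed

lemma X_norm_eq: "X_norm \<mu> f = sqrt (LINT x|torus. (cmod (f x))\<^sup>2 * inverse (\<mu> x))"
proof -
  have "X_inner \<mu> f f = (LINT x|torus. complex_of_real ((cmod (f x))\<^sup>2 * inverse (\<mu> x)))"
    unfolding X_inner_def by (simp add: complex_norm_square[symmetric])
  then show ?thesis by (simp only: X_norm_def integral_complex_of_real Re_complex_of_real)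
qed

lemma X_norm_equiv:
  obtains a b where "a > 0" "b > 0" "\<And>f. f \<in> L2p \<Longrightarrow> X_norm \<mu> f \<le> a * norm (fhat f)"
    "\<And>f. f \<in> L2p \<Longrightarrow> norm (fhat f) \<le> b * X_norm \<mu> f"
proof -
  let ?v = "vol TYPE('d)"
  obtain m M where m: "m > 0" and M: "M > 0"
    and b: "\<And>x a. 0 \<le> a \<Longrightarrow> 0 \<le> a * inverse (\<mu> x) \<and> a * inverse (\<mu> x) \<le> inverse m * a \<and> a \<le> M * (a * inverse (\<mu> x))"
    using density_bounds by metis
  note b = b[OF zero_le_power2]
  have two: "(X_norm \<mu> f)\<^sup>2 \<le> ?v / m * (norm (fhat f))\<^sup>2" "?v * (norm (fhat f))\<^sup>2 \<le> M * (X_norm \<mu> f)\<^sup>2" "X_norm \<mu> f \<ge> 0"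
    if f: "f \<in> L2p" for f
  proof -
    have [measurable]: "f \<in> borel_measurable borel" by (rule L2p_borel[OF f])
    define S where "S = (LINT x|torus. (cmod (f x))\<^sup>2 * inverse (\<mu> x))"
    have i1: "integrable torus (\<lambda>x. inverse m * (cmod (f x))\<^sup>2)" using L2p_sq[OF f] by simp
    have int: "integrable torus (\<lambda>x. (cmod (f x))\<^sup>2 * inverse (\<mu> x))"
    proof (rule Bochner_Integration.integrable_bound[OF i1])
      have "norm ((cmod (f x))\<^sup>2 * inverse (\<mu> x)) \<le> norm (inverse m * (cmod (f x))\<^sup>2)" for x
        unfolding real_norm_def using b[of "cmod (f x)" x] by linarith
      then show "AE x in torus. norm ((cmod (f x))\<^sup>2 * inverse (\<mu> x)) \<le> norm (inverse m * (cmod (f x))\<^sup>2)" by simp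
    qed measurable
    have S0: "S \<ge> 0" unfolding S_def using b by (intro Bochner_Integration.integral_nonneg) simp
    then show "X_norm \<mu> f \<ge> 0" unfolding X_norm_eq S_def by simp
    have S: "(X_norm \<mu> f)\<^sup>2 = S" using S0 unfolding X_norm_eq S_def by simp
    have "S \<le> (LINT x|torus. inverse m * (cmod (f x))\<^sup>2)"
      unfolding S_def using b by (intro integral_mono int i1) simp
    then show "(X_norm \<mu> f)\<^sup>2 \<le> ?v / m * (norm (fhat f))\<^sup>2"
      using S parseval_norm[OF f] by (simp add: divide_inverse mult_ac)
    have "(LINT x|torus. (cmod (f x))\<^sup>2) \<le> (LINT x|torus. M * ((cmod (f x))\<^sup>2 * inverse (\<mu> x)))"
      using b by (intro integral_mono L2p_sq[OF f] integrable_mult_right int) simp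
    then show "?v * (norm (fhat f))\<^sup>2 \<le> M * (X_norm \<mu> f)\<^sup>2"
      unfolding S parseval_norm[OF f] by (simp add: S_def)
  qed
  have v: "?v > 0" by (rule vol_pos)
  show thesis
  proof (rule that[of "sqrt (?v / m)" "sqrt (M / ?v)"])
    show "sqrt (?v / m) > 0" "sqrt (M / ?v) > 0" using v m M by auto
    show "X_norm \<mu> f \<le> sqrt (?v / m) * norm (fhat f)" if "f \<in> L2p" for f
    proof (rule power2_le_imp_le)
      show "(X_norm \<mu> f)\<^sup>2 \<le> (sqrt (?v / m) * norm (fhat f))\<^sup>2"
        using two(1)[OF that] v m by (simp add: power_mult_distrib)
    qed (use v m in auto)
    show "norm (fhat f) \<le> sqrt (M / ?v) * X_norm \<mu> f" if "f \<in> L2p" for f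
    proof (rule power2_le_imp_le)
      show "(norm (fhat f))\<^sup>2 \<le> (sqrt (M / ?v) * X_norm \<mu> f)\<^sup>2"
        using two(2)[OF that] v M by (simp add: power_mult_distrib field_simps)
    qed (use v M two(3)[OF that] in auto)
  qed
qed

end

section \<open>From the coefficient pencil to the resolvent set\<close>

lemma pencil_unique: "pencil B p q z v f \<Longrightarrow> pencil B p q z v g \<Longrightarrow> f = g"
  unfolding pencil_def by (auto intro!: l2_eqI) (metis l2_eqI)

lemma pencil_diff:
  assumes "clin B" "pencil B p q z v f" "pencil B p q z w g"
  shows "pencil B p q z (v - w) (f - g)"
proof -
  obtain h u where 1: "\<And>k. cf h k = of_real (p k) * cf v k" "\<And>k. cf u k = of_real (1 + q k) * cf v k"
    "\<And>k. cf f k = (z + of_real (q k)) * cf v k - cf (B h) k"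
    using assms(2) unfolding pencil_def by blast
  obtain h' u' where 2: "\<And>k. cf h' k = of_real (p k) * cf w k" "\<And>k. cf u' k = of_real (1 + q k) * cf w k"
    "\<And>k. cf g k = (z + of_real (q k)) * cf w k - cf (B h') k"
    using assms(3) unfolding pencil_def by blast
  show ?thesis
    unfolding pencil_def
    by (rule exI[of _ "h - h'"], rule exI[of _ "u - u'"]) (simp add: 1 2 clin_minus[OF assms(1)] algebra_simps)
qed

lemma fhat_eq_iff_AE:
  assumes "f \<in> L2p" "g \<in> L2p"
  shows "fhat f = fhat g \<longleftrightarrow> (AE x in torus. f x = g x)"
proof
  assume "fhat f = fhat g"
  then have "fc f k = fc g k" for k using cf_fhat[OF assms(1), of k] cf_fhat[OF assms(2), of k] by simp
  then show "AE x in torus. f x = g x" using assms by (intro fc_inject L2p_integrable)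
next
  assume "AE x in torus. f x = g x"
  then have "fc f k = fc g k" for k using assms by (intro fc_cong_AE L2p_measurable)
  then show "fhat f = fhat g" using assms by (intro l2_eqI) (simp add: cf_fhat)
qed

context mckean_vlasov
begin

text \<open>The a priori bound gives injectivity and, through the equivalence of norms, the bounded
  inverse. Solvability on coefficients gives surjectivity after synthesis.\<close>

lemma resolvent_setI:
  assumes bound: "\<And>v f. pencil lower_order freq1 (freq2 \<sigma>) z v f \<Longrightarrow> norm v \<le> C * norm f"
    and surj: "\<And>f. \<exists>v. pencil lower_order freq1 (freq2 \<sigma>) z v f"
  shows "z \<in> resolvent_set (X_space \<mu>) (X_norm \<mu>) (Wkp 2 2) (McKV_lin \<sigma> V W \<mu>)"
  unfolding resolvent_set_def
proof (intro CollectI conjI ballI impI)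
  let ?R = "\<lambda>y x. z * y x - McKV_lin \<sigma> V W \<mu> y x"
  have RL: "?R y \<in> L2p" if "y \<in> Wkp 2 2" for y
    by (intro L2p_diff L2p_cmult McKV_lin_fourier(1) Wkp_wd(1) that)
  note pen = McKV_lin_fourier(2)[where z = z]
  {
    fix y y' :: "real^'d \<Rightarrow> complex"
    assume y: "y \<in> Wkp 2 2" "y' \<in> Wkp 2 2" and eq: "AE x in torus. ?R y x = ?R y' x"
    have "fhat (?R y) = fhat (?R y')" using eq RL y by (simp add: fhat_eq_iff_AE)
    \<comment> \<open>The difference solves the homogeneous pencil, so the a priori bound forces it
      to vanish.\<close>
    then have "norm (fhat y - fhat y') \<le> C * norm (0 :: (int^'d) l2)"
      using bound[OF pencil_diff[OF clin_lower_order pen[OF y(1)] pen[OF y(2)]]] by simp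
    then show "AE x in torus. y x = y' x" using fhat_eq_iff_AE[OF Wkp_wd(1)[OF y(1)] Wkp_wd(1)[OF y(2)]] by simp
  next
    fix f assume "f \<in> X_space \<mu>"
    then have f: "f \<in> L2p" using X_space_L2p by blast
    obtain v where v: "pencil lower_order freq1 (freq2 \<sigma>) z v (fhat f)" using surj by blast
    \<comment> \<open>The domain witness of the pencil is what places the synthesized function in
      H^2.\<close>
    then obtain u where u: "\<And>k. cf u k = of_real (1 + freq2 \<sigma> k) * cf v k" unfolding pencil_def by blast
    have y: "synth v \<in> Wkp 2 2" by (rule synth_Wkp[OF \<sigma>_pos u])
    have "fhat (?R (synth v)) = fhat f"
      using pencil_unique[OF pen[OF y]] v by (simp add: synth)
    then have "AE x in torus. ?R (synth v) x = f x" using fhat_eq_iff_AE[OF RL[OF y] f] by simp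
    then show "\<exists>y\<in>Wkp 2 2. AE x in torus. ?R y x = f x" using y by blast
  }
  obtain a b where ab: "a > 0" "b > 0" "\<And>f. f \<in> L2p \<Longrightarrow> X_norm \<mu> f \<le> a * norm (fhat f)"
    "\<And>f. f \<in> L2p \<Longrightarrow> norm (fhat f) \<le> b * X_norm \<mu> f"
    using X_norm_equiv by metis
  have "X_norm \<mu> y \<le> (a * \<bar>C\<bar> * b) * X_norm \<mu> (?R y)" if y: "y \<in> Wkp 2 2" for y
  proof -
    have "X_norm \<mu> y \<le> a * norm (fhat y)" by (rule ab(3)[OF Wkp_wd(1)[OF y]])
    also have "\<dots> \<le> a * (\<bar>C\<bar> * norm (fhat (?R y)))"
      using bound[OF pen[OF y]] mult_right_mono[OF abs_ge_self[of C] norm_ge_zero[of "fhat (?R y)"]] ab(1)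
      by (intro mult_left_mono) linarith+
    also have "\<dots> \<le> a * (\<bar>C\<bar> * (b * X_norm \<mu> (?R y)))"
      using ab(1) ab(4)[OF RL[OF y]] by (intro mult_left_mono) auto
    finally show ?thesis by (simp add: mult.assoc)
  qed
  then show "\<exists>C. \<forall>y\<in>Wkp 2 2. X_norm \<mu> y \<le> C * X_norm \<mu> (?R y)" by blast
qed

theorem spectrum_right_half_plane_finite:
  assumes "\<delta> > 0"
  shows "finite {z \<in> McKV_spectrum \<sigma> V W \<mu>. Re z \<ge> - \<delta>}"
proof -
  have "freq2 \<sigma> k \<ge> 0" for k :: "int^'d" using \<sigma>_pos by (simp add: freq2_def sum_nonneg)
  then obtain E where E: "finite E" "\<And>z. Re z \<ge> - \<delta> \<Longrightarrow> z \<notin> E \<Longrightarrow>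
    (\<exists>C. \<forall>v f. pencil lower_order freq1 (freq2 \<sigma>) z v f \<longrightarrow> norm v \<le> C * norm f) \<and>
    (\<forall>f. \<exists>v. pencil lower_order freq1 (freq2 \<sigma>) z v f)"
    using diagonal_perturbation_spectrum_finite[OF clin_lower_order freq1_ge_1 _ freq_small[OF \<sigma>_pos] assms] by metis
  have "z \<in> E" if z: "z \<in> McKV_spectrum \<sigma> V W \<mu>" "Re z \<ge> - \<delta>" for z
  proof (rule ccontr)
    assume "z \<notin> E"
    with E(2)[OF z(2)] obtain C where "\<forall>v f. pencil lower_order freq1 (freq2 \<sigma>) z v f \<longrightarrow> norm v \<le> C * norm f"
      and "\<forall>f. \<exists>v. pencil lower_order freq1 (freq2 \<sigma>) z v f" by blast
    then have "z \<in> resolvent_set (X_space \<mu>) (X_norm \<mu>) (Wkp 2 2) (McKV_lin \<sigma> V W \<mu>)"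
      by (intro resolvent_setI) blast+
    then show False using z(1) by (simp add: McKV_spectrum_def spectrum_of_def)
  qed
  then show ?thesis by (intro finite_subset[OF _ E(1)]) blast
qed

end

theorem lemma2p12:
  fixes V W \<mu> :: "real^'d::finite \<Rightarrow> real" and \<sigma> \<epsilon> \<delta> :: real
  assumes "\<sigma> > 0"
    and "\<epsilon> > 0"
    and "V \<in> Wkp 1 \<infinity>" and "V \<in> Wkp 2 (ereal (max (real CARD('d)) (2 + \<epsilon>)))"
    and "W \<in> Wkp 2 \<infinity>" and "even_each_coordinate W"
    and "V \<in> Ck 2" and "W \<in> Ck 2"
    and "H_stable W \<or> esssup torus (\<lambda>x. ereal \<bar>W x\<bar>) < ereal \<sigma>"
    and "stationary_state \<sigma> V W \<mu>"
    and "\<delta> > 0"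
  shows "finite {z \<in> McKV_spectrum \<sigma> V W \<mu>. Re z \<ge> - \<delta>}"
proof -
  interpret mckean_vlasov \<sigma> V W \<mu> by unfold_locales fact+
  show ?thesis by (rule spectrum_right_half_plane_finite) fact
qed

end
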